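(* Fix a constant $\varepsilon>0$. For each $n$ let $p=p_n\in[0,1/2]$ satisfy $p\ge (1+\varepsilon)\log n/n$, let $G_0$ be any graph on the vertex set $\{1,\dots,n\}$, and let $G_{\mathrm{rand}}\sim\mathbb G(n,p)$. Then with high probability the colour refinement algorithm distinguishes all vertices of $G_0\triangle G_{\mathrm{rand}}$ from each other, i.e. the stable colouring $\mathcal R^*\sigma$ of $G=G_0\triangle G_{\mathrm{rand}}$ assigns pairwise distinct colours to all vertices. In particular, with high probability $G_0\triangle G_{\mathrm{rand}}$ can be tested for isomorphism with any other graph in polynomial time.
   Context: $\mathbb G(n,p)$ is the random graph on $\{1,\dots,n\}$ in which each of the $\binom n2$ possible edges is present independently with probability $p$. "With high probability" (whp) means with probability tending to $1$ as $n\to\infty$. For graphs $G,G'$ on the same vertex set, $G\triangle G'$ is the graph whose edges are those lying in exactly one of $G,G'$. Colour refinement: for a graph $G$ and a colouring $c:V(G)\to\Omega$, the refinement $\mathcal R_Gc$ is the colouring $v\mapsto (c(v),(d_\omega(v))_{\omega\in\Omega})$, where $d_\omega(v)$ is the number of neighbours of $v$ of colour $\omega$. Iterating $\mathcal R_G$ starting from $c$, after at most $|V(G)|$ steps the induced vertex partition stops changing; the resulting colouring is the stable colouring $\mathcal R_G^*c$. $\sigma$ denotes the trivial colouring giving every vertex the same colour. *)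

theory Defs
  imports "HOL-Probability.Probability" "HOL-Computational_Algebra.Polynomial"
begin

section \<open>Graphs and random graphs\<close>

text \<open>A simple graph on \<open>{1..n}\<close> is given by its edge set, a subset of \<open>all_edges n\<close>;
  with this representation the graph \<open>G \<triangle> G'\<close> is \<open>sym_diff G G'\<close>.\<close>

definition all_edges :: "nat \<Rightarrow> nat set set" where
  "all_edges n = {e. e \<subseteq> {1..n} \<and> card e = 2}"

definition neighbours :: "'v set set \<Rightarrow> 'v \<Rightarrow> 'v set" where
  "neighbours E v = {u. {v, u} \<in> E}"

definition graph_iso :: "'v set \<Rightarrow> 'v set set \<Rightarrow> 'w set \<Rightarrow> 'w set set \<Rightarrow> bool" where
  "graph_iso V E W F \<longleftrightarrow>
     (\<exists>f. bij_betw f V W \<and> (\<forall>u\<in>V. \<forall>v\<in>V. {u, v} \<in> E \<longleftrightarrow> {f u, f v} \<in> F))"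

definition random_graph :: "nat \<Rightarrow> real \<Rightarrow> nat set set pmf" where
  "random_graph n p =
     map_pmf (\<lambda>f. {e \<in> all_edges n. f e}) (Pi_pmf (all_edges n) False (\<lambda>_. bernoulli_pmf p))"

definition whp :: "(nat \<Rightarrow> 'a pmf) \<Rightarrow> (nat \<Rightarrow> 'a \<Rightarrow> bool) \<Rightarrow> bool" where
  "whp M P \<longleftrightarrow> (\<lambda>n. measure_pmf.prob (M n) {x. P n x}) \<longlonglongrightarrow> 1"


section \<open>Colour refinement\<close>

text \<open>Each refinement step enlarges the set of colours, so one type containing all iterated
  colours is needed. The family \<open>(d\<^sub>\<omega>)\<^sub>\<omega>\<close> has finite support and is represented by a multiset
  in which \<open>\<omega>\<close> has multiplicity \<open>d\<^sub>\<omega>\<close>.\<close>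

datatype 'o colour = Colour 'o | Refined "'o colour" "'o colour multiset"

definition refine :: "'v set set \<Rightarrow> ('v \<Rightarrow> 'o colour) \<Rightarrow> 'v \<Rightarrow> 'o colour" where
  "refine E c v = Refined (c v) (image_mset c (mset_set (neighbours E v)))"

lemma refine_eq_iff:
  assumes "finite (neighbours E u)" "finite (neighbours E v)"
  shows "refine E c u = refine E c v \<longleftrightarrow>
    c u = c v \<and> (\<forall>\<omega>. card {w \<in> neighbours E u. c w = \<omega>} = card {w \<in> neighbours E v. c w = \<omega>})"
proof -
  have "count (image_mset c (mset_set A)) \<omega> = card {w \<in> A. c w = \<omega>}" if "finite A" for A \<omega>
    using that by (simp add: count_image_mset vimage_def Int_def conj_commute)
  then show ?thesis
    using assms by (auto simp: refine_def multiset_eq_iff)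
qed

definition colour_classes :: "'v set \<Rightarrow> ('v \<Rightarrow> 'c) \<Rightarrow> 'v set set" where
  "colour_classes V c = (\<lambda>u. {v \<in> V. c v = c u}) ` V"

definition stable_colouring ::
    "'v set \<Rightarrow> 'v set set \<Rightarrow> ('v \<Rightarrow> 'o colour) \<Rightarrow> 'v \<Rightarrow> 'o colour" where
  "stable_colouring V E c =
     (refine E ^^ (LEAST t. colour_classes V ((refine E ^^ Suc t) c)
                          = colour_classes V ((refine E ^^ t) c))) c"

definition trivial_colouring :: "'v \<Rightarrow> unit colour" where
  "trivial_colouring = (\<lambda>_. Colour ())"

definition distinguishes_all_vertices :: "'v set \<Rightarrow> 'v set set \<Rightarrow> bool" where
  "distinguishes_all_vertices V E \<longleftrightarrow> inj_on (stable_colouring V E trivial_colouring) V"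


section \<open>Polynomial time\<close>

text \<open>Structured programs for a unit-cost random access machine. The memory consists of arrays
  of natural numbers: \<open>s x i\<close> is cell \<open>i\<close> of array \<open>x\<close>, and a program can address only the
  finitely many arrays that it names. Each assignment and each test takes one unit of time. The
  expressions in a program have constant size, and the only arithmetic is addition and truncated
  subtraction; multiplication is left out because with it unit-cost time would not be
  polynomially equivalent to Turing machine time.\<close>

datatype aexp = N nat | Cell nat aexp | Plus aexp aexp | Minus aexp aexp

datatype bexp = Less aexp aexp | Not bexp | And bexp bexp

datatype com =
    Skip
  | Assign nat aexp aexp
  | Seq com com
  | If bexp com com
  | While bexp com

type_synonym memory = "nat \<Rightarrow> nat \<Rightarrow> nat"

fun aval :: "aexp \<Rightarrow> memory \<Rightarrow> nat" where
  "aval (N k) s = k"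
| "aval (Cell x a) s = s x (aval a s)"
| "aval (Plus a b) s = aval a s + aval b s"
| "aval (Minus a b) s = aval a s - aval b s"

fun bval :: "bexp \<Rightarrow> memory \<Rightarrow> bool" where
  "bval (Less a b) s \<longleftrightarrow> aval a s < aval b s"
| "bval (Not b) s \<longleftrightarrow> \<not> bval b s"
| "bval (And b c) s \<longleftrightarrow> bval b s \<and> bval c s"

text \<open>\<open>exec P s t s'\<close>: started in memory \<open>s\<close>, the program \<open>P\<close> halts after \<open>t\<close> steps in
  memory \<open>s'\<close>.\<close>

inductive exec :: "com \<Rightarrow> memory \<Rightarrow> nat \<Rightarrow> memory \<Rightarrow> bool" where
  Skip: "exec Skip s 1 s"
| Assign: "exec (Assign x a b) s 1 (s(x := (s x)(aval a s := aval b s)))"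
| Seq: "\<lbrakk>exec P s t s'; exec Q s' u s''\<rbrakk> \<Longrightarrow> exec (Seq P Q) s (t + u) s''"
| IfTrue: "\<lbrakk>bval b s; exec P s t s'\<rbrakk> \<Longrightarrow> exec (If b P Q) s (1 + t) s'"
| IfFalse: "\<lbrakk>\<not> bval b s; exec Q s t s'\<rbrakk> \<Longrightarrow> exec (If b P Q) s (1 + t) s'"
| WhileFalse: "\<not> bval b s \<Longrightarrow> exec (While b P) s 1 s"
| WhileTrue: "\<lbrakk>bval b s; exec P s t s'; exec (While b P) s' u s''\<rbrakk>
    \<Longrightarrow> exec (While b P) s (1 + t + u) s''"

text \<open>The input word is stored in array 0, all other cells being 0; the output is read off
  cell 0 of array 0.\<close>

definition initial_memory :: "nat list \<Rightarrow> memory" where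
  "initial_memory w = (\<lambda>x i. if x = 0 \<and> i < length w then w ! i else 0)"

definition adjacency_word :: "nat \<Rightarrow> nat set set \<Rightarrow> nat list" where
  "adjacency_word n E =
     concat (map (\<lambda>i. map (\<lambda>j. if {i, j} \<in> E then 1 else 0) [1..<Suc n]) [1..<Suc n])"

definition encode_pair :: "nat \<Rightarrow> nat set set \<Rightarrow> nat \<Rightarrow> nat set set \<Rightarrow> nat list" where
  "encode_pair n E m F = [n, m] @ adjacency_word n E @ adjacency_word m F"

text \<open>The program \<open>P\<close> correctly tests the graph \<open>E\<close> on \<open>{1..n}\<close> for isomorphism with any other
  graph, in time at most the polynomial \<open>q\<close> of the length of the input.\<close>

definition tests_isomorphism :: "com \<Rightarrow> nat poly \<Rightarrow> nat \<Rightarrow> nat set set \<Rightarrow> bool" where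
  "tests_isomorphism P q n E \<longleftrightarrow>
     (\<forall>m F. F \<subseteq> all_edges m \<longrightarrow>
        (\<exists>t s. exec P (initial_memory (encode_pair n E m F)) t s
             \<and> t \<le> poly q (length (encode_pair n E m F))
             \<and> s 0 0 = (if graph_iso {1..n} E {1..m} F then 1 else 0)))"

end

theory Submission
  imports Defs "HOL-Real_Asymp.Real_Asymp"
begin

text \<open>
  Let \<open>q = 2 * p * (1 - p)\<close>, the probability that exactly one of two given edges is random, so that
  \<open>q * n \<ge> 2 * (1 + \<kappa>) * ln n\<close> for some \<open>\<kappa> > 0\<close>. The partition into stable colour classes is
  equitable. If it is not discrete, let \<open>U\<close> be the union of its classes with at least two elements.
  One of four events occurs, and each of them is improbable.

  (1) \<open>U\<close> has at most \<open>\<delta> * n\<close> elements. Split \<open>U\<close> into blocks of two or three vertices of the same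
  class. Every vertex outside \<open>U\<close> is a class of its own and hence is joined to all or to none of
  the vertices of a block. For a block of size \<open>k\<close> this has probability at most
  \<open>exp (- k * q * (1 - \<delta>) * n / 2)\<close>, which beats the \<open>n ^ k\<close> choices of the block.

  (2) A class has linear size. Then quadratically many pairs of vertices have equal degrees, but two
  degrees coincide with probability \<open>o(1)\<close>; this follows by Fourier analysis modulo a large constant.

  (3) The classes with at least \<open>b = \<tau> * n / ln n\<close> elements cover a positive proportion of the
  vertices, but none has linear size, so there are at least \<open>K1\<close> of them, a large constant. All
  vertices of a class have degrees of the same parity into each of these \<open>K\<close> classes, which costs
  \<open>exp (- c * K * n)\<close>, whereas the classes can be chosen in only \<open>(K + 1) ^ n\<close> ways.

  (4) Otherwise put the smaller classes into \<open>O(ln n)\<close> groups of size at most \<open>2 * b\<close>, and choose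
  \<open>m\<close> disjoint pairs of equivalent vertices, where \<open>m\<close> is a small multiple of \<open>n\<close>. The two vertices
  of a pair have degrees of the same parity into each group. As the groups are small, this has
  probability about \<open>exp (- q * n)\<close> for each pair, which beats the \<open>n ^ (2 * m)\<close> choices of the pairs;
  the choice of the groups contributes only a factor \<open>O(ln n) ^ n\<close>.

  If the stable colouring of \<open>E\<close> is discrete, then \<open>E\<close> is isomorphic to a graph \<open>F\<close> with as many
  vertices if and only if after \<open>2 * n\<close> rounds of refinement every vertex of \<open>E\<close> shares its colour with
  a vertex of \<open>F\<close>. This is tested by running colour refinement on the disjoint union.
\<close>

section \<open>Independent blocks of coordinates\<close>

abbreviation prob :: "'a pmf \<Rightarrow> 'a set \<Rightarrow> real" where
  "prob M A \<equiv> measure (measure_pmf M) A"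

abbreviation expectation :: "'a pmf \<Rightarrow> ('a \<Rightarrow> real) \<Rightarrow> real" where
  "expectation M h \<equiv> integral\<^sup>L (measure_pmf M) h"

abbreviation coins :: "'a set \<Rightarrow> bool \<Rightarrow> real \<Rightarrow> ('a \<Rightarrow> bool) pmf" where
  "coins S d p \<equiv> Pi_pmf S d (\<lambda>_. bernoulli_pmf p)"

text \<open>Fubini with the second coordinate revealed first: where \<open>R h\<close> holds, the
  conditional probability is at most \<open>\<beta>\<close>; elsewhere it is 0.\<close>

lemma prob_pair_pmf_le:
  assumes \<beta>: "\<beta> \<ge> 0" and le: "\<And>h. R h \<Longrightarrow> prob M {g. Q g h} \<le> \<beta>"
    and QR: "\<And>g h. Q g h \<Longrightarrow> R h"
  shows "prob (pair_pmf M N') {(g, h). Q g h} \<le> \<beta> * prob N' {h. R h}"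
proof -
  have "pair_pmf M N' = bind_pmf N' (\<lambda>h. map_pmf (\<lambda>g. (g, h)) M)"
    by (subst pair_commute_pmf) (simp add: pair_pmf_def map_pmf_def bind_assoc_pmf bind_return_pmf)
  then have "emeasure (measure_pmf (pair_pmf M N')) {(g, h). Q g h}
      = (\<integral>\<^sup>+h. emeasure (measure_pmf M) {g. Q g h} \<partial>measure_pmf N')"
    by (simp add: vimage_def)
  also have "\<dots> \<le> (\<integral>\<^sup>+h. ennreal \<beta> * indicator {h. R h} h \<partial>measure_pmf N')"
  proof (intro nn_integral_mono)
    fix h
    show "emeasure (measure_pmf M) {g. Q g h} \<le> ennreal \<beta> * indicator {h. R h} h"
    proof (cases "R h")
      case True
      then show ?thesis using le[OF True] by (simp add: measure_pmf.emeasure_eq_measure ennreal_leI)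
    next
      case False
      then have "{g. Q g h} = {}" using QR by auto
      then show ?thesis by simp
    qed
  qed
  also have "\<dots> = ennreal (\<beta> * prob N' {h. R h})"
    using \<beta> by (simp add: nn_integral_cmult measure_pmf.emeasure_eq_measure ennreal_mult)
  finally show ?thesis
    using \<beta> by (simp add: measure_pmf.emeasure_eq_measure)
qed

definition merge_on :: "'a set \<Rightarrow> ('a \<Rightarrow> 'b) \<Rightarrow> ('a \<Rightarrow> 'b) \<Rightarrow> 'a \<Rightarrow> 'b" where
  "merge_on S g h = (\<lambda>x. if x \<in> S then g x else h x)"

text \<open>The coordinates outside \<open>S\<close> are revealed first. By \<open>inv\<close> they
  alone decide \<open>R\<close>, and whatever their values are, the coordinates in \<open>S\<close>
  satisfy \<open>E\<close> with probability at most \<open>\<beta>\<close>. So \<open>E\<close> may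
  depend on all coordinates.\<close>

lemma prob_Pi_pmf_split_le:
  assumes "finite A" "S \<subseteq> A" "\<beta> \<ge> 0"
    and le: "\<And>h. prob (Pi_pmf S d p) {g. E (merge_on S g h)} \<le> \<beta>"
    and inv: "\<And>g h. R (merge_on S g h) = R h"
  shows "prob (Pi_pmf A d p) {f. E f \<and> R f}
    \<le> \<beta> * prob (Pi_pmf (A - S) d p) {f. R f}"
proof -
  have "Pi_pmf A d p = map_pmf (\<lambda>(g, h). merge_on S g h) (pair_pmf (Pi_pmf S d p) (Pi_pmf (A - S) d p))"
    using Pi_pmf_union[of S "A - S" d p] assms(1,2)
    by (simp add: Un_absorb1 finite_subset merge_on_def)
  then have "prob (Pi_pmf A d p) {f. E f \<and> R f}
    = prob (pair_pmf (Pi_pmf S d p) (Pi_pmf (A - S) d p))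
        {(g, h). E (merge_on S g h) \<and> R h}"
    by (simp add: vimage_def case_prod_unfold inv)
  also have "\<dots> \<le> \<beta> * prob (Pi_pmf (A - S) d p) {f. R f}"
  proof (rule prob_pair_pmf_le)
    fix h assume "R h"
    then show "prob (Pi_pmf S d p) {g. E (merge_on S g h) \<and> R h} \<le> \<beta>"
      using le[of h] by simp
  qed (use assms in auto)
  finally show ?thesis .
qed

text \<open>The \<open>S k\<close> are disjoint blocks of coordinates, and \<open>E k\<close> may depend on \<open>S k\<close> and on the
  coordinates outside all blocks.\<close>

lemma prob_Pi_pmf_blocks_le:
  assumes "finite I" "finite A" "\<And>k. k \<in> I \<Longrightarrow> S k \<subseteq> A"
    and "\<And>k. k \<in> I \<Longrightarrow> \<beta> k \<ge> 0"
    and "\<And>k l. k \<in> I \<Longrightarrow> l \<in> I \<Longrightarrow> k \<noteq> l \<Longrightarrow> S k \<inter> S l = {}"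
    and "\<And>k h. k \<in> I \<Longrightarrow> prob (Pi_pmf (S k) d p) {g. E k (merge_on (S k) g h)} \<le> \<beta> k"
    and "\<And>k l g h. k \<in> I \<Longrightarrow> l \<in> I \<Longrightarrow> k \<noteq> l \<Longrightarrow> E k (merge_on (S l) g h) = E k h"
  shows "prob (Pi_pmf A d p) {f. \<forall>k\<in>I. E k f} \<le> (\<Prod>k\<in>I. \<beta> k)"
  using assms
proof (induction I arbitrary: A rule: finite_induct)
  case (insert k I)
  \<comment> \<open>The events of the other blocks ignore \<open>S k\<close> and serve as
    \<open>R\<close> when this block is split off. What remains lives on \<open>A - S k\<close>,
    which is why the induction varies \<open>A\<close>.\<close>
  have inv: "(\<forall>i\<in>I. E i (merge_on (S k) g h)) = (\<forall>i\<in>I. E i h)" for g h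
    using insert.prems(6) insert.hyps by (metis insertCI)
  have "prob (Pi_pmf A d p) {f. \<forall>i\<in>insert k I. E i f}
      = prob (Pi_pmf A d p) {f. E k f \<and> (\<forall>i\<in>I. E i f)}" by simp
  also have "\<dots> \<le> \<beta> k * prob (Pi_pmf (A - S k) d p) {f. \<forall>i\<in>I. E i f}"
    by (rule prob_Pi_pmf_split_le) (use insert.prems inv in auto)
  also have "prob (Pi_pmf (A - S k) d p) {f. \<forall>i\<in>I. E i f} \<le> (\<Prod>k\<in>I. \<beta> k)"
  proof (rule insert.IH)
    fix i assume i: "i \<in> I"
    then have "S i \<inter> S k = {}" using insert.prems(4) insert.hyps by (metis insertCI)
    then show "S i \<subseteq> A - S k" using insert.prems(2)[of i] i by auto
  qed (use insert.prems in auto)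
  finally show ?case using insert.hyps insert.prems(3)[of k] by (simp add: mult_left_mono)
qed simp

lemma prob_Pi_bernoulli_insert:
  assumes "finite S" "x \<notin> S" "0 \<le> p" "p \<le> 1"
  shows "prob (coins (insert x S) d p) {f. Q f}
    = p * prob (coins S d p) {f. Q (f(x := True))}
      + (1 - p) * prob (coins S d p) {f. Q (f(x := False))}"
proof -
  let ?M = "coins S d p"
  have "coins (insert x S) d p
    = bind_pmf (bernoulli_pmf p) (\<lambda>b. map_pmf (\<lambda>f. f(x := b)) ?M)"
    using assms by (simp add: Pi_pmf_insert' map_pmf_def)
  then have "ennreal (prob (coins (insert x S) d p) {f. Q f})
    = (\<integral>\<^sup>+b. emeasure (map_pmf (\<lambda>f. f(x := b)) ?M) {f. Q f} \<partial>bernoulli_pmf p)"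
    by (simp only: measure_pmf.emeasure_eq_measure[symmetric] emeasure_bind_pmf)
  also have "\<dots> = ennreal (p * prob ?M {f. Q (f(x := True))}
      + (1 - p) * prob ?M {f. Q (f(x := False))})"
    using assms by (simp add: vimage_def measure_pmf.emeasure_eq_measure ennreal_mult mult.commute)
  finally show ?thesis
    using assms by (subst (asm) ennreal_inj) auto
qed

text \<open>The mean of the sign given by the parity is the product of the means
  \<open>1 - 2 * p\<close> of the single signs. In the induction a success of the new coin exchanges
  the two parities, hence the general \<open>t\<close>.\<close>

lemma prob_parity_Pi_bernoulli:
  assumes "finite S" "0 \<le> p" "p \<le> 1"
  shows "prob (coins S d p) {f. odd (card {e \<in> S. f e}) = t}
    = (1 + (if t then -1 else 1) * (1 - 2 * p) ^ card S) / 2"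
  using assms
proof (induction S arbitrary: t rule: finite_induct)
  case empty
  show ?case by (cases t) auto
next
  case (insert x S)
  let ?P = "\<lambda>Q. prob (coins S d p) {f. Q f}"
  have *: "{e \<in> insert x S. (f(x := True)) e} = insert x {e \<in> S. f e}"
    "{e \<in> insert x S. (f(x := False)) e} = {e \<in> S. f e}" for f
    using insert.hyps by auto
  have c: "card (insert x {e \<in> S. f e}) = Suc (card {e \<in> S. f e})" for f
    using insert.hyps by auto
  have "prob (coins (insert x S) d p)
      {f. odd (card {e \<in> insert x S. f e}) = t}
    = p * ?P (\<lambda>f. odd (card {e \<in> S. f e}) = (\<not> t)) + (1 - p) * ?P (\<lambda>f. odd (card {e \<in> S. f e}) = t)"
    unfolding prob_Pi_bernoulli_insert[OF insert.hyps insert.prems] * c by simp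
  also have "\<dots> = (1 + (if t then -1 else 1) * (1 - 2 * p) ^ card (insert x S)) / 2"
    unfolding insert.IH[OF insert.prems] using insert.hyps by (auto simp: field_simps)
  finally show ?case .
qed

section \<open>Random perturbations of a graph\<close>

lemma finite_all_edges [simp]: "finite (all_edges n)"
  unfolding all_edges_def by (rule finite_subset[of _ "Pow {1..n}"]) auto

lemma doubleton_in_all_edges_iff: "{x, w} \<in> all_edges n \<longleftrightarrow> x \<in> {1..n} \<and> w \<in> {1..n} \<and> x \<noteq> w"
  by (cases "x = w") (auto simp: all_edges_def)

abbreviation random_edges :: "nat \<Rightarrow> real \<Rightarrow> (nat set \<Rightarrow> bool) pmf" where
  "random_edges n p \<equiv> coins (all_edges n) False p"

definition perturbed :: "nat \<Rightarrow> nat set set \<Rightarrow> (nat set \<Rightarrow> bool) \<Rightarrow> nat set set" where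
  "perturbed n G f = sym_diff G {e \<in> all_edges n. f e}"

lemma prob_random_graph:
  "prob (random_graph n p) {R. Q (sym_diff G R)}
    = prob (random_edges n p) {f. Q (perturbed n G f)}"
  by (simp add: random_graph_def perturbed_def vimage_def)

lemma perturbed_iff:
  "e \<in> all_edges n \<Longrightarrow> e \<in> perturbed n G f \<longleftrightarrow> (e \<in> G) \<noteq> f e"
  by (auto simp: perturbed_def)

lemma perturbed_cong:
  "(e \<in> all_edges n \<Longrightarrow> f e = f' e) \<Longrightarrow> e \<in> perturbed n G f \<longleftrightarrow> e \<in> perturbed n G f'"
  by (auto simp: perturbed_def)

lemma prob_eq_on_Pi_bernoulli:
  assumes "finite S" "0 \<le> p" "p \<le> 1"
  shows "prob (coins S d p) {f. \<forall>e\<in>S. f e = g e}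
    = p ^ card {e\<in>S. g e} * (1 - p) ^ card {e\<in>S. \<not> g e}"
proof -
  have "{f. \<forall>e\<in>S. f e = g e} = Pi S (\<lambda>e. {g e})" by auto
  then have "prob (coins S d p) {f. \<forall>e\<in>S. f e = g e}
    = (\<Prod>e\<in>S. pmf (bernoulli_pmf p) (g e))"
    using assms by (simp add: measure_Pi_pmf_Pi measure_pmf_single)
  also have "\<dots> = (\<Prod>e\<in>S. if g e then p else 1 - p)"
    using assms by (intro prod.cong) (auto split: if_splits)
  also have "\<dots> = p ^ card {e\<in>S. g e} * (1 - p) ^ card {e\<in>S. \<not> g e}"
    using assms by (simp add: prod.If_cases Int_def Collect_neg_eq[symmetric])
  finally show ?thesis .
qed

text \<open>The condition says that on \<open>S\<close> the function \<open>f\<close> agrees with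
  \<open>g\<close> or with its negation. The resulting bound, in terms of the numbers
  \<open>i\<close> and \<open>j\<close> of true and false values of \<open>g\<close>, is largest
  when \<open>g\<close> is constant.\<close>

lemma prob_constant_Pi_bernoulli_le:
  assumes "finite S" "0 \<le> p" "p \<le> 1"
  shows "prob (coins S d p)
      {f. \<forall>e\<in>S. \<forall>e'\<in>S. (f e = g e) = (f e' = g e')} \<le> (1 - p) ^ card S + p ^ card S"
proof -
  let ?P = "prob (coins S d p)"
  define i where "i = card {e\<in>S. g e}"
  define j where "j = card {e\<in>S. \<not> g e}"
  have ij: "i + j = card S"
  proof -
    have "i + j = card ({e\<in>S. g e} \<union> {e\<in>S. \<not> g e})"
      unfolding i_def j_def using assms(1) by (subst card_Un_disjoint) auto
    also have "{e\<in>S. g e} \<union> {e\<in>S. \<not> g e} = S" by auto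
    finally show ?thesis .
  qed
  have "?P {f. \<forall>e\<in>S. \<forall>e'\<in>S. (f e = g e) = (f e' = g e')}
      \<le> ?P ({f. \<forall>e\<in>S. f e = g e} \<union> {f. \<forall>e\<in>S. f e = (\<not> g e)})"
    by (rule measure_pmf.finite_measure_mono) auto
  also have "\<dots> \<le> ?P {f. \<forall>e\<in>S. f e = g e} + ?P {f. \<forall>e\<in>S. f e = (\<not> g e)}"
    by (rule measure_subadditive) auto
  also have "\<dots> = p ^ i * (1 - p) ^ j + p ^ j * (1 - p) ^ i"
    using assms by (simp add: prob_eq_on_Pi_bernoulli i_def j_def)
  also have "\<dots> \<le> (1 - p) ^ card S + p ^ card S"
  proof -
    \<comment> \<open>Rearrangement inequality: the two factors never have opposite signs, and
      expanding their product gives the comparison.\<close>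
    have "0 \<le> ((1 - p) ^ i - p ^ i) * ((1 - p) ^ j - p ^ j)"
    proof (cases "p \<le> 1 - p")
      case True
      then show ?thesis using assms by (intro mult_nonneg_nonneg) (auto intro: power_mono)
    next
      case False
      then show ?thesis using assms by (intro mult_nonpos_nonpos) (auto intro: power_mono)
    qed
    then show ?thesis unfolding ij[symmetric] by (simp add: algebra_simps power_add)
  qed
  finally show ?thesis .
qed

text \<open>There is one block of coins for each \<open>b\<close> and each outside vertex
  \<open>w\<close>, namely the edges from \<open>w\<close> to \<open>b\<close>. Since
  \<open>w\<close> avoids \<open>\<Union>\<B>\<close> and the members of \<open>\<B>\<close> are
  disjoint, these blocks share no edge and the bounds multiply.\<close>

lemma prob_homogeneous_blocks_le:
  assumes p: "0 \<le> p" "p \<le> 1"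
    and \<B>: "finite \<B>" "disjoint \<B>" "\<Union>\<B> \<subseteq> {1..n}"
  shows "prob (random_graph n p)
      {R. \<forall>b\<in>\<B>. \<forall>w\<in>{1..n} - \<Union>\<B>. \<forall>x\<in>b. \<forall>y\<in>b. ({x, w} \<in> sym_diff G R) = ({y, w} \<in> sym_diff G R)}
    \<le> (\<Prod>b\<in>\<B>. ((1 - p) ^ card b + p ^ card b) ^ (n - card (\<Union>\<B>)))"
proof -
  define W where "W = {1..n} - \<Union>\<B>"
  define S where "S = (\<lambda>(b, w). (\<lambda>x. {x, w}) ` b :: nat set set)"
  define E where "E = (\<lambda>(b, w) f. \<forall>x\<in>b. \<forall>y\<in>b. ({x, w} \<in> perturbed n G f) = ({y, w} \<in> perturbed n G f))"
  define \<beta> where "\<beta> = (\<lambda>(b, w::nat). (1 - p) ^ card (b :: nat set) + p ^ card b)"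
  have fin: "finite b" if "b \<in> \<B>" for b
    using that \<B>(3) by (meson Sup_upper finite_atLeastAtMost finite_subset subset_trans)
  have mem: "x \<in> {1..n}" "x \<notin> W" if "b \<in> \<B>" "x \<in> b" for x b
    using that \<B>(3) by (auto simp: W_def)
  have notin: "{x, w} \<notin> S l"
    if "k = (b, w)" "k \<in> \<B> \<times> W" "l \<in> \<B> \<times> W" "k \<noteq> l" "x \<in> b" for k l b w x
  proof
    assume "{x, w} \<in> S l"
    then obtain b' w' x' where l: "l = (b', w')" and x': "x' \<in> b'" and eq: "{x, w} = {x', w'}"
      by (auto simp: S_def)
    have "b \<in> \<B>" "b' \<in> \<B>" "w \<in> W" "w' \<in> W" using that l by auto
    then have "x \<notin> W" "x' \<notin> W" using mem that(5) x' by blast+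
    then have "x = x'" "w = w'" using eq \<open>w \<in> W\<close> \<open>w' \<in> W\<close> by (auto simp: doubleton_eq_iff)
    moreover have "b = b'"
      using \<B>(2) \<open>b \<in> \<B>\<close> \<open>b' \<in> \<B>\<close> that(5) x' \<open>x = x'\<close> by (auto simp: disjoint_def)
    ultimately show False using that(1,4) l by simp
  qed
  have "prob (random_edges n p) {f. \<forall>k\<in>\<B> \<times> W. E k f} \<le> (\<Prod>k\<in>\<B> \<times> W. \<beta> k)"
  proof (rule prob_Pi_pmf_blocks_le)
    show "finite (\<B> \<times> W)" using \<B>(1) by (simp add: W_def)
    show "S k \<subseteq> all_edges n" if "k \<in> \<B> \<times> W" for k
      using that mem by (fastforce simp: S_def doubleton_in_all_edges_iff W_def)
    show "\<beta> k \<ge> 0" if "k \<in> \<B> \<times> W" for k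
      using p by (auto simp: \<beta>_def split: prod.splits)
    show "S k \<inter> S l = {}" if "k \<in> \<B> \<times> W" "l \<in> \<B> \<times> W" "k \<noteq> l" for k l
      using notin[OF _ that] by (cases k) (auto simp: S_def)
    show "E k (merge_on (S l) g h) = E k h" if "k \<in> \<B> \<times> W" "l \<in> \<B> \<times> W" "k \<noteq> l" for k l g h
    proof -
      obtain b w where k: "k = (b, w)" by (cases k)
      have "{x, w} \<in> perturbed n G (merge_on (S l) g h) \<longleftrightarrow> {x, w} \<in> perturbed n G h" if "x \<in> b" for x
        using notin[OF k \<open>k \<in> _\<close> \<open>l \<in> _\<close> \<open>k \<noteq> l\<close> that]
        by (intro perturbed_cong) (simp add: merge_on_def)
      then show ?thesis by (simp add: E_def k)
    qed
    show "prob (coins (S k) False p) {g. E k (merge_on (S k) g h)} \<le> \<beta> k"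
      if "k \<in> \<B> \<times> W" for k h
    proof -
      obtain b w where k: "k = (b, w)" by (cases k)
      with that have b: "b \<in> \<B>" and w: "w \<in> W" by auto
      \<comment> \<open>The fixed graph is absorbed into the pattern: an edge is present exactly if
        its coin equals \<open>e \<notin> G\<close>, so an arbitrary \<open>G\<close> costs
        nothing.\<close>
      have "E k (merge_on (S k) g h) \<longleftrightarrow>
          (\<forall>e\<in>S k. \<forall>e'\<in>S k. (g e = (e \<notin> G)) = (g e' = (e' \<notin> G)))" for g
      proof -
        have "{x, w} \<in> perturbed n G (merge_on (S k) g h) \<longleftrightarrow> g {x, w} = ({x, w} \<notin> G)" if "x \<in> b" for x
        proof -
          have "{x, w} \<in> S k" using that by (simp add: S_def k)
          moreover have "{x, w} \<in> all_edges n"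
            using mem[OF b that] w by (auto simp: doubleton_in_all_edges_iff W_def)
          ultimately show ?thesis by (auto simp: perturbed_iff merge_on_def)
        qed
        then show ?thesis by (auto simp: E_def k S_def)
      qed
      moreover have "card (S k) = card b"
      proof -
        have "inj_on (\<lambda>x. {x, w}) b" by (rule inj_onI) (auto simp: doubleton_eq_iff)
        then show ?thesis by (simp add: S_def k card_image)
      qed
      moreover have "finite (S k)" using fin[OF b] by (simp add: S_def k)
      ultimately show ?thesis
        using prob_constant_Pi_bernoulli_le[OF _ p, of "S k" False "\<lambda>e. e \<notin> G"] by (simp add: \<beta>_def k)
    qed
  qed simp
  also have "(\<Prod>k\<in>\<B> \<times> W. \<beta> k) = (\<Prod>b\<in>\<B>. ((1 - p) ^ card b + p ^ card b) ^ card W)"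
    by (simp add: prod.Sigma[symmetric] \<beta>_def \<B>(1) prod.cartesian_product[symmetric])
  also have "card W = n - card (\<Union>\<B>)"
    using \<B>(3) by (simp add: W_def card_Diff_subset finite_subset)
  finally show ?thesis
    by (subst prob_random_graph) (simp add: E_def W_def)
qed

section \<open>Parities of degrees\<close>

lemma odd_card_exclusive_or:
  assumes "finite A"
  shows "odd (card {w \<in> A. P w \<noteq> Q w}) \<longleftrightarrow> odd (card {w \<in> A. P w}) \<noteq> odd (card {w \<in> A. Q w})"
  using assms
proof (induction A rule: finite_induct)
  case (insert x A)
  have *: "{w \<in> insert x A. R w} = (if R x then insert x {w \<in> A. R w} else {w \<in> A. R w})" for R
    by auto
  show ?case using insert.hyps insert.IH
    by (simp only: *[of P] *[of Q] *[of "\<lambda>w. P w \<noteq> Q w"]) auto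
qed simp

abbreviation odd_degree_into :: "nat set set \<Rightarrow> nat \<Rightarrow> nat set \<Rightarrow> bool" where
  "odd_degree_into E x B \<equiv> odd (card {w \<in> B. {x, w} \<in> E})"

abbreviation same_parity :: "nat set set \<Rightarrow> nat set \<Rightarrow> nat \<Rightarrow> nat \<Rightarrow> bool" where
  "same_parity E B x y \<equiv> odd_degree_into E x B = odd_degree_into E y B"

lemma odd_degree_into_split:
  assumes "finite B"
  shows "odd_degree_into E x B \<longleftrightarrow> odd_degree_into E x (B \<inter> X) \<noteq> odd_degree_into E x (B - X)"
proof -
  have "{w \<in> B. {x, w} \<in> E} = {w \<in> B \<inter> X. {x, w} \<in> E} \<union> {w \<in> B - X. {x, w} \<in> E}" by auto
  then have "card {w \<in> B. {x, w} \<in> E} = card {w \<in> B \<inter> X. {x, w} \<in> E} + card {w \<in> B - X. {x, w} \<in> E}"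
    using assms by (subst card_Un_disjoint[symmetric]) auto
  then show ?thesis by simp
qed

text \<open>For each pair and each \<open>j\<close> the fresh coins are the edges from
  \<open>x\<close> and from \<open>y\<close> to \<open>B j - X\<close>. Edges inside
  \<open>X\<close> may be shared by two pairs and are therefore treated as fixed. The parities agree
  exactly if the number of successes among the \<open>2 * card (B j - X)\<close> fresh coins has a
  prescribed parity.\<close>

lemma prob_parities_agree_le:
  fixes B :: "'j \<Rightarrow> nat set"
  assumes p: "0 \<le> p" "p \<le> 1 / 2"
    and \<P>: "finite \<P>" "\<And>x y. (x, y) \<in> \<P> \<Longrightarrow> x \<noteq> y"
      "\<And>x y x' y'. (x, y) \<in> \<P> \<Longrightarrow> (x', y') \<in> \<P> \<Longrightarrow> (x, y) \<noteq> (x', y') \<Longrightarrow> {x, y} \<inter> {x', y'} = {}"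
    and X: "X = fst ` \<P> \<union> snd ` \<P>" "X \<subseteq> {1..n}"
    and J: "finite J" "\<And>j. j \<in> J \<Longrightarrow> B j \<subseteq> {1..n}" "disjoint_family_on B J"
  shows "prob (random_graph n p)
      {R. \<forall>(x, y)\<in>\<P>. \<forall>j\<in>J. same_parity (sym_diff G R) (B j) x y}
    \<le> (\<Prod>j\<in>J. (1 + (1 - 2 * p) ^ (2 * card (B j - X))) / 2) ^ card \<P>"
proof -
  define S where "S = (\<lambda>((x, y), j). (\<lambda>w. {x, w}) ` (B j - X) \<union> (\<lambda>w. {y, w}) ` (B j - X))"
  define E where "E = (\<lambda>((x, y), j) f. same_parity (perturbed n G f) (B j) x y)"
  define \<beta> where "\<beta> = (\<lambda>(q :: nat \<times> nat, j). (1 + (1 - 2 * p) ^ (2 * card (B j - X))) / 2)"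
  have inX: "x \<in> X" "y \<in> X" if "(x, y) \<in> \<P>" for x y
    using that by (force simp: X)+
  have finB: "finite (B j)" if "j \<in> J" for j using J(2)[OF that] finite_subset by blast
  have notin: "{z, w} \<notin> S l"
    if "k = ((x, y), j)" "k \<in> \<P> \<times> J" "l \<in> \<P> \<times> J" "k \<noteq> l" "z \<in> {x, y}" "w \<in> B j" for k l x y z w j
  proof
    assume "{z, w} \<in> S l"
    then obtain x' y' j' z' w' where l: "l = ((x', y'), j')" and z': "z' \<in> {x', y'}"
      and w': "w' \<in> B j' - X" and eq: "{z, w} = {z', w'}"
      by (cases l) (auto simp: S_def)
    have P: "(x, y) \<in> \<P>" "(x', y') \<in> \<P>" "j \<in> J" "j' \<in> J" using that l by auto
    then have "z \<in> X" "z' \<in> X" using inX z' that(5) by auto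
    \<comment> \<open>\<open>z\<close> and \<open>z'\<close> lie in \<open>X\<close> but
      \<open>w'\<close> does not, so the two ends of the edge cannot be exchanged.\<close>
    then have "z = z'" "w = w'" using eq w' by (auto simp: doubleton_eq_iff)
    then have "(x, y) = (x', y')" using \<P>(3)[OF P(1,2)] z' that(5) by auto
    moreover have "j = j'"
      using J(3) P(3,4) \<open>w = w'\<close> w' that(6) by (auto simp: disjoint_family_on_def)
    ultimately show False using that(1,4) l by simp
  qed
  have "prob (random_edges n p) {f. \<forall>k\<in>\<P> \<times> J. E k f} \<le> (\<Prod>k\<in>\<P> \<times> J. \<beta> k)"
  proof (rule prob_Pi_pmf_blocks_le)
    show "finite (\<P> \<times> J)" using \<P>(1) J(1) by simp
    show "S k \<subseteq> all_edges n" if "k \<in> \<P> \<times> J" for k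
    proof -
      obtain x y j where k: "k = ((x, y), j)" by (metis prod.exhaust)
      then have xyj: "x \<in> X" "y \<in> X" "j \<in> J" using that inX by auto
      then have "x \<in> {1..n}" "y \<in> {1..n}" "B j \<subseteq> {1..n}" using X(2) J(2) by blast+
      then show ?thesis using xyj(1,2)
        unfolding S_def k by (auto simp: doubleton_in_all_edges_iff simp del: atLeastAtMost_iff)
    qed
    show "\<beta> k \<ge> 0" if "k \<in> \<P> \<times> J" for k
      using p by (auto simp: \<beta>_def split: prod.splits)
    show "S k \<inter> S l = {}" if "k \<in> \<P> \<times> J" "l \<in> \<P> \<times> J" "k \<noteq> l" for k l
    proof -
      obtain x y j where k: "k = ((x, y), j)" by (metis prod.exhaust)
      show ?thesis using notin[OF k that] by (auto simp: S_def k)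
    qed
    show "E k (merge_on (S l) g h) = E k h" if "k \<in> \<P> \<times> J" "l \<in> \<P> \<times> J" "k \<noteq> l" for k l g h
    proof -
      obtain x y j where k: "k = ((x, y), j)" by (metis prod.exhaust)
      have "{z, w} \<in> perturbed n G (merge_on (S l) g h) \<longleftrightarrow> {z, w} \<in> perturbed n G h"
        if "z \<in> {x, y}" "w \<in> B j" for z w
        using notin[OF k \<open>k \<in> _\<close> \<open>l \<in> _\<close> \<open>k \<noteq> l\<close> that]
        by (intro perturbed_cong) (simp add: merge_on_def)
      then have "{w \<in> B j. {z, w} \<in> perturbed n G (merge_on (S l) g h)}
          = {w \<in> B j. {z, w} \<in> perturbed n G h}" if "z \<in> {x, y}" for z
        using that by blast
      then show ?thesis by (simp add: E_def k)
    qed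
    show "prob (coins (S k) False p) {g. E k (merge_on (S k) g h)} \<le> \<beta> k"
      if "k \<in> \<P> \<times> J" for k h
    proof -
      obtain x y j where k: "k = ((x, y), j)" by (metis prod.exhaust)
      have xy: "(x, y) \<in> \<P>" and j: "j \<in> J" using that k by auto
      define A where "A = B j - X"
      have finA: "finite A" using finB[OF j] by (simp add: A_def)
      have xyX: "x \<in> X" "y \<in> X" "x \<noteq> y" using inX[OF xy] \<P>(2)[OF xy] by auto
      have inj: "inj_on (\<lambda>w. {z, w}) A" for z :: nat by (rule inj_onI) (auto simp: doubleton_eq_iff)
      have disj: "(\<lambda>w. {x, w}) ` A \<inter> (\<lambda>w. {y, w}) ` A = {}"
        using xyX by (auto simp: A_def doubleton_eq_iff)
      have Sk: "S k = (\<lambda>w. {x, w}) ` A \<union> (\<lambda>w. {y, w}) ` A" by (simp add: S_def k A_def)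
      have cardS: "card (S k) = 2 * card A"
        using finA disj by (simp add: Sk card_Un_disjoint card_image[OF inj])
      have oddS: "odd (card {e \<in> S k. g e}) \<longleftrightarrow> odd (card {w \<in> A. g {x, w}}) \<noteq> odd (card {w \<in> A. g {y, w}})" for g
      proof -
        have "{e \<in> S k. g e} = (\<lambda>w. {x, w}) ` {w \<in> A. g {x, w}} \<union> (\<lambda>w. {y, w}) ` {w \<in> A. g {y, w}}"
          by (auto simp: Sk)
        moreover have "(\<lambda>w. {x, w}) ` {w \<in> A. g {x, w}} \<inter> (\<lambda>w. {y, w}) ` {w \<in> A. g {y, w}} = {}"
          using disj by auto
        ultimately have "card {e \<in> S k. g e} = card {w \<in> A. g {x, w}} + card {w \<in> A. g {y, w}}"
          using finA by (simp add: card_Un_disjoint card_image inj_on_subset[OF inj])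
        then show ?thesis by simp
      qed
      have deg: "odd_degree_into (perturbed n G (merge_on (S k) g h)) z (B j) \<longleftrightarrow>
          ((odd_degree_into (perturbed n G h) z (B j \<inter> X) \<noteq> odd_degree_into G z A) \<noteq> odd (card {w \<in> A. g {z, w}}))"
        if z: "z \<in> {x, y}" for z g
      proof -
        have "{w \<in> A. {z, w} \<in> perturbed n G (merge_on (S k) g h)} = {w \<in> A. ({z, w} \<in> G) \<noteq> g {z, w}}"
        proof -
          have "{z, w} \<in> perturbed n G (merge_on (S k) g h) \<longleftrightarrow> ({z, w} \<in> G) \<noteq> g {z, w}" if "w \<in> A" for w
          proof -
            have "{z, w} \<in> all_edges n"
              using that z xyX X(2) J(2)[OF j] by (auto simp: doubleton_in_all_edges_iff A_def)
            moreover have "{z, w} \<in> S k" using that z by (auto simp: Sk)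
            ultimately show ?thesis by (simp add: perturbed_iff merge_on_def)
          qed
          then show ?thesis by blast
        qed
        then have 1: "odd_degree_into (perturbed n G (merge_on (S k) g h)) z A \<longleftrightarrow>
            odd_degree_into G z A \<noteq> odd (card {w \<in> A. g {z, w}})"
          using odd_card_exclusive_or[OF finA, of "\<lambda>w. {z, w} \<in> G" "\<lambda>w. g {z, w}"] by simp
        have 2: "{w \<in> B j \<inter> X. {z, w} \<in> perturbed n G (merge_on (S k) g h)}
            = {w \<in> B j \<inter> X. {z, w} \<in> perturbed n G h}"
        proof -
          have "{z, w} \<in> perturbed n G (merge_on (S k) g h) \<longleftrightarrow> {z, w} \<in> perturbed n G h" if "w \<in> X" for w
          proof -
            have "z \<in> X" using z xyX by auto
            then have "{z, w} \<notin> S k" using that by (auto simp: Sk A_def doubleton_eq_iff)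
            then show ?thesis by (intro perturbed_cong) (simp add: merge_on_def)
          qed
          then show ?thesis by blast
        qed
        have assoc: "(a \<noteq> (c \<noteq> d)) = ((a \<noteq> c) \<noteq> d)" for a c d :: bool by auto
        show ?thesis
          unfolding odd_degree_into_split[OF finB[OF j], where x = z and X = X
              and E = "perturbed n G (merge_on (S k) g h)"]
          unfolding A_def[symmetric] 1 2 assoc by (rule refl)
      qed
      \<comment> \<open>\<open>t\<close> gathers everything that the coins of this block do not
        influence: the parities into \<open>X\<close> and those of \<open>G\<close> into
        \<open>A\<close>.\<close>
      define t where "t \<longleftrightarrow> (odd_degree_into (perturbed n G h) x (B j \<inter> X) \<noteq> odd_degree_into G x A)
        \<noteq> (odd_degree_into (perturbed n G h) y (B j \<inter> X) \<noteq> odd_degree_into G y A)"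
      have "E k (merge_on (S k) g h) \<longleftrightarrow> odd (card {e \<in> S k. g e}) = t" for g
      proof -
        have "E k (merge_on (S k) g h) \<longleftrightarrow> odd_degree_into (perturbed n G (merge_on (S k) g h)) x (B j)
          = odd_degree_into (perturbed n G (merge_on (S k) g h)) y (B j)"
          by (simp add: E_def k)
        also have "\<dots> = (odd (card {e \<in> S k. g e}) = t)"
        proof -
          have "((a \<noteq> c) = (b \<noteq> d)) = ((c \<noteq> d) = (a \<noteq> b))" for a b c d :: bool by auto
          then show ?thesis unfolding oddS t_def by (simp only: deg[of x] deg[of y] insertI1 insertI2 singletonI)
        qed
        finally show ?thesis .
      qed
      then have "prob (coins (S k) False p) {g. E k (merge_on (S k) g h)}
         = (1 + (if t then -1 else 1) * (1 - 2 * p) ^ card (S k)) / 2"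
        using prob_parity_Pi_bernoulli[of "S k" p False t] p finA by (simp add: Sk)
      also have "\<dots> \<le> \<beta> k"
      proof -
        \<comment> \<open>Even parity is the likelier one, so the bound for \<open>t\<close> false
          serves in both cases.\<close>
        have "0 \<le> (1 - 2 * p) ^ (2 * card A)" using p by simp
        then show ?thesis unfolding cardS by (simp add: \<beta>_def k A_def)
      qed
      finally show ?thesis .
    qed
  qed simp
  also have "(\<Prod>k\<in>\<P> \<times> J. \<beta> k) = (\<Prod>j\<in>J. (1 + (1 - 2 * p) ^ (2 * card (B j - X))) / 2) ^ card \<P>"
    by (simp add: \<beta>_def prod.cartesian_product[symmetric])
  finally show ?thesis
    by (subst prob_random_graph) (simp add: E_def case_prod_unfold)
qed

section \<open>Coincidence of two degrees\<close>

lemma finite_set_Pi_bernoulli [simp]: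
  "finite S \<Longrightarrow> finite (set_pmf (coins S d p))"
  by (rule finite_subset[OF set_Pi_pmf_subset' finite_PiE_dflt]) auto

lemma expectation_Pi_bernoulli_insert:
  fixes h :: "('a \<Rightarrow> bool) \<Rightarrow> real"
  assumes "finite S" "x \<notin> S" "0 \<le> p" "p \<le> 1"
  shows "expectation (coins (insert x S) d p) h
    = p * expectation (coins S d p) (\<lambda>f. h (f(x := True)))
      + (1 - p) * expectation (coins S d p) (\<lambda>f. h (f(x := False)))"
proof -
  let ?M = "coins S d p"
  have eq: "coins (insert x S) d p
    = bind_pmf (bernoulli_pmf p) (\<lambda>b. map_pmf (\<lambda>f. f(x := b)) ?M)"
    using assms by (simp add: Pi_pmf_insert' map_pmf_def)
  show ?thesis
    unfolding eq using assms by (subst pmf_expectation_bind[where A = UNIV]) (auto simp: UNIV_bool)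
qed

text \<open>With sign -1 on the edges of \<open>G\<close> and 1 on the others, this is the change of
  a degree caused by the coins.\<close>

definition signed_sum :: "'a set \<Rightarrow> ('a \<Rightarrow> int) \<Rightarrow> ('a \<Rightarrow> bool) \<Rightarrow> int" where
  "signed_sum S s f = (\<Sum>e\<in>S. if f e then s e else 0)"

text \<open>\<open>\<Phi>\<close> is the characteristic function of the signed sum at
  \<open>\<theta>\<close>, a product of factors \<open>z\<close> of squared modulus
  \<open>1 - 2 * p * (1 - p) * (1 - cos \<theta>)\<close>. The phase \<open>a\<close> keeps all
  expectations real and absorbs the value of a new coin in the induction.\<close>

lemma expectation_cos_signed_sum:
  assumes "finite S" "0 \<le> p" "p \<le> 1" "\<And>e. e \<in> S \<Longrightarrow> s e \<in> {1, -1}"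
  shows "\<exists>\<Phi>. norm \<Phi> \<le> exp (- (p * (1 - p) * (1 - cos \<theta>))) ^ card S
    \<and> (\<forall>a. expectation (coins S d p)
         (\<lambda>f. cos (\<theta> * of_int (signed_sum S s f) + a)) = Re (cis a * \<Phi>))"
  using assms
proof (induction S rule: finite_induct)
  case empty
  show ?case by (intro exI[of _ 1]) (simp add: signed_sum_def)
next
  case (insert x S)
  then obtain \<Phi> where \<Phi>: "norm \<Phi> \<le> exp (- (p * (1 - p) * (1 - cos \<theta>))) ^ card S"
    "\<And>a. expectation (coins S d p)
         (\<lambda>f. cos (\<theta> * of_int (signed_sum S s f) + a)) = Re (cis a * \<Phi>)" by auto
  define z where "z = of_real (1 - p) + of_real p * cis (\<theta> * of_int (s x))"
  have s: "s x = 1 \<or> s x = -1" using insert.prems(3)[of x] by auto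
  have "(norm z)\<^sup>2 = 1 - 2 * (p * (1 - p) * (1 - cos \<theta>))"
  proof -
    have "(norm z)\<^sup>2 = (1 - p + p * cos \<theta>)\<^sup>2 + (p * sin \<theta>)\<^sup>2"
      unfolding cmod_power2 z_def using s by auto
    also have "\<dots> = (1 - p)\<^sup>2 + 2 * (1 - p) * p * cos \<theta> + p\<^sup>2 * ((sin \<theta>)\<^sup>2 + (cos \<theta>)\<^sup>2)"
      by algebra
    also have "\<dots> = 1 - 2 * (p * (1 - p) * (1 - cos \<theta>))"
      by (simp only: sin_cos_squared_add) (simp add: power2_eq_square algebra_simps)
    finally show ?thesis .
  qed
  also have "\<dots> \<le> exp (- 2 * (p * (1 - p) * (1 - cos \<theta>)))"
    using exp_ge_add_one_self[of "- 2 * (p * (1 - p) * (1 - cos \<theta>))"] by simp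
  also have "\<dots> = (exp (- (p * (1 - p) * (1 - cos \<theta>))))\<^sup>2"
    by (simp add: power2_eq_square exp_add[symmetric])
  finally have z: "norm z \<le> exp (- (p * (1 - p) * (1 - cos \<theta>)))"
    by (rule power2_le_imp_le) simp
  have upd: "signed_sum (insert x S) s (f(x := b)) = (if b then s x else 0) + signed_sum S s f" for f b
  proof -
    have "signed_sum S s (f(x := b)) = signed_sum S s f"
      unfolding signed_sum_def using insert.hyps by (intro sum.cong) auto
    then show ?thesis using insert.hyps by (simp add: signed_sum_def)
  qed
  show ?case
  proof (intro exI[of _ "z * \<Phi>"] conjI allI)
    show "norm (z * \<Phi>) \<le> exp (- (p * (1 - p) * (1 - cos \<theta>))) ^ card (insert x S)"
      using insert.hyps z \<Phi>(1) by (simp add: norm_mult mult_mono)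
    fix a
    have "expectation (coins (insert x S) d p)
         (\<lambda>f. cos (\<theta> * of_int (signed_sum (insert x S) s f) + a))
      = p * Re (cis (\<theta> * of_int (s x) + a) * \<Phi>) + (1 - p) * Re (cis a * \<Phi>)"
    proof -
      have "cos (\<theta> * of_int (signed_sum (insert x S) s (f(x := True))) + a)
          = cos (\<theta> * of_int (signed_sum S s f) + (\<theta> * of_int (s x) + a))"
        "cos (\<theta> * of_int (signed_sum (insert x S) s (f(x := False))) + a)
          = cos (\<theta> * of_int (signed_sum S s f) + a)" for f
        by (simp_all add: upd algebra_simps)
      then show ?thesis
        unfolding expectation_Pi_bernoulli_insert[OF insert.hyps insert.prems(1,2)]
        by (simp only: \<Phi>(2))
    qed
    also have "\<dots> = Re (cis a * (z * \<Phi>))"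
      unfolding z_def cis_mult[symmetric] by (simp add: algebra_simps)
    finally show "expectation (coins (insert x S) d p)
         (\<lambda>f. cos (\<theta> * of_int (signed_sum (insert x S) s f) + a)) = Re (cis a * (z * \<Phi>))" .
  qed
qed

text \<open>This is the real part of a geometric sum over the powers of an \<open>M\<close>-th root
  of unity, hence \<open>M\<close> or 0.\<close>

lemma sum_cos_root_of_unity_nonneg:
  assumes "M > 0"
  shows "(\<Sum>j<M. cos (2 * pi * real j / real M * of_int k)) \<ge> 0"
proof -
  define z where "z = cis (2 * pi / real M * of_int k)"
  have "z ^ M = 1"
  proof -
    have "real M * (2 * pi / real M * of_int k) = 2 * pi * of_int k" using assms by simp
    then have "z ^ M = cis (2 * pi * of_int k)" by (simp only: z_def Complex.DeMoivre)
    then show ?thesis by (simp add: cis_multiple_2pi)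
  qed
  then have "(\<Sum>j<M. z ^ j) = (if z = 1 then of_nat M else 0)"
    by (simp add: sum_gp_strict)
  then have "Re (\<Sum>j<M. z ^ j) \<ge> 0" by (simp split: if_splits)
  also have "Re (\<Sum>j<M. z ^ j) = (\<Sum>j<M. cos (2 * pi * real j / real M * of_int k))"
    by (simp add: z_def Complex.DeMoivre algebra_simps)
  finally show ?thesis .
qed

lemma one_minus_cos_roots_bounded_below:
  "\<exists>c>0. \<forall>j\<in>{1..<M}. 1 - cos (2 * pi * real j / real M) \<ge> c"
proof -
  \<comment> \<open>The extra element 1 keeps the set nonempty when \<open>{1..<M}\<close> is
    empty.\<close>
  let ?A = "insert 1 ((\<lambda>j. 1 - cos (2 * pi * real j / real M)) ` {1..<M})"
  have "1 - cos (2 * pi * real j / real M) > 0" if "j \<in> {1..<M}" for j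
  proof -
    have "cos (2 * pi * real j / real M) \<noteq> 1"
    proof
      assume "cos (2 * pi * real j / real M) = 1"
      then obtain k :: int where "2 * pi * real j / real M = of_int k * 2 * pi"
        by (auto simp: cos_one_2pi_int)
      then have "real j = of_int k * real M" using that by (simp add: field_simps)
      then have k: "int j = k * int M" by (metis of_int_eq_iff of_int_mult of_int_of_nat_eq)
      then have "0 < k * int M" "k * int M < 1 * int M" unfolding k[symmetric] using that by auto
      then have "0 < k" by (auto simp: zero_less_mult_iff)
      then have "1 * int M \<le> k * int M" by (intro mult_right_mono) auto
      then show False using \<open>k * int M < 1 * int M\<close> by simp
    qed
    then show ?thesis using cos_le_one[of "2 * pi * real j / real M"] by linarith
  qed
  then have "\<forall>a\<in>?A. a > 0" by auto
  then have "Min ?A > 0" by (subst Min_gr_iff) auto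
  moreover have "\<forall>j\<in>{1..<M}. 1 - cos (2 * pi * real j / real M) \<ge> Min ?A"
    by (intro ballI Min_le) (auto simp del: Min_insert)
  ultimately show ?thesis by blast
qed

text \<open>The event is relaxed to congruence modulo \<open>M\<close>, whose indicator is an
  average of \<open>M\<close> cosines. The term \<open>j = 0\<close> contributes
  \<open>1 / M\<close>; every other term is a value of the characteristic function at an angle
  bounded away from the multiples of \<open>2 * pi\<close>.\<close>

lemma prob_signed_sum_eq_le:
  assumes "M > 0" and c: "\<forall>j\<in>{1..<M}. 1 - cos (2 * pi * real j / real M) \<ge> c"
    and S: "finite S" "0 \<le> p" "p \<le> 1" "\<And>e. e \<in> S \<Longrightarrow> s e \<in> {1, -1}"
  shows "prob (coins S d p) {f. signed_sum S s f = a}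
    \<le> 1 / real M + exp (- (p * (1 - p) * c * card S))"
proof -
  let ?M = "coins S d p"
  define \<theta> where "\<theta> = (\<lambda>j::nat. 2 * pi * real j / real M)"
  have int: "integrable (measure_pmf ?M) h" for h :: "_ \<Rightarrow> real"
    using S(1) by (intro integrable_measure_pmf_finite) simp
  have "prob ?M {f. signed_sum S s f = a}
      = expectation ?M (indicator {f. signed_sum S s f = a})"
    by simp
  also have "\<dots> \<le> expectation ?M
      (\<lambda>f. (\<Sum>j<M. cos (\<theta> j * of_int (signed_sum S s f) + (- \<theta> j * of_int a))) / M)"
  proof (intro integral_mono int)
    fix f
    have eq: "(\<Sum>j<M. cos (\<theta> j * of_int (signed_sum S s f) + (- \<theta> j * of_int a)))
      = (\<Sum>j<M. cos (2 * pi * real j / real M * of_int (signed_sum S s f - a)))"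
      by (simp add: \<theta>_def diff_divide_distrib algebra_simps)
    show "indicator {f. signed_sum S s f = a} f
      \<le> (\<Sum>j<M. cos (\<theta> j * of_int (signed_sum S s f) + (- \<theta> j * of_int a))) / M"
    proof (cases "signed_sum S s f = a")
      case True
      then show ?thesis using assms(1) by simp
    next
      case False
      then have "indicator {f. signed_sum S s f = a} f = (0 :: real)" by simp
      then show ?thesis
        unfolding eq by (simp only: divide_nonneg_nonneg sum_cos_root_of_unity_nonneg[OF assms(1)] of_nat_0_le_iff)
    qed
  qed
  also have "\<dots> = (\<Sum>j<M. expectation ?M
      (\<lambda>f. cos (\<theta> j * of_int (signed_sum S s f) + (- \<theta> j * of_int a)))) / M"
    using int by (simp add: Bochner_Integration.integral_sum)
  also have "\<dots> \<le> (\<Sum>j<M. if j = 0 then 1 else exp (- (p * (1 - p) * c * card S))) / M"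
  proof (intro divide_right_mono sum_mono)
    fix j assume j: "j \<in> {..<M}"
    obtain \<Phi> where \<Phi>: "norm \<Phi> \<le> exp (- (p * (1 - p) * (1 - cos (\<theta> j)))) ^ card S"
      "\<And>a. expectation ?M (\<lambda>f. cos (\<theta> j * of_int (signed_sum S s f) + a)) = Re (cis a * \<Phi>)"
      using expectation_cos_signed_sum[OF S(1-3), where s = s and \<theta> = "\<theta> j" and d = d] S(4) by blast
    have "expectation ?M (\<lambda>f. cos (\<theta> j * of_int (signed_sum S s f) + (- \<theta> j * of_int a)))
        \<le> norm (cis (- \<theta> j * of_int a) * \<Phi>)"
      unfolding \<Phi>(2) by (rule complex_Re_le_cmod)
    also have "\<dots> \<le> exp (- (p * (1 - p) * (1 - cos (\<theta> j)))) ^ card S"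
      using \<Phi>(1) by (simp add: norm_mult)
    also have "\<dots> = exp (- (p * (1 - p) * (1 - cos (\<theta> j)) * card S))"
      by (simp add: exp_of_nat_mult[symmetric] mult.commute)
    also have "\<dots> \<le> (if j = 0 then 1 else exp (- (p * (1 - p) * c * card S)))"
    proof (cases "j = 0")
      case False
      then have "c \<le> 1 - cos (\<theta> j)" using c j by (auto simp: \<theta>_def)
      then show ?thesis using False S(2,3) by (auto intro!: mult_right_mono mult_left_mono)
    qed (simp add: \<theta>_def)
    finally show "expectation ?M (\<lambda>f. cos (\<theta> j * of_int (signed_sum S s f) + (- \<theta> j * of_int a)))
      \<le> (if j = 0 then 1 else exp (- (p * (1 - p) * c * card S)))" .
  qed simp
  also have "(\<Sum>j<M. if j = 0 then 1 else exp (- (p * (1 - p) * c * card S)))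
      = 1 + (real M - 1) * exp (- (p * (1 - p) * c * card S))"
  proof -
    have "{..<M} \<inter> {j. j = 0} = {0}" "{..<M} \<inter> - {j. j = 0} = {..<M} - {0}" using assms(1) by auto
    then show ?thesis using assms(1) by (simp add: sum.If_cases of_nat_diff)
  qed
  also have "\<dots> / M \<le> 1 / real M + exp (- (p * (1 - p) * c * card S))"
    using assms(1) by (simp add: field_simps)
  finally show ?thesis .
qed

definition degree_in :: "nat \<Rightarrow> nat set set \<Rightarrow> nat \<Rightarrow> nat" where
  "degree_in n E x = card {w \<in> {1..n}. {x, w} \<in> E}"

text \<open>Only the \<open>n - 2\<close> edges from \<open>x\<close> to third vertices are kept
  random. The degree of \<open>y\<close> does not involve them, so equality of the degrees
  prescribes their signed sum.\<close>

lemma prob_degrees_eq_le: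
  assumes "M > 0" and c: "\<forall>j\<in>{1..<M}. 1 - cos (2 * pi * real j / real M) \<ge> c"
    and p: "0 \<le> p" "p \<le> 1" and xy: "x \<in> {1..n}" "y \<in> {1..n}" "x \<noteq> y"
  shows "prob (random_graph n p)
      {R. degree_in n (sym_diff G R) x = degree_in n (sym_diff G R) y}
    \<le> 1 / real M + exp (- (p * (1 - p) * c * (n - 2)))"
proof -
  define A where "A = {1..n} - {x, y}"
  define S where "S = (\<lambda>w. {x, w}) ` A"
  define s where "s = (\<lambda>e. if e \<in> G then -1 else 1 :: int)"
  have inj: "inj_on (\<lambda>w. {x, w}) A" by (rule inj_onI) (auto simp: doubleton_eq_iff)
  have "card A = n - 2"
    using xy unfolding A_def by (subst card_Diff_subset) auto
  then have cS: "card S = n - 2" by (simp add: S_def card_image[OF inj])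
  have finA: "finite A" by (simp add: A_def)
  have degx: "\<exists>a. \<forall>g. (degree_in n (perturbed n G (merge_on S g h)) x
      = degree_in n (perturbed n G (merge_on S g h)) y) \<longleftrightarrow> signed_sum S s g = a" for h
  proof -
    have y: "degree_in n (perturbed n G (merge_on S g h)) y = degree_in n (perturbed n G h) y" for g
    proof -
      have "{y, w} \<in> perturbed n G (merge_on S g h) \<longleftrightarrow> {y, w} \<in> perturbed n G h" for w
      proof -
        have "{y, w} \<notin> S" using xy by (auto simp: S_def A_def doubleton_eq_iff)
        then show ?thesis by (intro perturbed_cong) (simp add: merge_on_def)
      qed
      then show ?thesis by (simp add: degree_in_def)
    qed
    \<comment> \<open>\<open>b\<close> accounts for \<open>w = x\<close> and \<open>w = y\<close>;
      their doubletons with \<open>x\<close> are not in \<open>S\<close>.\<close>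
    define b where "b = card {w \<in> {x, y}. {x, w} \<in> perturbed n G h}"
    have x: "int (degree_in n (perturbed n G (merge_on S g h)) x)
      = int b + int (card {w \<in> A. {x, w} \<in> G}) + signed_sum S s g" for g
    proof -
      have "{w \<in> {1..n}. {x, w} \<in> perturbed n G (merge_on S g h)}
        = {w \<in> {x, y}. {x, w} \<in> perturbed n G h} \<union> {w \<in> A. ({x, w} \<in> G) \<noteq> g {x, w}}"
      proof -
        have 1: "{x, w} \<in> perturbed n G (merge_on S g h) \<longleftrightarrow> {x, w} \<in> perturbed n G h" if "w \<in> {x, y}" for w
        proof -
          have "{x, w} \<notin> S" using that xy by (auto simp: S_def A_def doubleton_eq_iff)
          then show ?thesis by (intro perturbed_cong) (simp add: merge_on_def)
        qed
        have 2: "{x, w} \<in> perturbed n G (merge_on S g h) \<longleftrightarrow> ({x, w} \<in> G) \<noteq> g {x, w}" if "w \<in> A" for w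
        proof -
          have "{x, w} \<in> S" using that by (simp add: S_def)
          moreover have "{x, w} \<in> all_edges n"
            using that xy by (auto simp: doubleton_in_all_edges_iff A_def)
          ultimately show ?thesis by (simp add: perturbed_iff merge_on_def)
        qed
        have "{1..n} = {x, y} \<union> A" using xy by (auto simp: A_def)
        then show ?thesis using 1 2 by blast
      qed
      then have "degree_in n (perturbed n G (merge_on S g h)) x
        = b + card {w \<in> A. ({x, w} \<in> G) \<noteq> g {x, w}}"
        unfolding degree_in_def b_def using finA by (subst card_Un_disjoint[symmetric]) (auto simp: A_def)
      moreover have "int (card {w \<in> A. ({x, w} \<in> G) \<noteq> g {x, w}})
        = int (card {w \<in> A. {x, w} \<in> G}) + signed_sum S s g"
      proof -
        have "int (card {w \<in> A. ({x, w} \<in> G) \<noteq> g {x, w}})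
          = (\<Sum>w\<in>A. if ({x, w} \<in> G) \<noteq> g {x, w} then 1 else 0)"
          using finA by (simp add: sum.If_cases Int_def)
        also have "\<dots> = (\<Sum>w\<in>A. (if {x, w} \<in> G then 1 else 0) + (if g {x, w} then s {x, w} else 0))"
          by (intro sum.cong) (auto simp: s_def)
        also have "\<dots> = int (card {w \<in> A. {x, w} \<in> G}) + signed_sum S s g"
          unfolding sum.distrib signed_sum_def S_def sum.reindex[OF inj] o_def
          using finA by (simp add: sum.If_cases Int_def)
        finally show ?thesis .
      qed
      ultimately show ?thesis by simp
    qed
    show ?thesis
    proof (intro exI allI)
      fix g
      show "(degree_in n (perturbed n G (merge_on S g h)) x
        = degree_in n (perturbed n G (merge_on S g h)) y) \<longleftrightarrow>
        signed_sum S s g = int (degree_in n (perturbed n G h) y) - int b - int (card {w \<in> A. {x, w} \<in> G})"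
        unfolding y using x[of g] by linarith
    qed
  qed
  \<comment> \<open>The splitting lemma is applied with the trivial event in the place of
    \<open>R\<close>.\<close>
  have "prob (random_edges n p)
      {f. degree_in n (perturbed n G f) x = degree_in n (perturbed n G f) y \<and> True}
    \<le> (1 / real M + exp (- (p * (1 - p) * c * (n - 2)))) * measure_pmf.prob
        (coins (all_edges n - S) False p) {f. True}"
  proof (rule prob_Pi_pmf_split_le)
    show "S \<subseteq> all_edges n" using xy by (auto simp: S_def A_def doubleton_in_all_edges_iff)
    show "prob (coins S False p)
          {g. degree_in n (perturbed n G (merge_on S g h)) x = degree_in n (perturbed n G (merge_on S g h)) y}
         \<le> 1 / real M + exp (- (p * (1 - p) * c * (n - 2)))" for h
    proof -
      obtain a where "\<And>g. (degree_in n (perturbed n G (merge_on S g h)) x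
        = degree_in n (perturbed n G (merge_on S g h)) y) \<longleftrightarrow> signed_sum S s g = a" using degx[of h] by blast
      then show ?thesis
        using prob_signed_sum_eq_le[OF assms(1) c, of S p s False a] p finA cS xy
        by (simp add: S_def s_def)
    qed
  qed (use assms in auto)
  then show ?thesis by (subst prob_random_graph) simp
qed

text \<open>Markov's inequality for the number \<open>Z\<close> of ordered pairs of distinct
  vertices with equal degrees. Its mean is at most \<open>\<theta> * n\<^sup>2\<close>, whereas a
  class of \<open>\<eta> * n\<close> vertices forces at least half of
  \<open>(\<eta> * n)\<^sup>2\<close> such pairs.\<close>

lemma prob_large_degree_class_le:
  assumes \<theta>: "\<And>x y. x \<in> {1..n} \<Longrightarrow> y \<in> {1..n} \<Longrightarrow> x \<noteq> y \<Longrightarrow>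
      prob (random_graph n p)
        {R. degree_in n (sym_diff G R) x = degree_in n (sym_diff G R) y} \<le> \<theta>"
    and "\<eta> > 0" "\<eta> * real n \<ge> 2" "\<theta> \<ge> 0"
  shows "prob (random_graph n p) {R. \<exists>C\<subseteq>{1..n}. real (card C) \<ge> \<eta> * real n \<and>
      (\<forall>x\<in>C. \<forall>y\<in>C. degree_in n (sym_diff G R) x = degree_in n (sym_diff G R) y)} \<le> 2 * \<theta> / \<eta>\<^sup>2"
proof -
  let ?M = "random_graph n p"
  define D where "D = {(x, y) \<in> {1..n} \<times> {1..n}. x \<noteq> y}"
  define Z where "Z = (\<lambda>R. \<Sum>(x, y)\<in>D. if degree_in n (sym_diff G R) x = degree_in n (sym_diff G R) y then 1 else 0 :: real)"
  have finM: "finite (set_pmf ?M)" by (simp add: random_graph_def)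
  have "D \<subseteq> {1..n} \<times> {1..n}" by (auto simp: D_def)
  then have finD: "finite D" "card D \<le> n * n"
    using card_mono[of "{1..n} \<times> {1..n}" D] finite_subset[of D "{1..n} \<times> {1..n}"] by auto
  have int: "integrable (measure_pmf ?M) h" for h :: "_ \<Rightarrow> real"
    using finM by (intro integrable_measure_pmf_finite)
  have n: "n > 0" using assms(2,3) by (cases n) auto
  have t: "(\<eta> * real n)\<^sup>2 / 2 > 0" using assms(2) n by simp
  have "prob ?M {R. \<exists>C\<subseteq>{1..n}. real (card C) \<ge> \<eta> * real n \<and>
      (\<forall>x\<in>C. \<forall>y\<in>C. degree_in n (sym_diff G R) x = degree_in n (sym_diff G R) y)}
    \<le> prob ?M {R \<in> space (measure_pmf ?M). Z R \<ge> (\<eta> * real n)\<^sup>2 / 2}"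
  proof (intro measure_pmf.finite_measure_mono)
    show "{R. \<exists>C\<subseteq>{1..n}. real (card C) \<ge> \<eta> * real n \<and>
      (\<forall>x\<in>C. \<forall>y\<in>C. degree_in n (sym_diff G R) x = degree_in n (sym_diff G R) y)}
      \<subseteq> {R \<in> space (measure_pmf ?M). Z R \<ge> (\<eta> * real n)\<^sup>2 / 2}"
    proof safe
      fix R C assume C: "C \<subseteq> {1..n}" "real (card C) \<ge> \<eta> * real n"
        "\<forall>x\<in>C. \<forall>y\<in>C. degree_in n (sym_diff G R) x = degree_in n (sym_diff G R) y"
      have finC: "finite C" using C(1) finite_subset by blast
      define c where "c = real (card C)"
      have c2: "c \<ge> 2" using C(2) assms(3) by (simp add: c_def)
      have "(\<eta> * real n)\<^sup>2 / 2 \<le> c\<^sup>2 / 2"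
        using C(2) assms(2) by (auto simp: c_def intro!: power_mono)
      \<comment> \<open>This comparison uses \<open>c \<ge> 2\<close>, the reason for assuming
        \<open>\<eta> * real n \<ge> 2\<close>.\<close>
      also have "\<dots> \<le> c * (c - 1)"
      proof -
        have "c * c \<ge> 2 * c" using c2 by (intro mult_right_mono) auto
        then show ?thesis by (simp add: power2_eq_square algebra_simps)
      qed
      also have "\<dots> = (\<Sum>(x, y)\<in>(SIGMA x:C. C - {x}). 1)"
        using finC c2 by (simp add: sum.Sigma[symmetric] c_def of_nat_diff)
      also have "\<dots> = (\<Sum>(x, y)\<in>(SIGMA x:C. C - {x}). if degree_in n (sym_diff G R) x = degree_in n (sym_diff G R) y then 1 else 0)"
      proof (rule sum.cong)
        fix z assume "z \<in> (SIGMA x:C. C - {x})"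
        then have "fst z \<in> C" "snd z \<in> C" by auto
        then have "degree_in n (sym_diff G R) (fst z) = degree_in n (sym_diff G R) (snd z)"
          using C(3) by blast
        then show "(case z of (x, y) \<Rightarrow> (1 :: real)) = (case z of (x, y) \<Rightarrow>
            if degree_in n (sym_diff G R) x = degree_in n (sym_diff G R) y then 1 else 0)"
          by (simp add: case_prod_unfold)
      qed simp
      also have "\<dots> \<le> Z R"
        unfolding Z_def by (rule sum_mono2[OF finD(1)]) (use C(1) in \<open>force simp: D_def\<close>, simp add: case_prod_unfold)
      finally show "(\<eta> * real n)\<^sup>2 / 2 \<le> Z R" .
    qed simp
  qed simp
  also have "\<dots> \<le> expectation ?M Z / ((\<eta> * real n)\<^sup>2 / 2)"
    by (rule integral_Markov_inequality_measure[where A = "{}"])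
      (use int t in \<open>auto simp: Z_def intro!: sum_nonneg AE_I2\<close>)
  also have "expectation ?M Z = (\<Sum>(x, y)\<in>D. prob ?M
        {R. degree_in n (sym_diff G R) x = degree_in n (sym_diff G R) y})"
  proof -
    have "(if P then 1 else 0 :: real) = indicator {R. Q R} R" if "P = Q R" for P Q R
      using that by simp
    then have "Z = (\<lambda>R. \<Sum>q\<in>D. indicator {R. degree_in n (sym_diff G R) (fst q) = degree_in n (sym_diff G R) (snd q)} R)"
      unfolding Z_def case_prod_unfold by (intro ext sum.cong) (auto simp: indicator_def)
    then show ?thesis
      using int by (simp add: Bochner_Integration.integral_sum case_prod_unfold)
  qed
  also have "\<dots> \<le> (\<Sum>(x, y)\<in>D. \<theta>)"
    by (intro sum_mono) (auto simp: D_def intro: \<theta>)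
  also have "\<dots> \<le> \<theta> * (real n)\<^sup>2"
    using finD assms(4) mult_right_mono[of "real (card D)" "real (n * n)" \<theta>]
    by (simp add: power2_eq_square algebra_simps flip: of_nat_mult)
  finally show ?thesis
    using t n assms(2) by (simp add: divide_simps power_mult_distrib split: if_splits)
qed

section \<open>Pairings\<close>

text \<open>A finite matching whose edges carry an orientation; \<open>(x, y)\<close> and
  \<open>(y, x)\<close> cannot both occur, because their vertex sets meet.\<close>

definition pairing :: "('a \<times> 'a) set \<Rightarrow> bool" where
  "pairing \<P> \<longleftrightarrow> finite \<P> \<and> (\<forall>x y. (x, y) \<in> \<P> \<longrightarrow> x \<noteq> y) \<and>
     (\<forall>x y x' y'. (x, y) \<in> \<P> \<longrightarrow> (x', y') \<in> \<P> \<longrightarrow> (x, y) \<noteq> (x', y') \<longrightarrow> {x, y} \<inter> {x', y'} = {})"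

definition support :: "('a \<times> 'a) set \<Rightarrow> 'a set" where
  "support \<P> = fst ` \<P> \<union> snd ` \<P>"

lemma support_simps [simp]:
  "support {} = {}"
  "support (insert (x, y) \<P>) = {x, y} \<union> support \<P>"
  "support (\<P> \<union> \<Q>) = support \<P> \<union> support \<Q>"
  by (auto simp: support_def)

lemma support_subsetI: "(\<And>x y. (x, y) \<in> \<P> \<Longrightarrow> x \<in> A \<and> y \<in> A) \<Longrightarrow> support \<P> \<subseteq> A"
  by (force simp: support_def)

lemma finite_support [simp]: "finite \<P> \<Longrightarrow> finite (support \<P>)"
  by (simp add: support_def)

lemma pairing_empty [simp]: "pairing {}"
  by (simp add: pairing_def)

lemma in_supportI: "(x, y) \<in> \<P> \<Longrightarrow> x \<in> support \<P> \<and> y \<in> support \<P>"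
  unfolding support_def by (metis UnI1 UnI2 fst_conv imageI snd_conv)

lemma pairing_neq: "pairing \<P> \<Longrightarrow> (x, y) \<in> \<P> \<Longrightarrow> x \<noteq> y"
  by (simp add: pairing_def)

lemma pairing_finite: "pairing \<P> \<Longrightarrow> finite \<P>"
  by (simp add: pairing_def)

lemma pairing_disjoint:
  "pairing \<P> \<Longrightarrow> (x, y) \<in> \<P> \<Longrightarrow> (x', y') \<in> \<P> \<Longrightarrow> (x, y) \<noteq> (x', y') \<Longrightarrow> {x, y} \<inter> {x', y'} = {}"
  unfolding pairing_def by (elim conjE allE, erule impE, assumption, erule impE, assumption, erule mp)

lemma pairingI:
  assumes "finite \<P>" "\<And>x y. (x, y) \<in> \<P> \<Longrightarrow> x \<noteq> y"
    and "\<And>x y x' y'. (x, y) \<in> \<P> \<Longrightarrow> (x', y') \<in> \<P> \<Longrightarrow> (x, y) \<noteq> (x', y') \<Longrightarrow> {x, y} \<inter> {x', y'} = {}"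
  shows "pairing \<P>"
  unfolding pairing_def by (intro conjI allI impI assms)

lemma pairing_subset:
  assumes "pairing \<P>" "\<Q> \<subseteq> \<P>"
  shows "pairing \<Q>"
proof (rule pairingI)
  show "finite \<Q>" using finite_subset[OF assms(2) pairing_finite[OF assms(1)]] .
  show "x \<noteq> y" if "(x, y) \<in> \<Q>" for x y
    using pairing_neq[OF assms(1) subsetD[OF assms(2) that]] .
  show "{x, y} \<inter> {x', y'} = {}" if "(x, y) \<in> \<Q>" "(x', y') \<in> \<Q>" "(x, y) \<noteq> (x', y')" for x y x' y'
    using pairing_disjoint[OF assms(1) subsetD[OF assms(2) that(1)] subsetD[OF assms(2) that(2)] that(3)] .
qed

lemma pairing_Un:
  assumes "pairing \<P>" "pairing \<Q>" "support \<P> \<inter> support \<Q> = {}"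
  shows "pairing (\<P> \<union> \<Q>)"
proof (rule pairingI)
  show "finite (\<P> \<union> \<Q>)" using assms(1,2) by (simp add: pairing_def)
  show "x \<noteq> y" if "(x, y) \<in> \<P> \<union> \<Q>" for x y
    using that by (rule UnE) (fact pairing_neq[OF assms(1)] pairing_neq[OF assms(2)])+
  have cross: "{x, y} \<inter> {x', y'} = {}" if "(x, y) \<in> \<P>" "(x', y') \<in> \<Q>" for x y x' y'
    using in_supportI[OF that(1)] in_supportI[OF that(2)] assms(3) by blast
  show "{x, y} \<inter> {x', y'} = {}"
    if "(x, y) \<in> \<P> \<union> \<Q>" "(x', y') \<in> \<P> \<union> \<Q>" "(x, y) \<noteq> (x', y')" for x y x' y'
    using that(1,2) unfolding Un_iff
  proof (elim disjE)
    assume "(x, y) \<in> \<P>" "(x', y') \<in> \<P>"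
    then show ?thesis by (rule pairing_disjoint[OF assms(1) _ _ that(3)])
  next
    assume "(x, y) \<in> \<Q>" "(x', y') \<in> \<Q>"
    then show ?thesis by (rule pairing_disjoint[OF assms(2) _ _ that(3)])
  next
    assume "(x, y) \<in> \<P>" "(x', y') \<in> \<Q>"
    then show ?thesis by (rule cross)
  next
    assume "(x, y) \<in> \<Q>" "(x', y') \<in> \<P>"
    then show ?thesis using cross[of x' y' x y] by blast
  qed
qed

lemma pairing_insert:
  assumes "pairing \<P>" "x \<noteq> y" "x \<notin> support \<P>" "y \<notin> support \<P>"
  shows "pairing (insert (x, y) \<P>)"
proof -
  have "pairing {(x, y)}" using assms(2) by (intro pairingI) auto
  then have "pairing ({(x, y)} \<union> \<P>)" using assms by (intro pairing_Un) auto
  then show ?thesis by simp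
qed

lemma card_support_le: "finite \<P> \<Longrightarrow> card (support \<P>) \<le> 2 * card \<P>"
  unfolding support_def using card_Un_le[of "fst ` \<P>" "snd ` \<P>"] card_image_le[of \<P> fst] card_image_le[of \<P> snd]
  by linarith

lemma exists_pairing:
  assumes "finite C" "2 * m \<le> card C"
  shows "\<exists>\<P>. pairing \<P> \<and> card \<P> = m \<and> support \<P> \<subseteq> C"
  using assms(2)
proof (induction m)
  case 0
  show ?case by (intro exI[of _ "{}"]) simp
next
  case (Suc m)
  then obtain \<P> where P: "pairing \<P>" "card \<P> = m" "support \<P> \<subseteq> C" by auto
  have fin: "finite \<P>" using P(1) by (simp add: pairing_def)
  have "card (C - support \<P>) \<ge> 2"
    using card_support_le[OF fin] P(2,3) Suc.prems fin by (subst card_Diff_subset) auto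
  then obtain T where "T \<subseteq> C - support \<P>" "card T = 2"
    by (meson obtain_subset_with_card_n)
  then obtain x y where xy: "x \<noteq> y" "x \<in> C - support \<P>" "y \<in> C - support \<P>"
    by (auto simp: card_2_iff)
  have "(x, y) \<notin> \<P>" using xy in_supportI[of x y \<P>] by blast
  then show ?case
    using P xy fin by (intro exI[of _ "insert (x, y) \<P>"]) (auto intro!: pairing_insert)
qed

text \<open>The classes are paired separately and the pairings are united. The last clause limits
  the part of each class that is used up, so that a small \<open>m j\<close> leaves fresh vertices
  for the parity estimate.\<close>

lemma exists_pairing_in_classes:
  assumes "finite J" "disjoint_family_on C J" "\<And>j. j \<in> J \<Longrightarrow> finite (C j)"
    and "\<And>j. j \<in> J \<Longrightarrow> 2 * m j \<le> card (C j)"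
  shows "\<exists>\<P>. pairing \<P> \<and> card \<P> = (\<Sum>j\<in>J. m j) \<and> (\<forall>(x, y)\<in>\<P>. \<exists>j\<in>J. x \<in> C j \<and> y \<in> C j)
    \<and> (\<forall>j\<in>J. card (support \<P> \<inter> C j) \<le> 2 * m j)"
  using assms
proof (induction J rule: finite_induct)
  case empty
  show ?case by (intro exI[of _ "{}"]) simp
next
  case (insert k J)
  have disj: "C i \<inter> C j = {}" if "i \<in> insert k J" "j \<in> insert k J" "i \<noteq> j" for i j
    using insert.prems(1) that unfolding disjoint_family_on_def by blast
  have "disjoint_family_on C J" using insert.prems(1) unfolding disjoint_family_on_def by blast
  then obtain \<P> where P: "pairing \<P>" "card \<P> = (\<Sum>j\<in>J. m j)"
    "\<forall>(x, y)\<in>\<P>. \<exists>j\<in>J. x \<in> C j \<and> y \<in> C j" "\<forall>j\<in>J. card (support \<P> \<inter> C j) \<le> 2 * m j"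
    using insert.IH[OF _ insert.prems(2,3)] by blast
  obtain \<Q> where Q: "pairing \<Q>" "card \<Q> = m k" "support \<Q> \<subseteq> C k"
    using exists_pairing[of "C k" "m k"] insert.prems by auto
  have sP: "support \<P> \<subseteq> (\<Union>j\<in>J. C j)"
    by (rule support_subsetI) (use P(3) in blast)
  have "(\<Union>j\<in>J. C j) \<inter> C k = {}" using disj insert.hyps by fastforce
  then have dd2: "support \<P> \<inter> C k = {}" using sP by blast
  then have dd1: "support \<P> \<inter> support \<Q> = {}" using Q(3) by blast
  have dPQ: "\<P> \<inter> \<Q> = {}"
  proof -
    have False if "(x, y) \<in> \<P>" "(x, y) \<in> \<Q>" for x y
      using in_supportI[OF that(1)] in_supportI[OF that(2)] dd1 by blast
    then show ?thesis by auto
  qed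
  have fin: "finite \<P>" "finite \<Q>" using P(1) Q(1) by (simp_all add: pairing_finite)
  show ?case
  proof (intro exI[of _ "\<P> \<union> \<Q>"] conjI)
    show "pairing (\<P> \<union> \<Q>)" using P(1) Q(1) dd1 by (rule pairing_Un)
    show "card (\<P> \<union> \<Q>) = (\<Sum>j\<in>insert k J. m j)"
      using fin dPQ P(2) Q(2) insert.hyps by (simp add: card_Un_disjoint)
    show "\<forall>(x, y)\<in>\<P> \<union> \<Q>. \<exists>j\<in>insert k J. x \<in> C j \<and> y \<in> C j"
    proof (clarify, elim UnE)
      fix x y assume "(x, y) \<in> \<P>"
      then show "\<exists>j\<in>insert k J. x \<in> C j \<and> y \<in> C j" using P(3) by blast
    next
      fix x y assume "(x, y) \<in> \<Q>"
      then show "\<exists>j\<in>insert k J. x \<in> C j \<and> y \<in> C j" using Q(3) in_supportI[of x y \<Q>] by blast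
    qed
    show "\<forall>j\<in>insert k J. card (support (\<P> \<union> \<Q>) \<inter> C j) \<le> 2 * m j"
    proof
      fix j assume j: "j \<in> insert k J"
      show "card (support (\<P> \<union> \<Q>) \<inter> C j) \<le> 2 * m j"
      proof (cases "j = k")
        case True
        have "support (\<P> \<union> \<Q>) \<inter> C j = support \<Q>" using dd2 Q(3) True unfolding support_simps by blast
        then show ?thesis using card_support_le[OF fin(2)] Q(2) True by simp
      next
        case False
        have "support \<Q> \<inter> C j = {}" using Q(3) disj[OF j _ False] by blast
        then have "support (\<P> \<union> \<Q>) \<inter> C j = support \<P> \<inter> C j" unfolding support_simps by blast
        then show ?thesis using P(4) j False by simp
      qed
    qed
  qed
qed

text \<open>Pairs are removed until two or three elements are left; removing one from at least four
  elements leaves at least two.\<close>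

lemma exists_blocks_of_size_2_or_3:
  assumes "finite A" "card A \<ge> 2"
  shows "\<exists>\<B>. disjoint \<B> \<and> \<Union>\<B> = A \<and> (\<forall>b\<in>\<B>. card b \<in> {2, 3})"
  using assms
proof (induction "card A" arbitrary: A rule: less_induct)
  case less
  show ?case
  proof (cases "card A \<le> 3")
    case True
    then show ?thesis using less.prems by (intro exI[of _ "{A}"]) auto
  next
    case False
    obtain T where T: "T \<subseteq> A" "card T = 2" using less.prems by (meson obtain_subset_with_card_n)
    have finT: "finite T" using T less.prems finite_subset by blast
    have "card (A - T) = card A - 2" using T finT by (simp add: card_Diff_subset)
    then have small: "card (A - T) < card A" "2 \<le> card (A - T)" using False by simp_all
    have "\<exists>\<B>. disjoint \<B> \<and> \<Union>\<B> = A - T \<and> (\<forall>b\<in>\<B>. card b \<in> {2, 3})"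
      using less.hyps[OF small(1) finite_Diff[OF less.prems(1)] small(2)] .
    then obtain \<B> where B: "disjoint \<B>" "\<Union>\<B> = A - T" "\<forall>b\<in>\<B>. card b \<in> {2, 3}"
      by (elim exE conjE)
    have "disjoint (insert T \<B>)"
    proof (rule disjoint_union[of "{T}" \<B>, simplified])
      show "T \<inter> \<Union>\<B> = {}" unfolding B(2) by blast
    qed (fact B(1))
    then show ?thesis
      using B T(1,2) by (intro exI[of _ "insert T \<B>"] conjI) auto
  qed
qed

section \<open>Equitable partitions\<close>

definition equitable :: "nat \<Rightarrow> nat set set \<Rightarrow> (nat \<Rightarrow> 'c) \<Rightarrow> bool" where
  "equitable n E c \<longleftrightarrow> (\<forall>x\<in>{1..n}. \<forall>y\<in>{1..n}. c x = c y \<longrightarrow>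
     (\<forall>\<omega>. card {w \<in> {1..n}. {x, w} \<in> E \<and> c w = \<omega>} = card {w \<in> {1..n}. {y, w} \<in> E \<and> c w = \<omega>}))"

text \<open>A set closed under equality of colours is a union of classes, and the degree into it is
  the sum of the degrees into these classes.\<close>

lemma equitable_degree_into:
  assumes "equitable n E c" "x \<in> {1..n}" "y \<in> {1..n}" "c x = c y"
    and B: "B \<subseteq> {1..n}" "\<And>v w. v \<in> B \<Longrightarrow> w \<in> {1..n} \<Longrightarrow> c v = c w \<Longrightarrow> w \<in> B"
  shows "card {w \<in> B. {x, w} \<in> E} = card {w \<in> B. {y, w} \<in> E}"
proof -
  have finB: "finite B" using B(1) finite_subset by blast
  have "card {w \<in> B. {z, w} \<in> E} = (\<Sum>\<omega>\<in>c ` B. card {w \<in> {1..n}. {z, w} \<in> E \<and> c w = \<omega>})" for z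
  proof -
    have "{w \<in> B. {z, w} \<in> E} = (\<Union>\<omega>\<in>c ` B. {w \<in> {1..n}. {z, w} \<in> E \<and> c w = \<omega>})"
    proof safe
      fix w v assume "w \<in> {1..n}" "v \<in> B" "c w = c v"
      then show "w \<in> B" using B(2)[of v w] by simp
    qed (use B in auto)
    then show ?thesis
      using finB by (subst card_UN_disjoint[symmetric]) auto
  qed
  moreover have "\<forall>\<omega>. card {w \<in> {1..n}. {x, w} \<in> E \<and> c w = \<omega>} = card {w \<in> {1..n}. {y, w} \<in> E \<and> c w = \<omega>}"
    using assms(1-4) unfolding equitable_def by blast
  ultimately show ?thesis by simp
qed

section \<open>The four exceptional events, stated without reference to a colouring\<close>

definition small_event :: "real \<Rightarrow> nat \<Rightarrow> nat set set \<Rightarrow> bool" where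
  "small_event \<delta> n E \<longleftrightarrow> (\<exists>\<B>. \<B> \<noteq> {} \<and> disjoint \<B> \<and> \<Union>\<B> \<subseteq> {1..n} \<and> (\<forall>b\<in>\<B>. card b \<in> {2, 3})
     \<and> real (card (\<Union>\<B>)) \<le> \<delta> * real n
     \<and> (\<forall>b\<in>\<B>. \<forall>w\<in>{1..n} - \<Union>\<B>. \<forall>x\<in>b. \<forall>y\<in>b. ({x, w} \<in> E) = ({y, w} \<in> E)))"

definition degree_event :: "real \<Rightarrow> nat \<Rightarrow> nat set set \<Rightarrow> bool" where
  "degree_event \<eta> n E \<longleftrightarrow> (\<exists>C\<subseteq>{1..n}. real (card C) \<ge> \<eta> * real n \<and>
      (\<forall>x\<in>C. \<forall>y\<in>C. degree_in n E x = degree_in n E y))"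

abbreviation fibre :: "nat \<Rightarrow> (nat \<Rightarrow> nat) \<Rightarrow> nat \<Rightarrow> nat set" where
  "fibre n \<phi> j \<equiv> {v \<in> {1..n}. \<phi> v = j}"

text \<open>A family of \<open>K\<close> disjoint sets is encoded by one map, with the value 0 for
  the vertices outside all of them. Counting the families then means counting maps into
  \<open>K + 1\<close> values.\<close>

definition big_classes_event :: "nat \<Rightarrow> real \<Rightarrow> nat \<Rightarrow> nat \<Rightarrow> nat set set \<Rightarrow> bool" where
  "big_classes_event b \<delta> K n E \<longleftrightarrow> (\<exists>\<phi>\<in>{1..n} \<rightarrow>\<^sub>E {0..K}. (\<forall>j\<in>{1..K}. b \<le> card (fibre n \<phi> j))
     \<and> \<delta> * real n \<le> real (\<Sum>j\<in>{1..K}. card (fibre n \<phi> j))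
     \<and> (\<forall>i\<in>{1..K}. \<forall>x\<in>fibre n \<phi> i. \<forall>y\<in>fibre n \<phi> i. \<forall>j\<in>{1..K}.
          same_parity E (fibre n \<phi> j) x y))"

text \<open>Only groups of at most \<open>2 * b\<close> vertices are tested, since for them the
  parity factor is close to its first-order value. The bound on the sum says that the other groups
  cover at most \<open>2 * \<delta> * n\<close> vertices.\<close>

definition grouping_event :: "nat \<Rightarrow> nat \<Rightarrow> real \<Rightarrow> nat \<Rightarrow> nat \<Rightarrow> nat set set \<Rightarrow> bool" where
  "grouping_event b r \<delta> m n E \<longleftrightarrow> (\<exists>\<phi>\<in>{1..n} \<rightarrow>\<^sub>E {..<r}. \<exists>\<P>\<subseteq>{1..n} \<times> {1..n}. pairing \<P> \<and> card \<P> = m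
     \<and> (1 - 2 * \<delta>) * real n \<le> real (\<Sum>j | j < r \<and> card (fibre n \<phi> j) \<le> 2 * b. card (fibre n \<phi> j))
     \<and> (\<forall>(x, y)\<in>\<P>. \<forall>j\<in>{j. j < r \<and> card (fibre n \<phi> j) \<le> 2 * b}.
          same_parity E (fibre n \<phi> j) x y))"

section \<open>Non-discrete equitable partitions cause one of the events\<close>

context
  fixes n :: nat and E :: "nat set set" and c :: "nat \<Rightarrow> 'c"
  assumes equitable: "equitable n E c"
begin

definition col_class :: "nat \<Rightarrow> nat set" where
  "col_class v = {w \<in> {1..n}. c w = c v}"

lemma finite_col_class [simp]: "finite (col_class v)"
  by (simp add: col_class_def)

lemma col_class_subset: "col_class v \<subseteq> {1..n}"
  by (auto simp: col_class_def)

lemma self_in_col_class: "v \<in> {1..n} \<Longrightarrow> v \<in> col_class v"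
  by (simp add: col_class_def)

lemma col_class_disjoint: "C \<in> col_class ` {1..n} \<Longrightarrow> D \<in> col_class ` {1..n} \<Longrightarrow> C \<noteq> D \<Longrightarrow> C \<inter> D = {}"
  by (auto simp: col_class_def)

text \<open>The set \<open>U\<close> of the opening outline.\<close>

definition nontrivial :: "nat set" where
  "nontrivial = {v \<in> {1..n}. card (col_class v) \<ge> 2}"

lemma nontrivial_nonempty:
  assumes "\<not> inj_on c {1..n}"
  shows "nontrivial \<noteq> {}"
proof -
  obtain x y where xy: "x \<in> {1..n}" "y \<in> {1..n}" "c x = c y" "x \<noteq> y" using assms by (auto simp: inj_on_def)
  then have "{x, y} \<subseteq> col_class x" by (auto simp: col_class_def)
  then have "card {x, y} \<le> card (col_class x)" by (intro card_mono) auto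
  then show ?thesis using xy by (auto simp: nontrivial_def)
qed

lemma Union_nontrivial_classes: "(\<Union>C\<in>col_class ` nontrivial. C) = nontrivial"
proof safe
  fix w v assume "v \<in> nontrivial" "w \<in> col_class v"
  then have "w \<in> {1..n}" "col_class w = col_class v" by (auto simp: col_class_def)
  then show "w \<in> nontrivial" using \<open>v \<in> nontrivial\<close> by (simp add: nontrivial_def)
next
  fix v assume "v \<in> nontrivial"
  then show "v \<in> (\<Union>C\<in>col_class ` nontrivial. C)" using self_in_col_class by (auto simp: nontrivial_def)
qed

text \<open>Each class inside \<open>nontrivial\<close> is cut into blocks on its own. A vertex
  \<open>w\<close> outside is alone in its class, and the degree into \<open>{w}\<close> is 1 or 0
  according to adjacency to \<open>w\<close>; so equal degrees make \<open>w\<close> joined to all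
  or none of a block.\<close>

lemma equitable_small_event:
  assumes "\<not> inj_on c {1..n}" "real (card nontrivial) \<le> \<delta> * real n"
  shows "small_event \<delta> n E"
proof -
  let ?\<C> = "col_class ` nontrivial"
  have "\<forall>C\<in>?\<C>. \<exists>\<B>. disjoint \<B> \<and> \<Union>\<B> = C \<and> (\<forall>b\<in>\<B>. card b \<in> {2, 3})"
  proof
    fix C assume "C \<in> ?\<C>"
    then have "finite C" "card C \<ge> 2" by (auto simp: nontrivial_def)
    then show "\<exists>\<B>. disjoint \<B> \<and> \<Union>\<B> = C \<and> (\<forall>b\<in>\<B>. card b \<in> {2, 3})"
      by (rule exists_blocks_of_size_2_or_3)
  qed
  then obtain blk where blk: "\<And>C. C \<in> ?\<C> \<Longrightarrow> disjoint (blk C) \<and> \<Union>(blk C) = C \<and> (\<forall>b\<in>blk C. card b \<in> {2, 3})"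
    by metis
  have blk_disjoint: "disjoint (blk (col_class v))" and blk_Union: "\<Union>(blk (col_class v)) = col_class v"
    and blk_card: "b \<in> blk (col_class v) \<Longrightarrow> card b \<in> {2, 3}" if "v \<in> nontrivial" for v b
    using blk[OF imageI[OF that]] by blast+
  define \<B> where "\<B> = (\<Union>v\<in>nontrivial. blk (col_class v))"
  have in_class: "\<exists>v\<in>nontrivial. b \<in> blk (col_class v) \<and> b \<subseteq> col_class v" if b: "b \<in> \<B>" for b
  proof -
    obtain v where v: "v \<in> nontrivial" "b \<in> blk (col_class v)" using b unfolding \<B>_def by (rule UN_E)
    then have "b \<subseteq> \<Union>(blk (col_class v))" by auto
    then show ?thesis using v blk_Union by auto
  qed
  have union: "\<Union>\<B> = nontrivial"
  proof -
    have "\<Union>\<B> = (\<Union>v\<in>nontrivial. \<Union>(blk (col_class v)))" unfolding \<B>_def by blast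
    also have "\<dots> = (\<Union>C\<in>?\<C>. C)" using blk_Union by simp
    also have "\<dots> = nontrivial" by (rule Union_nontrivial_classes)
    finally show ?thesis .
  qed
  show ?thesis
    unfolding small_event_def
  proof (intro exI[of _ \<B>] conjI ballI)
    show "\<B> \<noteq> {}" using nontrivial_nonempty[OF assms(1)] union by auto
    show "disjoint \<B>"
    proof (rule disjointI)
      fix a b assume ab: "a \<in> \<B>" "b \<in> \<B>" "a \<noteq> b"
      obtain v where v: "v \<in> nontrivial" "a \<in> blk (col_class v)" "a \<subseteq> col_class v" using in_class[OF ab(1)] by (elim bexE conjE)
      obtain w where w: "w \<in> nontrivial" "b \<in> blk (col_class w)" "b \<subseteq> col_class w" using in_class[OF ab(2)] by (elim bexE conjE)
      show "a \<inter> b = {}"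
      proof (cases "col_class v = col_class w")
        case True
        then show ?thesis using disjointD[OF blk_disjoint[OF w(1)] _ w(2) ab(3)] v(2) by simp
      next
        case False
        then have "col_class v \<inter> col_class w = {}"
          using v(1) w(1) by (intro col_class_disjoint) (auto simp: nontrivial_def)
        then show ?thesis using v(3) w(3) by blast
      qed
    qed
    show "\<Union>\<B> \<subseteq> {1..n}" unfolding union by (auto simp: nontrivial_def)
    show "card b \<in> {2, 3}" if "b \<in> \<B>" for b using in_class[OF that] blk_card by blast
    show "real (card (\<Union>\<B>)) \<le> \<delta> * real n" unfolding union using assms(2) .
    show "({x, w} \<in> E) = ({y, w} \<in> E)" if b: "b \<in> \<B>" and w: "w \<in> {1..n} - \<Union>\<B>" and x: "x \<in> b" and y: "y \<in> b" for b w x y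
    proof -
      have "card (col_class w) < 2" using w unfolding union by (auto simp: nontrivial_def)
      moreover have "w \<in> col_class w" using w self_in_col_class by simp
      ultimately have cw: "col_class w = {w}"
        by (metis One_nat_def card_0_eq card_1_singletonE empty_iff finite_col_class less_2_cases singletonD)
      obtain v where v: "b \<subseteq> col_class v" using in_class[OF b] by (elim bexE conjE)
      have "card {u \<in> {w}. {x, u} \<in> E} = card {u \<in> {w}. {y, u} \<in> E}"
      proof (rule equitable_degree_into[OF equitable])
        show "x \<in> {1..n}" "y \<in> {1..n}" "c x = c y" using subsetD[OF v x] subsetD[OF v y] by (auto simp: col_class_def)
        show "u' \<in> {w}" if "u \<in> {w}" "u' \<in> {1..n}" "c u = c u'" for u u'
          using that cw by (auto simp: col_class_def)
      qed (use w in auto)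
      moreover have "{u \<in> {w}. {z, u} \<in> E} = (if {z, w} \<in> E then {w} else {})" for z by auto
      ultimately show ?thesis by (auto split: if_splits)
    qed
  qed
qed

text \<open>The whole vertex set is a union of classes, so the full degrees are constant on each
  class.\<close>

lemma equitable_degree_event:
  assumes "v \<in> {1..n}" "real (card (col_class v)) \<ge> \<eta> * real n"
  shows "degree_event \<eta> n E"
  unfolding degree_event_def degree_in_def
proof (intro exI[of _ "col_class v"] conjI ballI)
  fix x y assume "x \<in> col_class v" "y \<in> col_class v"
  then show "card {w \<in> {1..n}. {x, w} \<in> E} = card {w \<in> {1..n}. {y, w} \<in> E}"
    by (intro equitable_degree_into[OF equitable]) (auto simp: col_class_def)
qed (use assms col_class_subset in auto)

definition big_classes :: "nat \<Rightarrow> nat set set" where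
  "big_classes b = {C \<in> col_class ` {1..n}. card C \<ge> b}"

lemma finite_big_classes [simp]: "finite (big_classes b)"
  by (simp add: big_classes_def)

lemma card_big_classes_le: "card (big_classes b) \<le> n"
proof -
  have "card (big_classes b) \<le> card (col_class ` {1..n})"
    by (rule card_mono) (auto simp: big_classes_def)
  also have "\<dots> \<le> card {1..n}" by (rule card_image_le) simp
  finally show ?thesis by simp
qed

lemma equitable_big_classes_event:
  assumes "\<delta> * real n \<le> real (\<Sum>C\<in>big_classes b. card C)"
  shows "big_classes_event b \<delta> (card (big_classes b)) n E"
proof -
  define K where "K = card (big_classes b)"
  obtain h where h: "bij_betw h {1..K} (big_classes b)"
    using ex_bij_betw_nat_finite_1[OF finite_big_classes] K_def by blast
  define \<phi> where "\<phi> = (\<lambda>v\<in>{1..n}. if col_class v \<in> big_classes b then the_inv_into {1..K} h (col_class v) else 0)"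
  have fib: "fibre n \<phi> j = h j" if j: "j \<in> {1..K}" for j
  proof -
    have hj: "h j \<in> big_classes b" using h j by (auto simp: bij_betw_def)
    then obtain u where u: "u \<in> {1..n}" "h j = col_class u" by (auto simp: big_classes_def)
    show ?thesis
    proof (rule set_eqI)
      fix v
      show "v \<in> fibre n \<phi> j \<longleftrightarrow> v \<in> h j"
      proof
        assume "v \<in> fibre n \<phi> j"
        then have v: "v \<in> {1..n}" "\<phi> v = j" by auto
        then have "col_class v \<in> big_classes b" "the_inv_into {1..K} h (col_class v) = j"
          using j by (auto simp: \<phi>_def split: if_splits)
        then have "h j = col_class v"
          using h f_the_inv_into_f[of h "{1..K}" "col_class v"] by (auto simp: bij_betw_def)
        then show "v \<in> h j" using self_in_col_class v by simp
      next
        assume v: "v \<in> h j"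
        then have "v \<in> {1..n}" "col_class v = h j" using u by (auto simp: col_class_def)
        moreover have "the_inv_into {1..K} h (h j) = j"
          using h j by (auto simp: bij_betw_def the_inv_into_f_f)
        ultimately show "v \<in> fibre n \<phi> j" using hj by (auto simp: \<phi>_def)
      qed
    qed
  qed
  show ?thesis
    unfolding big_classes_event_def K_def[symmetric]
  proof (intro bexI[of _ \<phi>] conjI ballI)
    show "\<phi> \<in> {1..n} \<rightarrow>\<^sub>E {0..K}"
    proof -
      have "the_inv_into {1..K} h C \<le> K" if "C \<in> big_classes b" for C
        using the_inv_into_into[of h "{1..K}" C "{1..K}"] that h by (auto simp: bij_betw_def)
      then show ?thesis by (auto simp: \<phi>_def)
    qed
    show "b \<le> card (fibre n \<phi> j)" if "j \<in> {1..K}" for j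
      unfolding fib[OF that] using h that by (auto simp: bij_betw_def big_classes_def)
    have "(\<Sum>j\<in>{1..K}. card (fibre n \<phi> j)) = (\<Sum>j\<in>{1..K}. card (h j))"
      by (rule sum.cong) (use fib in auto)
    also have "\<dots> = (\<Sum>C\<in>big_classes b. card C)"
      by (rule sum.reindex_bij_betw[OF h])
    finally show "\<delta> * real n \<le> real (\<Sum>j\<in>{1..K}. card (fibre n \<phi> j))" using assms by simp
    fix i x y j assume *: "i \<in> {1..K}" "x \<in> fibre n \<phi> i" "y \<in> fibre n \<phi> i" "j \<in> {1..K}"
    have hi: "h i \<in> col_class ` {1..n}" "h j \<in> col_class ` {1..n}"
      using bij_betw_apply[OF h *(1)] bij_betw_apply[OF h *(4)] by (auto simp: big_classes_def)
    have "card {w \<in> h j. {x, w} \<in> E} = card {w \<in> h j. {y, w} \<in> E}"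
    proof (rule equitable_degree_into[OF equitable])
      show "c x = c y" using *(2,3) hi unfolding fib[OF *(1)] by (auto simp: col_class_def)
    qed (use * hi in \<open>auto simp: col_class_def\<close>)
    then show "same_parity E (fibre n \<phi> j) x y"
      unfolding fib[OF *(4)] by simp
  qed
qed

lemma sum_fibres: "\<phi> ` {1..n} \<subseteq> {..<r} \<Longrightarrow> (\<Sum>j<r. card (fibre n \<phi> j)) = n"
proof -
  assume r: "\<phi> ` {1..n} \<subseteq> {..<r}"
  have "(\<Sum>j<r. card (fibre n \<phi> j)) = card (\<Union>j<r. fibre n \<phi> j)"
    by (subst card_UN_disjoint) auto
  also have "(\<Union>j<r. fibre n \<phi> j) = {1..n}" using r by auto
  finally show ?thesis by simp
qed

text \<open>A class of \<open>c \<ge> 2\<close> vertices yields \<open>c div 2\<close> disjoint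
  pairs, and \<open>3 * (c div 2) \<ge> c\<close> with equality for \<open>c = 3\<close>.\<close>

lemma nontrivial_pairing:
  assumes "3 * m \<le> card nontrivial"
  shows "\<exists>\<P>\<subseteq>{1..n} \<times> {1..n}. pairing \<P> \<and> card \<P> = m \<and> (\<forall>(x, y)\<in>\<P>. c x = c y)"
proof -
  let ?J = "col_class ` nontrivial"
  have disj: "disjoint_family_on (\<lambda>C. C) ?J"
    unfolding disjoint_family_on_def
    by (intro ballI impI col_class_disjoint) (auto simp: nontrivial_def)
  have "\<exists>\<P>. pairing \<P> \<and> card \<P> = (\<Sum>C\<in>?J. card C div 2) \<and> (\<forall>(x, y)\<in>\<P>. \<exists>C\<in>?J. x \<in> C \<and> y \<in> C)
    \<and> (\<forall>C\<in>?J. card (support \<P> \<inter> C) \<le> 2 * (card C div 2))"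
    by (rule exists_pairing_in_classes[OF _ disj]) (auto simp: nontrivial_def)
  then obtain \<P> where P: "pairing \<P>" "card \<P> = (\<Sum>C\<in>?J. card C div 2)"
    "\<forall>(x, y)\<in>\<P>. \<exists>C\<in>?J. x \<in> C \<and> y \<in> C" by blast
  have "card nontrivial = card (\<Union>C\<in>?J. C)"
    by (simp only: Union_nontrivial_classes)
  also have "\<dots> = (\<Sum>C\<in>?J. card C)"
    using disj by (intro card_UN_disjoint) (auto simp: disjoint_family_on_def nontrivial_def)
  also have "\<dots> \<le> (\<Sum>C\<in>?J. 3 * (card C div 2))"
  proof (rule sum_mono)
    fix C assume "C \<in> ?J"
    then have "card C \<ge> 2" by (auto simp: nontrivial_def)
    then show "card C \<le> 3 * (card C div 2)" by presburger
  qed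
  also have "\<dots> = 3 * card \<P>" by (simp add: P(2) sum_distrib_left)
  finally have "m \<le> card \<P>" using assms by simp
  then obtain \<Q> where Q: "\<Q> \<subseteq> \<P>" "card \<Q> = m" by (meson obtain_subset_with_card_n)
  have "x \<in> {1..n} \<and> y \<in> {1..n} \<and> c x = c y" if "(x, y) \<in> \<Q>" for x y
    using P(3) Q(1) that by (fastforce simp: col_class_def)
  then show ?thesis
    using pairing_subset[OF P(1) Q(1)] Q(2) by (intro exI[of _ \<Q>]) auto
qed

lemma equitable_grouping_event:
  assumes b: "b > 0" and m: "3 * m \<le> card nontrivial"
    and big: "real (\<Sum>C\<in>big_classes b. card C) \<le> \<delta> * real n"
  shows "grouping_event b (n div b + 1) \<delta> m n E"
proof -
  \<comment> \<open>Order the classes by their least elements. The group of a class is the number of vertices in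
    earlier classes divided by \<open>b\<close>, so fewer than \<open>b\<close> elements of a group lie outside its last class.\<close>
  define rep where "rep = (\<lambda>v. Min (col_class v))"
  define rk where "rk = (\<lambda>v. card {w \<in> {1..n}. rep w < rep v})"
  define \<phi> where "\<phi> = (\<lambda>v\<in>{1..n}. rk v div b)"
  let ?r = "n div b + 1"
  have rep_eq: "rep v = rep w \<longleftrightarrow> c v = c w" if "v \<in> {1..n}" "w \<in> {1..n}" for v w
  proof
    assume "rep v = rep w"
    moreover have "rep v \<in> col_class v" "rep w \<in> col_class w"
      unfolding rep_def using that self_in_col_class by (auto intro!: Min_in)
    ultimately show "c v = c w" by (auto simp: col_class_def)
  next
    assume "c v = c w"
    then have "col_class v = col_class w" using that by (simp add: col_class_def)
    then show "rep v = rep w" by (simp add: rep_def)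
  qed
  have closed: "w \<in> fibre n \<phi> j" if "v \<in> fibre n \<phi> j" "w \<in> {1..n}" "c v = c w" for v w j
  proof -
    have "rep v = rep w" using rep_eq that by auto
    then show ?thesis using that by (auto simp: \<phi>_def rk_def)
  qed
  have rk_le: "rk v \<le> n" for v
  proof -
    have "rk v \<le> card {1..n}" unfolding rk_def by (intro card_mono) auto
    then show ?thesis by simp
  qed
  have \<phi>: "\<phi> \<in> {1..n} \<rightarrow>\<^sub>E {..<?r}"
  proof -
    have "rk v div b \<le> n div b" for v using rk_le by (rule div_le_mono)
    then show ?thesis by (auto simp: \<phi>_def less_Suc_eq_le)
  qed
  \<comment> \<open>A group of more than \<open>2 * b\<close> vertices has fewer than
    \<open>b\<close> outside its last class; this class is therefore big and makes up at least half
    of the group.\<close>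
  have fibre_small: "\<exists>C\<in>big_classes b. C \<subseteq> fibre n \<phi> j \<and> card (fibre n \<phi> j) \<le> 2 * card C"
    if j: "card (fibre n \<phi> j) > 2 * b" for j
  proof -
    let ?F = "fibre n \<phi> j"
    have ne: "?F \<noteq> {}" using j by (metis card.empty not_less_zero)
    have mm: "Max (rep ` ?F) \<in> rep ` ?F" "Min (rep ` ?F) \<in> rep ` ?F"
      by (intro Max_in Min_in; use ne in simp)+
    obtain u where uF: "Max (rep ` ?F) = rep u" "u \<in> ?F" using mm(1) by (rule imageE)
    obtain l where lF: "Min (rep ` ?F) = rep l" "l \<in> ?F" using mm(2) by (rule imageE)
    have u: "rep w \<le> rep u" if "w \<in> ?F" for w
      unfolding uF(1)[symmetric] by (intro Max_ge imageI that) simp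
    have l: "rep l \<le> rep w" if "w \<in> ?F" for w
      unfolding lF(1)[symmetric] by (intro Min_le imageI that) simp
    have "?F \<subseteq> {w \<in> ?F. rep w < rep u} \<union> col_class u"
    proof
      fix w assume w: "w \<in> ?F"
      show "w \<in> {w \<in> ?F. rep w < rep u} \<union> col_class u"
      proof (cases "rep w = rep u")
        case True
        then show ?thesis using w uF(2) rep_eq[of w u] by (simp add: col_class_def)
      next
        case False
        then show ?thesis using w u[OF w] by simp
      qed
    qed
    then have "card ?F \<le> card ({w \<in> ?F. rep w < rep u} \<union> col_class u)" by (intro card_mono) auto
    also have "\<dots> \<le> card {w \<in> ?F. rep w < rep u} + card (col_class u)" by (rule card_Un_le)
    finally have 1: "card ?F \<le> card {w \<in> ?F. rep w < rep u} + card (col_class u)" .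
    \<comment> \<open>The vertices of the group before the class of \<open>u\<close> are counted by
      \<open>rk u\<close> but not by \<open>rk l\<close>, and two ranks with the same quotient by
      \<open>b\<close> differ by less than \<open>b\<close>.\<close>
    have 2: "card {w \<in> ?F. rep w < rep u} < b"
    proof -
      have "{w \<in> ?F. rep w < rep u} \<union> {w \<in> {1..n}. rep w < rep l} \<subseteq> {w \<in> {1..n}. rep w < rep u}"
        using l[OF uF(2)] by auto
      moreover have "{w \<in> ?F. rep w < rep u} \<inter> {w \<in> {1..n}. rep w < rep l} = {}"
        using l by force
      ultimately have "card {w \<in> ?F. rep w < rep u} + rk l \<le> rk u"
        unfolding rk_def by (subst card_Un_disjoint[symmetric]) (auto intro!: card_mono)
      moreover have "rk u div b = rk l div b"
        using uF(2) lF(2) by (auto simp: \<phi>_def)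
      then have "rk u < rk l + b"
        using b div_mult_mod_eq[of "rk u" b] mod_less_divisor[OF b, of "rk u"] div_times_less_eq_dividend[of "rk l" b]
        by (metis add_less_le_mono add.commute)
      ultimately show ?thesis by linarith
    qed
    have "col_class u \<subseteq> ?F"
    proof
      fix w assume "w \<in> col_class u"
      then show "w \<in> ?F" using closed[OF uF(2), of w] by (simp add: col_class_def)
    qed
    moreover have "col_class u \<in> big_classes b"
      using 1 2 j uF(2) by (auto simp: big_classes_def)
    ultimately show ?thesis using 1 2 j by (intro bexI[of _ "col_class u"]) auto
  qed
  \<comment> \<open>\<open>L\<close> indexes the oversized groups. Different groups contain
    different big classes, so together they cover at most twice as many vertices as the big classes
    do.\<close>
  define L where "L = {j. j < ?r \<and> card (fibre n \<phi> j) > 2 * b}"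
  have "\<forall>j\<in>L. \<exists>C\<in>big_classes b. C \<subseteq> fibre n \<phi> j \<and> card (fibre n \<phi> j) \<le> 2 * card C"
    using fibre_small by (auto simp: L_def)
  from bchoice[OF this[unfolded Bex_def]] obtain g where "\<forall>j\<in>L. g j \<in> big_classes b
      \<and> g j \<subseteq> fibre n \<phi> j \<and> card (fibre n \<phi> j) \<le> 2 * card (g j)" by (elim exE)
  then have g_big: "g j \<in> big_classes b" and g_sub: "g j \<subseteq> fibre n \<phi> j"
    and g_card: "card (fibre n \<phi> j) \<le> 2 * card (g j)" if "j \<in> L" for j
    using that by (simp_all del: One_nat_def)
  have finL: "finite L" by (simp add: L_def)
  have inj: "inj_on g L"
  proof (rule inj_onI)
    fix i j assume ij: "i \<in> L" "j \<in> L" "g i = g j"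
    have "card (g i) > 0" using g_big[OF ij(1)] b by (simp add: big_classes_def)
    then have "g i \<noteq> {}" by (intro notI) simp
    then obtain v where v: "v \<in> g i" by blast
    have "v \<in> g j" using v ij(3) by simp
    then have "v \<in> fibre n \<phi> i" "v \<in> fibre n \<phi> j"
      using subsetD[OF g_sub[OF ij(1)] v] subsetD[OF g_sub[OF ij(2)]] by simp_all
    then show "i = j" by simp
  qed
  have "(\<Sum>j\<in>L. card (fibre n \<phi> j)) \<le> (\<Sum>j\<in>L. 2 * card (g j))"
    by (intro sum_mono g_card)
  also have "\<dots> = 2 * (\<Sum>C\<in>g ` L. card C)" by (simp add: sum.reindex[OF inj] sum_distrib_left)
  also have "\<dots> \<le> 2 * (\<Sum>C\<in>big_classes b. card C)"
    by (intro mult_left_mono sum_mono2) (use g_big in \<open>auto simp del: One_nat_def\<close>)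
  finally have L: "real (\<Sum>j\<in>L. card (fibre n \<phi> j)) \<le> 2 * \<delta> * real n" using big by linarith
  have "n = (\<Sum>j<?r. card (fibre n \<phi> j))" using \<phi> by (intro sum_fibres[symmetric]) auto
  also have "{..<?r} = {j. j < ?r \<and> card (fibre n \<phi> j) \<le> 2 * b} \<union> L" by (auto simp: L_def)
  also have "(\<Sum>j\<in>\<dots>. card (fibre n \<phi> j))
    = (\<Sum>j | j < ?r \<and> card (fibre n \<phi> j) \<le> 2 * b. card (fibre n \<phi> j)) + (\<Sum>j\<in>L. card (fibre n \<phi> j))"
    using finL by (subst sum.union_disjoint) (auto simp: L_def)
  finally have tot: "(1 - 2 * \<delta>) * real n \<le> real (\<Sum>j | j < ?r \<and> card (fibre n \<phi> j) \<le> 2 * b. card (fibre n \<phi> j))"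
    using L by (simp add: algebra_simps flip: of_nat_sum of_nat_add)
  obtain \<P> where P: "\<P> \<subseteq> {1..n} \<times> {1..n}" "pairing \<P>" "card \<P> = m" "\<forall>(x, y)\<in>\<P>. c x = c y"
    using nontrivial_pairing[OF m] by blast
  show ?thesis
    unfolding grouping_event_def
  proof (rule bexI[OF _ \<phi>], intro exI[of _ \<P>] conjI P(1-3) tot)
    show "\<forall>(x, y)\<in>\<P>. \<forall>j\<in>{j. j < ?r \<and> card (fibre n \<phi> j) \<le> 2 * b}.
          same_parity E (fibre n \<phi> j) x y"
    proof (clarify)
      fix x y j assume xy: "(x, y) \<in> \<P>"
      have "card {w \<in> fibre n \<phi> j. {x, w} \<in> E} = card {w \<in> fibre n \<phi> j. {y, w} \<in> E}"
      proof (rule equitable_degree_into[OF equitable])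
        show "x \<in> {1..n}" "y \<in> {1..n}" using subsetD[OF P(1) xy] by simp_all
        show "c x = c y" using bspec[OF P(4) xy] by simp
        show "w \<in> fibre n \<phi> j" if "v \<in> fibre n \<phi> j" "w \<in> {1..n}" "c v = c w" for v w
          by (rule closed[OF that])
      qed auto
      then show "same_parity E (fibre n \<phi> j) x y" by simp
    qed
  qed
qed

text \<open>In the third case the classes have fewer than \<open>\<eta> * n\<close> vertices each
  and cover \<open>\<delta>' * n\<close> vertices, so there are at least
  \<open>\<delta>' / \<eta> \<ge> K1\<close> of them. Their exact number is not known in advance,
  hence the range of \<open>K\<close>.\<close>

lemma equitable_not_inj_cases:
  assumes "\<not> inj_on c {1..n}" "b > 0" "\<eta> > 0" "n > 0" "real (3 * m) \<le> \<delta> * real n"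
    and K: "real K1 * \<eta> \<le> \<delta>'"
  shows "small_event \<delta> n E \<or> degree_event \<eta> n E \<or> (\<exists>K\<in>{K1..n}. big_classes_event b \<delta>' K n E)
    \<or> grouping_event b (n div b + 1) \<delta>' m n E"
proof -
  consider (small) "real (card nontrivial) \<le> \<delta> * real n"
    | (degree) "\<exists>v\<in>{1..n}. real (card (col_class v)) \<ge> \<eta> * real n"
    | (big) "\<forall>v\<in>{1..n}. real (card (col_class v)) < \<eta> * real n" "\<delta>' * real n \<le> real (\<Sum>C\<in>big_classes b. card C)"
    | (group) "real (card nontrivial) > \<delta> * real n" "real (\<Sum>C\<in>big_classes b. card C) \<le> \<delta>' * real n"
    by (meson not_le_imp_less linorder_le_cases)
  then show ?thesis
  proof cases
    case small
    then show ?thesis using equitable_small_event assms(1) by blast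
  next
    case degree
    then show ?thesis using equitable_degree_event by blast
  next
    case big
    have "\<delta>' * real n \<le> (\<Sum>C\<in>big_classes b. real (card C))" using big(2) by simp
    also have "\<dots> \<le> (\<Sum>C\<in>big_classes b. \<eta> * real n)"
      using big(1) by (intro sum_mono) (auto simp: big_classes_def intro: less_imp_le)
    finally have "\<delta>' * real n \<le> card (big_classes b) * \<eta> * real n" by simp
    then have "\<delta>' \<le> card (big_classes b) * \<eta>" using assms(4) by simp
    then have "real K1 * \<eta> \<le> card (big_classes b) * \<eta>" using K by linarith
    then have "K1 \<le> card (big_classes b)" using assms(3) by simp
    then show ?thesis
      using equitable_big_classes_event[OF big(2)] card_big_classes_le by auto
  next
    case group
    have "real (3 * m) \<le> real (card nontrivial)" using group assms(5) by simp
    then have "3 * m \<le> card nontrivial" by linarith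
    then show ?thesis using equitable_grouping_event[OF assms(2) _ group(2)] by blast
  qed
qed

end

section \<open>Union bounds\<close>

lemma prob_Bex_le_sum:
  assumes "finite I" "\<And>i. i \<in> I \<Longrightarrow> prob M {R. Q i R} \<le> f i"
  shows "prob M {R. \<exists>i\<in>I. Q i R} \<le> (\<Sum>i\<in>I. f i)"
proof -
  have "{R. \<exists>i\<in>I. Q i R} = (\<Union>i\<in>I. {R. Q i R})" by auto
  then have "prob M {R. \<exists>i\<in>I. Q i R} \<le> (\<Sum>i\<in>I. prob M {R. Q i R})"
    using measure_pmf.finite_measure_subadditive_finite[OF assms(1), of "\<lambda>i. {R. Q i R}" M] by simp
  also have "\<dots> \<le> (\<Sum>i\<in>I. f i)" by (intro sum_mono assms(2))
  finally show ?thesis .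
qed

lemma prob_mono: "(\<And>R. P R \<Longrightarrow> Q R) \<Longrightarrow> prob M {R. P R} \<le> prob M {R. Q R}"
  by (intro measure_pmf.finite_measure_mono) auto

lemma binomial_le_power: "n choose k \<le> n ^ k"
  by (cases "k \<le> n") (simp_all add: binomial_le_pow binomial_eq_0)

lemma power_one_minus_le_exp:
  fixes x :: real
  assumes "0 \<le> 1 - x"
  shows "(1 - x) ^ k \<le> exp (- x * k)"
proof -
  have "(1 - x) ^ k \<le> exp (- x) ^ k"
    using assms exp_ge_add_one_self[of "- x"] by (intro power_mono) auto
  then show ?thesis by (simp add: exp_of_nat_mult[symmetric] mult.commute)
qed

text \<open>With \<open>q = 2 * p * (1 - p)\<close> one has
  \<open>(1 - 2 * p)\<^sup>2 = 1 - 2 * q\<close>, which is at most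
  \<open>exp (- (2 * q))\<close>.\<close>

lemma parity_factor_le:
  fixes p :: real
  assumes "0 \<le> p" "p \<le> 1 / 2"
  shows "(1 + (1 - 2 * p) ^ (2 * s)) / 2 \<le> (1 + exp (- (2 * (2 * p * (1 - p)) * s))) / 2"
proof -
  have "(1 - 2 * p) ^ (2 * s) = (1 - 2 * (2 * p * (1 - p))) ^ s"
    by (simp add: power_mult) (simp add: power2_eq_square algebra_simps)
  also have "\<dots> \<le> exp (- (2 * (2 * p * (1 - p))) * s)"
  proof (rule power_one_minus_le_exp)
    have "1 - 2 * (2 * p * (1 - p)) = (1 - 2 * p)\<^sup>2" by (simp add: power2_eq_square algebra_simps)
    then show "0 \<le> 1 - 2 * (2 * p * (1 - p))" by simp
  qed
  finally show ?thesis by simp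
qed

text \<open>To first order the parity factor is \<open>exp (- t)\<close>; on \<open>[0, T]\<close>
  the second-order error costs only the factor \<open>1 - T\<close> in the exponent. This makes many
  small groups as effective as one would be if all their exponents simply added up.\<close>

lemma half_one_plus_exp_le:
  fixes t :: real
  assumes "0 \<le> t" "t \<le> T"
  shows "(1 + exp (- (2 * t))) / 2 \<le> exp (- (1 - T) * t)"
proof -
  have "exp (- (2 * t)) \<le> 1 - 2 * t + 2 * t\<^sup>2"
  proof -
    have "1 + 2 * t + 2 * t\<^sup>2 \<le> exp (2 * t)"
      using exp_lower_Taylor_quadratic[of "2 * t"] assms by (simp add: power2_eq_square)
    moreover have "1 + 2 * t + 2 * t\<^sup>2 > 0" using assms by (simp add: add_pos_nonneg)
    ultimately have "exp (- (2 * t)) \<le> 1 / (1 + 2 * t + 2 * t\<^sup>2)"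
      by (simp add: exp_minus inverse_eq_divide frac_le)
    also have "\<dots> \<le> 1 - 2 * t + 2 * t\<^sup>2"
    proof -
      \<comment> \<open>Sophie Germain's identity: the quadratic lower bound for
        \<open>exp (2 * t)\<close> thereby turns into an upper bound for its reciprocal.\<close>
      have "(1 - 2 * t + 2 * t\<^sup>2) * (1 + 2 * t + 2 * t\<^sup>2) = 1 + 4 * t ^ 4"
        by (simp add: power2_eq_square power4_eq_xxxx algebra_simps)
      then show ?thesis using \<open>1 + 2 * t + 2 * t\<^sup>2 > 0\<close> by (simp add: divide_le_eq)
    qed
    finally show ?thesis .
  qed
  then have "(1 + exp (- (2 * t))) / 2 \<le> (1 + (1 - 2 * t + 2 * t\<^sup>2)) / 2" by simp
  also have "\<dots> = 1 + (- (1 - t) * t)" by (simp add: power2_eq_square field_simps)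
  also have "\<dots> \<le> 1 + (- (1 - T) * t)" using assms by (simp add: mult_right_mono)
  also have "\<dots> \<le> exp (- (1 - T) * t)" by (rule exp_ge_add_one_self)
  finally show ?thesis .
qed

text \<open>A family of blocks costs the product of the weights \<open>cc b\<close>. Summed over all
  nonempty families of blocks, these products give the product of all \<open>1 + cc b\<close> minus
  1, which is at most \<open>exp\<close> of the total weight minus 1. The at most
  \<open>n ^ k\<close> blocks of size \<open>k\<close> have total weight at most
  \<open>n powr (- (\<kappa> / 2) * k)\<close>, and \<open>k \<ge> 2\<close>.\<close>

lemma prob_small_event_le:
  assumes p: "0 \<le> p" "p \<le> 1 / 2" and n: "n \<ge> 2" and \<kappa>: "0 < \<kappa>" "\<kappa> \<le> 1 / 2"
    and q: "2 * p * (1 - p) * real n \<ge> 2 * (1 + \<kappa>) * ln (real n)"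
  shows "prob (random_graph n p) {R. small_event (\<kappa> / 4) n (sym_diff G R)}
    \<le> exp (2 * real n powr (- \<kappa>)) - 1"
proof -
  define T where "T = {b. b \<subseteq> {1..n} \<and> card b \<in> {2, 3}}"
  define cc where "cc = (\<lambda>b. real n powr (- (1 + \<kappa> / 2) * card (b :: nat set)))"
  define I where "I = {\<B> \<in> Pow T. \<B> \<noteq> {} \<and> disjoint \<B> \<and> real (card (\<Union>\<B>)) \<le> \<kappa> / 4 * real n}"
  have finT: "finite T" by (rule finite_subset[of _ "Pow {1..n}"]) (auto simp: T_def)
  have finI: "finite I" unfolding I_def using finT by simp
  have lnn: "ln (real n) > 0" using n by simp
  have factor: "((1 - p) ^ card b + p ^ card b) ^ N \<le> cc b"
    if b: "b \<in> T" and N: "(1 - \<kappa> / 4) * real n \<le> real N" for b and N :: nat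
  proof -
    let ?q = "2 * p * (1 - p)"
    \<comment> \<open>An identity for sizes 2 and 3 only:
      \<open>(1 - p)\<^sup>2 + p\<^sup>2 = 1 - q\<close> and
      \<open>(1 - p) ^ 3 + p ^ 3 = 1 - 3 * q / 2\<close>, where
      \<open>q = 2 * p * (1 - p)\<close>.\<close>
    have "(1 - p) ^ card b + p ^ card b = 1 - card b * ?q / 2"
      using b by (auto simp: T_def power2_eq_square power3_eq_cube field_simps)
    moreover have "0 \<le> (1 - p) ^ card b + p ^ card b" using p by simp
    ultimately have "((1 - p) ^ card b + p ^ card b) ^ N \<le> exp (- (card b * ?q / 2) * N)"
      using power_one_minus_le_exp[of "card b * ?q / 2" N] by simp
    also have "\<dots> \<le> exp (- (1 + \<kappa> / 2) * card b * ln (real n))"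
    proof -
      \<comment> \<open>The vertices inside the blocks are lost, which costs the factor
        \<open>1 - \<kappa> / 4\<close>; half of the surplus \<open>\<kappa>\<close> pays for
        it.\<close>
      have "(2 + \<kappa>) * ln (real n) \<le> (1 - \<kappa> / 4) * (2 * (1 + \<kappa>)) * ln (real n)"
      proof (intro mult_right_mono)
        have "\<kappa> * \<kappa> \<le> \<kappa> * 1" using \<kappa> by (intro mult_left_mono) auto
        then show "2 + \<kappa> \<le> (1 - \<kappa> / 4) * (2 * (1 + \<kappa>))" by (simp add: algebra_simps)
      qed (use lnn in simp)
      also have "\<dots> \<le> (1 - \<kappa> / 4) * (?q * real n)"
        using q \<kappa> by (simp add: mult_left_mono mult.assoc)
      also have "\<dots> = ?q * ((1 - \<kappa> / 4) * real n)" by simp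
      also have "\<dots> \<le> ?q * N" using N p by (intro mult_left_mono) auto
      finally have "card b / 2 * ((2 + \<kappa>) * ln (real n)) \<le> card b / 2 * (?q * N)"
        by (intro mult_left_mono) auto
      then show ?thesis by (simp add: algebra_simps)
    qed
    also have "\<dots> = cc b" using n by (simp add: cc_def powr_def algebra_simps)
    finally show ?thesis .
  qed
  have "prob (random_graph n p) {R. small_event (\<kappa> / 4) n (sym_diff G R)}
    \<le> prob (random_graph n p) {R. \<exists>\<B>\<in>I. \<forall>b\<in>\<B>. \<forall>w\<in>{1..n} - \<Union>\<B>.
        \<forall>x\<in>b. \<forall>y\<in>b. ({x, w} \<in> sym_diff G R) = ({y, w} \<in> sym_diff G R)}"
  proof (rule prob_mono)
    fix R assume "small_event (\<kappa> / 4) n (sym_diff G R)"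
    then obtain \<B> where B: "\<B> \<noteq> {}" "disjoint \<B>" "\<Union>\<B> \<subseteq> {1..n}" "\<forall>b\<in>\<B>. card b \<in> {2, 3}"
      "real (card (\<Union>\<B>)) \<le> \<kappa> / 4 * real n"
      "\<forall>b\<in>\<B>. \<forall>w\<in>{1..n} - \<Union>\<B>. \<forall>x\<in>b. \<forall>y\<in>b. ({x, w} \<in> sym_diff G R) = ({y, w} \<in> sym_diff G R)"
      unfolding small_event_def by (elim exE conjE)
    have "\<B> \<subseteq> T"
    proof
      fix b assume "b \<in> \<B>"
      then show "b \<in> T" using Union_upper[of b \<B>] B(3) bspec[OF B(4)] by (simp add: T_def)
    qed
    then have "\<B> \<in> I" using B(1,2,5) by (simp add: I_def)
    then show "\<exists>\<B>\<in>I. \<forall>b\<in>\<B>. \<forall>w\<in>{1..n} - \<Union>\<B>.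
        \<forall>x\<in>b. \<forall>y\<in>b. ({x, w} \<in> sym_diff G R) = ({y, w} \<in> sym_diff G R)"
      using B(6) by (rule bexI[rotated])
  qed
  also have "\<dots> \<le> (\<Sum>\<B>\<in>I. \<Prod>b\<in>\<B>. cc b)"
  proof (rule prob_Bex_le_sum[OF finI])
    fix \<B> assume B: "\<B> \<in> I"
    then have B': "\<B> \<subseteq> T" "disjoint \<B>" "real (card (\<Union>\<B>)) \<le> \<kappa> / 4 * real n" by (auto simp: I_def)
    have sub: "\<Union>\<B> \<subseteq> {1..n}" using B'(1) by (auto simp: T_def)
    have finB: "finite \<B>" using B'(1) finT finite_subset by blast
    have "prob (random_graph n p) {R. \<forall>b\<in>\<B>. \<forall>w\<in>{1..n} - \<Union>\<B>.
        \<forall>x\<in>b. \<forall>y\<in>b. ({x, w} \<in> sym_diff G R) = ({y, w} \<in> sym_diff G R)}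
      \<le> (\<Prod>b\<in>\<B>. ((1 - p) ^ card b + p ^ card b) ^ (n - card (\<Union>\<B>)))"
      using p finB B'(2) sub by (intro prob_homogeneous_blocks_le) auto
    also have "\<dots> \<le> (\<Prod>b\<in>\<B>. cc b)"
    proof (intro prod_mono conjI)
      fix b assume b: "b \<in> \<B>"
      have "card (\<Union>\<B>) \<le> n" using card_mono[OF _ sub] by simp
      then have "(1 - \<kappa> / 4) * real n \<le> real (n - card (\<Union>\<B>))"
        using B'(3) by (simp add: of_nat_diff algebra_simps)
      then show "((1 - p) ^ card b + p ^ card b) ^ (n - card (\<Union>\<B>)) \<le> cc b"
        using B'(1) b by (intro factor) auto
    qed (use p in simp)
    finally show "prob (random_graph n p) {R. \<forall>b\<in>\<B>. \<forall>w\<in>{1..n} - \<Union>\<B>.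
        \<forall>x\<in>b. \<forall>y\<in>b. ({x, w} \<in> sym_diff G R) = ({y, w} \<in> sym_diff G R)} \<le> (\<Prod>b\<in>\<B>. cc b)" .
  qed
  \<comment> \<open>Disjointness and the size bound are forgotten, so that the index set is a power
    set without the empty family and the sum factorises.\<close>
  also have "\<dots> \<le> (\<Sum>\<B>\<in>Pow T - {{}}. \<Prod>b\<in>\<B>. cc b)"
    using finT by (intro sum_mono2) (auto simp: I_def cc_def intro!: prod_nonneg)
  also have "\<dots> = (\<Sum>\<B>\<in>Pow T. \<Prod>b\<in>\<B>. cc b) - 1"
    using finT by (subst sum_diff1) auto
  also have "(\<Sum>\<B>\<in>Pow T. \<Prod>b\<in>\<B>. cc b) = (\<Prod>b\<in>T. cc b + 1)"
    using prod_add[OF finT, of cc "\<lambda>_. 1"] by simp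
  also have "\<dots> \<le> (\<Prod>b\<in>T. exp (cc b))"
    by (intro prod_mono conjI) (simp_all add: cc_def add.commute)
  also have "\<dots> = exp (\<Sum>b\<in>T. cc b)" using finT by (simp add: exp_sum)
  also have "(\<Sum>b\<in>T. cc b) \<le> 2 * real n powr (- \<kappa>)"
  proof -
    have count: "(\<Sum>b | b \<subseteq> {1..n} \<and> card b = k. cc b) \<le> real n powr (- \<kappa>)" if "k \<ge> 2" for k
    proof -
      have "(\<Sum>b | b \<subseteq> {1..n} \<and> card b = k. cc b) = (n choose k) * real n powr (- (1 + \<kappa> / 2) * k)"
        using n_subsets[of "{1..n}" k] by (simp add: cc_def)
      also have "\<dots> \<le> real (n ^ k) * real n powr (- (1 + \<kappa> / 2) * k)"
        by (intro mult_right_mono) (simp_all only: of_nat_le_iff binomial_le_power powr_ge_zero)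
      also have "\<dots> = real n powr k * real n powr (- (1 + \<kappa> / 2) * k)"
        using n by (simp add: powr_realpow)
      also have "\<dots> = real n powr (- (\<kappa> / 2) * k)"
        by (simp add: powr_add[symmetric] algebra_simps)
      also have "\<dots> \<le> real n powr (- \<kappa>)"
        using n \<kappa> that by (intro powr_mono) auto
      finally show ?thesis .
    qed
    have "T = {b. b \<subseteq> {1..n} \<and> card b = 2} \<union> {b. b \<subseteq> {1..n} \<and> card b = 3}" by (auto simp: T_def)
    then have "(\<Sum>b\<in>T. cc b) = (\<Sum>b | b \<subseteq> {1..n} \<and> card b = 2. cc b) + (\<Sum>b | b \<subseteq> {1..n} \<and> card b = 3. cc b)"
      using finT by (subst sum.union_disjoint[symmetric]) auto
    then show ?thesis using count[of 2] count[of 3] by simp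
  qed
  finally show ?thesis by simp
qed

lemma card_PiE_const: "card ({1..n} \<rightarrow>\<^sub>E A) = card A ^ n"
  by (simp add: card_PiE)

text \<open>For a fixed map, a quarter of each class is chosen as the number of its pairs. This
  gives at least \<open>\<delta> * n / 8\<close> pairs and leaves half of every class fresh, so each
  pair agrees in parity on each of the \<open>K\<close> classes at a cost of \<open>\<rho>\<close>.
  The maps number \<open>(K + 1) ^ n\<close>.\<close>

lemma prob_big_classes_event_le:
  assumes p: "0 \<le> p" "p \<le> 1 / 2" and b: "b \<ge> 4" "\<tau> > 0" "2 * p * (1 - p) * real b \<ge> 2 * \<tau>"
    and \<delta>: "\<delta> \<ge> 0"
  defines "\<rho> \<equiv> (1 + exp (- (2 * \<tau>))) / 2"
  shows "prob (random_graph n p) {R. big_classes_event b \<delta> K n (sym_diff G R)}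
    \<le> ((real K + 1) * \<rho> powr (K * \<delta> / 8)) ^ n"
proof -
  have \<rho>: "0 < \<rho>" "\<rho> \<le> 1" using b(2) by (auto simp: \<rho>_def add_pos_pos)
  define I where "I = {\<phi> \<in> {1..n} \<rightarrow>\<^sub>E {0..K}. (\<forall>j\<in>{1..K}. b \<le> card (fibre n \<phi> j))
     \<and> \<delta> * real n \<le> real (\<Sum>j\<in>{1..K}. card (fibre n \<phi> j))}"
  have finPi: "finite ({1..n} \<rightarrow>\<^sub>E {0..K})" by (intro finite_PiE) auto
  have finI: "finite I" unfolding I_def using finPi by simp
  have "card I \<le> card ({1..n} \<rightarrow>\<^sub>E {0..K})" using finPi by (intro card_mono) (auto simp: I_def)
  then have cardI: "card I \<le> Suc K ^ n" by (simp add: card_PiE_const del: One_nat_def)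
  define Q where "Q = (\<lambda>\<phi> R. \<forall>i\<in>{1..K}. \<forall>x\<in>fibre n \<phi> i. \<forall>y\<in>fibre n \<phi> i. \<forall>j\<in>{1..K}.
     same_parity (sym_diff G R) (fibre n \<phi> j) x y)"
  have "prob (random_graph n p) {R. big_classes_event b \<delta> K n (sym_diff G R)}
    \<le> prob (random_graph n p) {R. \<exists>\<phi>\<in>I. Q \<phi> R}"
    by (rule prob_mono) (simp add: big_classes_event_def I_def Q_def Bex_def conj_assoc)
  also have "\<dots> \<le> (\<Sum>\<phi>\<in>I. (\<rho> powr (K * \<delta> / 8)) ^ n)"
  proof (rule prob_Bex_le_sum[OF finI])
    fix \<phi> assume "\<phi> \<in> I"
    then have \<phi>: "\<And>j. j \<in> {1..K} \<Longrightarrow> b \<le> card (fibre n \<phi> j)"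
      "\<delta> * real n \<le> real (\<Sum>j\<in>{1..K}. card (fibre n \<phi> j))" by (auto simp: I_def)
    have disj: "disjoint_family_on (fibre n \<phi>) {1..K}" by (auto simp: disjoint_family_on_def)
    have "\<exists>\<P>. pairing \<P> \<and> card \<P> = (\<Sum>j\<in>{1..K}. card (fibre n \<phi> j) div 4)
      \<and> (\<forall>(x, y)\<in>\<P>. \<exists>j\<in>{1..K}. x \<in> fibre n \<phi> j \<and> y \<in> fibre n \<phi> j)
      \<and> (\<forall>j\<in>{1..K}. card (support \<P> \<inter> fibre n \<phi> j) \<le> 2 * (card (fibre n \<phi> j) div 4))"
      by (rule exists_pairing_in_classes[OF _ disj]) auto
    then obtain \<P> where P: "pairing \<P>" "card \<P> = (\<Sum>j\<in>{1..K}. card (fibre n \<phi> j) div 4)"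
      "\<forall>(x, y)\<in>\<P>. \<exists>j\<in>{1..K}. x \<in> fibre n \<phi> j \<and> y \<in> fibre n \<phi> j"
      "\<forall>j\<in>{1..K}. card (support \<P> \<inter> fibre n \<phi> j) \<le> 2 * (card (fibre n \<phi> j) div 4)"
      by (elim exE conjE)
    have cardP: "real (card \<P>) \<ge> \<delta> * n / 8"
    proof -
      have "\<delta> * n / 8 \<le> (\<Sum>j\<in>{1..K}. real (card (fibre n \<phi> j)) / 8)"
        using \<phi>(2) by (simp add: sum_divide_distrib[symmetric] divide_right_mono)
      also have "\<dots> \<le> (\<Sum>j\<in>{1..K}. real (card (fibre n \<phi> j) div 4))"
      proof (intro sum_mono)
        fix j assume "j \<in> {1..K}"
        then have "card (fibre n \<phi> j) \<ge> 4" using \<phi>(1)[of j] b(1) by linarith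
        \<comment> \<open>Rounding the quarter down loses at most a factor of two once there are
          four elements; hence \<open>b \<ge> 4\<close>.\<close>
        then have "card (fibre n \<phi> j) \<le> 8 * (card (fibre n \<phi> j) div 4)" by presburger
        then show "real (card (fibre n \<phi> j)) / 8 \<le> real (card (fibre n \<phi> j) div 4)" by linarith
      qed
      finally show ?thesis unfolding P(2) by simp
    qed
    define X where "X = support \<P>"
    have X: "X \<subseteq> {1..n}" unfolding X_def
      by (rule support_subsetI) (use P(3) in blast)
    have "prob (random_graph n p) {R. Q \<phi> R} \<le> prob (random_graph n p)
      {R. \<forall>(x, y)\<in>\<P>. \<forall>j\<in>{1..K}. same_parity (sym_diff G R) (fibre n \<phi> j) x y}"
    proof (rule prob_mono, clarify)
      fix R x y j assume Q: "Q \<phi> R" and xy: "(x, y) \<in> \<P>" and j: "j \<in> {1..K}"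
      obtain i where "i \<in> {1..K}" "x \<in> fibre n \<phi> i" "y \<in> fibre n \<phi> i"
        using bspec[OF P(3) xy] by auto
      then show "same_parity (sym_diff G R) (fibre n \<phi> j) x y"
        using Q[unfolded Q_def, rule_format, of i x y j] j by simp
    qed
    also have "\<dots> \<le> (\<Prod>j\<in>{1..K}. (1 + (1 - 2 * p) ^ (2 * card (fibre n \<phi> j - X))) / 2) ^ card \<P>"
      by (rule prob_parities_agree_le[OF p pairing_finite[OF P(1)] pairing_neq[OF P(1)]
          pairing_disjoint[OF P(1)] X_def[unfolded support_def] X _ _ disj]) auto
    also have "\<dots> \<le> (\<rho> ^ K) ^ card \<P>"
    proof (rule power_mono)
      have "(\<Prod>j\<in>{1..K}. (1 + (1 - 2 * p) ^ (2 * card (fibre n \<phi> j - X))) / 2) \<le> (\<Prod>j\<in>{1..K}. \<rho>)"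
      proof (intro prod_mono conjI)
        fix j assume j: "j \<in> {1..K}"
        define s where "s = card (fibre n \<phi> j - X)"
        have "s = card (fibre n \<phi> j) - card (X \<inter> fibre n \<phi> j)"
          unfolding s_def by (subst Int_commute, subst card_Diff_subset_Int) auto
        \<comment> \<open>The pairs occupy at most half of the class, so \<open>s\<close> is at
          least half of its size.\<close>
        then have "b \<le> 2 * s" using \<phi>(1)[OF j] P(4)[rule_format, OF j] b(1) unfolding X_def by linarith
        then have "real b \<le> 2 * real s" by linarith
        then have "2 * p * (1 - p) * real b \<le> 2 * p * (1 - p) * (2 * real s)"
          using p by (intro mult_left_mono) auto
        then have "2 * \<tau> \<le> 2 * (2 * p * (1 - p)) * s" using b(3) by (simp add: algebra_simps)
        then have "(1 + exp (- (2 * (2 * p * (1 - p)) * s))) / 2 \<le> \<rho>" unfolding \<rho>_def by simp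
        then show "(1 + (1 - 2 * p) ^ (2 * s)) / 2 \<le> \<rho>"
          using parity_factor_le[OF p, of s] by linarith
      qed (use p in simp)
      then show "(\<Prod>j\<in>{1..K}. (1 + (1 - 2 * p) ^ (2 * card (fibre n \<phi> j - X))) / 2) \<le> \<rho> ^ K" by simp
    qed (use p in \<open>auto intro!: prod_nonneg\<close>)
    also have "\<dots> = \<rho> powr (K * card \<P>)"
      using \<rho> by (simp add: powr_realpow[symmetric] powr_powr)
    also have "\<dots> \<le> \<rho> powr (K * \<delta> / 8 * n)"
    proof (rule powr_mono')
      have "K * (\<delta> * n / 8) \<le> K * real (card \<P>)" using cardP by (intro mult_left_mono) auto
      then show "K * \<delta> / 8 * n \<le> real (K * card \<P>)" by (simp add: algebra_simps)
    qed (use \<rho> in auto)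
    also have "\<dots> = (\<rho> powr (K * \<delta> / 8)) ^ n"
      using \<rho> by (simp add: powr_realpow[symmetric] powr_powr)
    finally show "prob (random_graph n p) {R. Q \<phi> R} \<le> (\<rho> powr (K * \<delta> / 8)) ^ n" .
  qed
  also have "\<dots> = card I * (\<rho> powr (K * \<delta> / 8)) ^ n" by simp
  also have "\<dots> \<le> (1 + real K) ^ n * (\<rho> powr (K * \<delta> / 8)) ^ n"
    using of_nat_mono[OF cardI, where 'a = real] by (intro mult_right_mono) auto
  finally show ?thesis by (simp add: power_mult_distrib add.commute)
qed

text \<open>For a fixed grouping the factors of the groups combine to at most
  \<open>n powr (- (2 + \<kappa>))\<close> for each pair. The at most \<open>n ^ (2 * m)\<close>
  choices of the pairs use up the exponent 2, and \<open>\<kappa>\<close> per pair remains against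
  the \<open>r ^ n\<close> groupings.\<close>

lemma prob_grouping_event_le:
  assumes p: "0 \<le> p" "p \<le> 1 / 2" and n: "n \<ge> 2" and \<kappa>: "0 < \<kappa>" "\<kappa> \<le> 1 / 2"
    and q: "2 * p * (1 - p) * real n \<ge> 2 * (1 + \<kappa>) * ln (real n)"
    and b: "2 * real b * (2 * (1 + \<kappa>) * ln (real n) / real n) \<le> \<kappa> / 12"
    and m: "2 * real m \<le> \<kappa> / 12 * real n"
  shows "prob (random_graph n p) {R. grouping_event b r (\<kappa> / 24) m n (sym_diff G R)}
    \<le> real r ^ n * real n powr (- \<kappa> * m)"
proof -
  \<comment> \<open>The true density \<open>2 * p * (1 - p)\<close> may be large. Its lower bound
    \<open>q0\<close> is used instead, because the first-order estimate requires
    \<open>q0 * s j\<close> to be small.\<close>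
  define q0 where "q0 = 2 * (1 + \<kappa>) * ln (real n) / real n"
  have lnn: "ln (real n) > 0" using n by simp
  have q0: "0 \<le> q0" "q0 \<le> 2 * p * (1 - p)" "q0 * n = 2 * (1 + \<kappa>) * ln (real n)"
    using n q lnn \<kappa> by (auto simp: q0_def divide_le_eq)
  define J where "J = (\<lambda>\<phi>. {j. j < r \<and> card (fibre n \<phi> j) \<le> 2 * b})"
  define F where "F = {\<phi> \<in> {1..n} \<rightarrow>\<^sub>E {..<r}.
    (1 - 2 * (\<kappa> / 24)) * real n \<le> real (\<Sum>j\<in>J \<phi>. card (fibre n \<phi> j))}"
  define PP where "PP = {\<P>. \<P> \<subseteq> {1..n} \<times> {1..n} \<and> card \<P> = m}"
  define I where "I = F \<times> {\<P> \<in> PP. pairing \<P>}"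
  have finPi: "finite ({1..n} \<rightarrow>\<^sub>E {..<r})" by (intro finite_PiE) auto
  have finPP: "finite PP" by (rule finite_subset[of _ "Pow ({1..n} \<times> {1..n})"]) (auto simp: PP_def)
  have finI: "finite I" unfolding I_def F_def using finPi finPP by simp
  have "card F \<le> card ({1..n} \<rightarrow>\<^sub>E {..<r})" using finPi by (intro card_mono) (auto simp: F_def)
  then have cardF: "card F \<le> r ^ n" by (simp add: card_PiE_const del: One_nat_def)
  have "card {\<P> \<in> PP. pairing \<P>} \<le> card PP" using finPP by (intro card_mono) auto
  also have "card PP = (n * n) choose m" unfolding PP_def by (subst n_subsets) auto
  also have "\<dots> \<le> (n * n) ^ m" by (rule binomial_le_power)
  finally have "card I \<le> r ^ n * (n * n) ^ m" unfolding I_def card_cartesian_product using cardF by (intro mult_mono) auto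
  then have cardI: "real (card I) \<le> real r ^ n * real n powr (2 * m)"
  proof -
    have "real n powr (2 * m) = real ((n * n) ^ m)"
      using n by (subst powr_realpow) (simp_all add: power2_eq_square power_mult)
    then show ?thesis
      using of_nat_mono[OF \<open>card I \<le> r ^ n * (n * n) ^ m\<close>, where 'a = real] by simp
  qed
  define Q where "Q = (\<lambda>(\<phi>, \<P>) R. \<forall>(x, y)\<in>\<P>. \<forall>j\<in>J \<phi>.
     same_parity (sym_diff G R) (fibre n \<phi> j) x y)"
  have "prob (random_graph n p) {R. grouping_event b r (\<kappa> / 24) m n (sym_diff G R)}
    \<le> prob (random_graph n p) {R. \<exists>i\<in>I. Q i R}"
  proof (rule prob_mono)
    fix R assume "grouping_event b r (\<kappa> / 24) m n (sym_diff G R)"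
    then obtain \<phi> \<P> where *: "\<phi> \<in> {1..n} \<rightarrow>\<^sub>E {..<r}" "\<P> \<subseteq> {1..n} \<times> {1..n}" "pairing \<P>" "card \<P> = m"
      "(1 - 2 * (\<kappa> / 24)) * real n \<le> real (\<Sum>j\<in>J \<phi>. card (fibre n \<phi> j))"
      "\<forall>(x, y)\<in>\<P>. \<forall>j\<in>J \<phi>.
          same_parity (sym_diff G R) (fibre n \<phi> j) x y"
      unfolding grouping_event_def J_def by (elim bexE exE conjE)
    then have "(\<phi>, \<P>) \<in> I" "Q (\<phi>, \<P>) R" by (simp_all add: I_def F_def PP_def Q_def)
    then show "\<exists>i\<in>I. Q i R" by (rule bexI[rotated])
  qed
  also have "\<dots> \<le> (\<Sum>i\<in>I. real n powr (- (2 + \<kappa>) * m))"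
  proof (rule prob_Bex_le_sum[OF finI])
    fix i assume "i \<in> I"
    then obtain \<phi> \<P> where i: "i = (\<phi>, \<P>)" and \<phi>: "\<phi> \<in> F" and P: "\<P> \<in> PP" "pairing \<P>"
      by (auto simp: I_def)
    define X where "X = support \<P>"
    have X: "X \<subseteq> {1..n}" unfolding X_def
      by (rule support_subsetI) (use P(1) in \<open>auto simp: PP_def\<close>)
    have finX: "finite X" using X finite_subset by blast
    have finJ: "finite (J \<phi>)" by (simp add: J_def)
    have disj: "disjoint_family_on (fibre n \<phi>) (J \<phi>)" by (auto simp: disjoint_family_on_def)
    have cardX: "card X \<le> 2 * m"
      using card_support_le[OF pairing_finite[OF P(2)]] P(1) by (simp add: X_def PP_def)
    define s where "s = (\<lambda>j. card (fibre n \<phi> j - X))"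
    have "prob (random_graph n p) {R. Q i R}
      \<le> (\<Prod>j\<in>J \<phi>. (1 + (1 - 2 * p) ^ (2 * s j)) / 2) ^ card \<P>"
      unfolding i Q_def prod.case s_def
      by (rule prob_parities_agree_le[OF p pairing_finite[OF P(2)] pairing_neq[OF P(2)]
          pairing_disjoint[OF P(2)] X_def[unfolded support_def] X finJ _ disj]) auto
    also have "\<dots> \<le> (real n powr (- (2 + \<kappa>))) ^ card \<P>"
    proof (rule power_mono)
      have "(\<Prod>j\<in>J \<phi>. (1 + (1 - 2 * p) ^ (2 * s j)) / 2) \<le> (\<Prod>j\<in>J \<phi>. exp (- (1 - \<kappa> / 12) * (q0 * s j)))"
      proof (intro prod_mono conjI)
        fix j assume j: "j \<in> J \<phi>"
        have "s j \<le> card (fibre n \<phi> j)" unfolding s_def by (intro card_mono) auto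
        then have sj: "real (s j) \<le> 2 * real b" using j by (simp add: J_def)
        have "(1 + (1 - 2 * p) ^ (2 * s j)) / 2 \<le> (1 + exp (- (2 * (2 * p * (1 - p)) * s j))) / 2"
          by (rule parity_factor_le[OF p])
        also have "\<dots> \<le> (1 + exp (- (2 * (q0 * s j)))) / 2"
          using mult_right_mono[OF q0(2), of "real (s j)"] by (simp add: mult.assoc)
        also have "\<dots> \<le> exp (- (1 - \<kappa> / 12) * (q0 * s j))"
        proof (rule half_one_plus_exp_le)
          show "0 \<le> q0 * s j" using q0(1) by simp
          have "q0 * s j \<le> q0 * (2 * real b)" using q0(1) sj by (intro mult_left_mono)
          also have "\<dots> \<le> \<kappa> / 12" using b unfolding q0_def by (simp add: mult.commute)
          finally show "q0 * s j \<le> \<kappa> / 12" .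
        qed
        finally show "(1 + (1 - 2 * p) ^ (2 * s j)) / 2 \<le> exp (- (1 - \<kappa> / 12) * (q0 * s j))" .
      qed (use p in simp)
      also have "\<dots> = exp (- (1 - \<kappa> / 12) * (q0 * (\<Sum>j\<in>J \<phi>. s j)))"
        using finJ by (simp add: exp_sum[symmetric] sum_distrib_left)
      also have "\<dots> \<le> exp (- (2 + \<kappa>) * ln (real n))"
      proof -
        have "(\<Sum>j\<in>J \<phi>. card (fibre n \<phi> j)) \<le> (\<Sum>j\<in>J \<phi>. s j) + card X"
        proof -
          have "(\<Sum>j\<in>J \<phi>. card (fibre n \<phi> j)) = (\<Sum>j\<in>J \<phi>. s j + card (fibre n \<phi> j \<inter> X))"
          proof (rule sum.cong[OF refl])
            fix j
            show "card (fibre n \<phi> j) = s j + card (fibre n \<phi> j \<inter> X)"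
              unfolding s_def by (subst card_Un_disjoint[symmetric]) (auto intro: arg_cong[where f = card])
          qed
          also have "\<dots> = (\<Sum>j\<in>J \<phi>. s j) + card (\<Union>j\<in>J \<phi>. fibre n \<phi> j \<inter> X)"
            using finJ by (subst card_UN_disjoint) (auto simp: sum.distrib)
          also have "card (\<Union>j\<in>J \<phi>. fibre n \<phi> j \<inter> X) \<le> card X"
            by (rule card_mono[OF finX]) auto
          finally show ?thesis by simp
        qed
        then have "real (\<Sum>j\<in>J \<phi>. card (fibre n \<phi> j)) \<le> real (\<Sum>j\<in>J \<phi>. s j) + 2 * real m"
          using cardX by linarith
        \<comment> \<open>The loss \<open>\<kappa> / 6\<close> consists of
          \<open>\<kappa> / 12\<close> for the oversized groups and \<open>\<kappa> / 12\<close> for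
          the paired vertices.\<close>
        then have S: "(1 - \<kappa> / 6) * real n \<le> real (\<Sum>j\<in>J \<phi>. s j)"
          using \<phi> m unfolding F_def by (simp add: algebra_simps)
        \<comment> \<open>Both losses together,
          \<open>(1 - \<kappa> / 12) * (1 - \<kappa> / 6)\<close>, stay above
          \<open>1 - \<kappa> / 4\<close>.\<close>
        have "2 + \<kappa> \<le> (1 - \<kappa> / 4) * (2 * (1 + \<kappa>))"
        proof -
          have "\<kappa> * \<kappa> \<le> \<kappa> * 1" using \<kappa> by (intro mult_left_mono) auto
          then show ?thesis by (simp add: algebra_simps)
        qed
        also have "\<dots> \<le> ((1 - \<kappa> / 12) * (1 - \<kappa> / 6)) * (2 * (1 + \<kappa>))"
          using \<kappa> by (intro mult_right_mono) (auto simp: algebra_simps)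
        finally have "(2 + \<kappa>) * ln (real n) \<le> ((1 - \<kappa> / 12) * (1 - \<kappa> / 6)) * (2 * (1 + \<kappa>)) * ln (real n)"
          using lnn by (intro mult_right_mono) auto
        also have "\<dots> = ((1 - \<kappa> / 12) * (1 - \<kappa> / 6)) * (q0 * real n)"
          by (simp only: q0(3) mult.assoc)
        also have "\<dots> = (1 - \<kappa> / 12) * (q0 * ((1 - \<kappa> / 6) * real n))"
          by (simp only: mult_ac)
        also have "\<dots> \<le> (1 - \<kappa> / 12) * (q0 * real (\<Sum>j\<in>J \<phi>. s j))"
          using S q0(1) \<kappa> by (intro mult_left_mono) auto
        finally show ?thesis
          by (simp only: exp_le_cancel_iff mult_minus_left neg_le_iff_le)
      qed
      also have "\<dots> = real n powr (- (2 + \<kappa>))" using n by (simp add: powr_def)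
      finally show "(\<Prod>j\<in>J \<phi>. (1 + (1 - 2 * p) ^ (2 * s j)) / 2) \<le> real n powr (- (2 + \<kappa>))" .
    qed (use p in \<open>auto intro!: prod_nonneg\<close>)
    also have "\<dots> = real n powr (- (2 + \<kappa>) * m)"
      using n P(1) by (simp add: powr_powr[symmetric] powr_realpow PP_def)
    finally show "prob (random_graph n p) {R. Q i R} \<le> real n powr (- (2 + \<kappa>) * m)" .
  qed
  also have "\<dots> = card I * real n powr (- (2 + \<kappa>) * m)" by simp
  also have "\<dots> \<le> (real r ^ n * real n powr (2 * m)) * real n powr (- (2 + \<kappa>) * m)"
    using cardI by (intro mult_right_mono) auto
  also have "\<dots> = real r ^ n * (real n powr (2 * m) * real n powr (- (2 + \<kappa>) * m))" by simp
  also have "real n powr (2 * m) * real n powr (- (2 + \<kappa>) * m) = real n powr (- \<kappa> * m)"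
    by (simp add: powr_add[symmetric] algebra_simps)
  finally show ?thesis .
qed

section \<open>Colour refinement of the perturbed graph\<close>

lemma neighbours_subset: "E \<subseteq> all_edges n \<Longrightarrow> neighbours E v \<subseteq> {1..n}"
  using doubleton_in_all_edges_iff by (auto simp: neighbours_def)

lemma finite_neighbours: "E \<subseteq> all_edges n \<Longrightarrow> finite (neighbours E v)"
  by (rule finite_subset[OF neighbours_subset]) auto

section \<open>Stabilisation of colour refinement\<close>

fun prev_colour :: "'o colour \<Rightarrow> 'o colour" where
  "prev_colour (Refined c M) = c"
| "prev_colour (Colour x) = Colour x"

abbreviation iterated :: "nat set set \<Rightarrow> nat \<Rightarrow> nat \<Rightarrow> unit colour" where
  "iterated E t \<equiv> (refine E ^^ t) trivial_colouring"

lemma prev_colour_iterated: "prev_colour (iterated E (Suc t) v) = iterated E t v"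
  by (simp add: refine_def)

lemma iterated_eq_Suc: "iterated E (Suc t) u = iterated F (Suc t) v \<Longrightarrow> iterated E t u = iterated F t v"
  by (metis prev_colour_iterated)

text \<open>A refined colour contains its predecessor, so equality at one round, even between
  vertices of different graphs, implies equality at all earlier rounds.\<close>

lemma iterated_eq_mono: "s \<le> t \<Longrightarrow> iterated E t u = iterated F t v \<Longrightarrow> iterated E s u = iterated F s v"
  by (induction t rule: dec_induct) (auto dest: iterated_eq_Suc simp del: funpow.simps)

text \<open>The map \<open>prev_colour\<close> sends the new colours onto the old ones. If their
  number has not grown, it is injective and the partition is the same.\<close>

lemma colour_classes_eq_if_card_eq:
  assumes "finite V" "card (iterated E (Suc t) ` V) \<le> card (iterated E t ` V)"
  shows "colour_classes V (iterated E (Suc t)) = colour_classes V (iterated E t)"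
proof -
  have img: "prev_colour ` (iterated E (Suc t) ` V) = iterated E t ` V"
    by (simp only: image_image prev_colour_iterated)
  have "card (prev_colour ` (iterated E (Suc t) ` V)) = card (iterated E (Suc t) ` V)"
    using assms card_image_le[of "iterated E (Suc t) ` V" prev_colour] unfolding img by simp
  then have "inj_on prev_colour (iterated E (Suc t) ` V)"
    using assms(1) by (intro eq_card_imp_inj_on) auto
  then have "iterated E (Suc t) u = iterated E (Suc t) v \<longleftrightarrow> iterated E t u = iterated E t v"
    if "u \<in> V" "v \<in> V" for u v
    using that prev_colour_iterated[where E = E and t = t] by (metis imageI inj_onD)
  then show ?thesis
    unfolding colour_classes_def by (intro image_cong refl Collect_cong) auto
qed

text \<open>Every round that changes the partition increases the number of colours, which cannot
  exceed \<open>card V\<close>.\<close>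

lemma stable_time_le:
  assumes "finite V"
  shows "\<exists>t\<le>card V. colour_classes V (iterated E (Suc t)) = colour_classes V (iterated E t)"
proof (rule ccontr)
  assume "\<not> ?thesis"
  then have lt: "card (iterated E t ` V) < card (iterated E (Suc t) ` V)" if "t \<le> card V" for t
    using colour_classes_eq_if_card_eq[OF assms] that by (meson not_le)
  have "t \<le> Suc (card V) \<Longrightarrow> t \<le> card (iterated E t ` V)" for t
  proof (induction t)
    case (Suc t)
    then show ?case using lt[of t] by simp
  qed simp
  from this[of "Suc (card V)"] card_image_le[OF assms, of "iterated E (Suc (card V))"]
  show False by (simp del: funpow.simps)
qed

lemma stable_colouring_properties:
  fixes E :: "nat set set"
  assumes "finite V"
  obtains t where "t \<le> card V" "stable_colouring V E trivial_colouring = iterated E t"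
    "colour_classes V (iterated E (Suc t)) = colour_classes V (iterated E t)"
proof -
  let ?P = "\<lambda>t. colour_classes V (iterated E (Suc t)) = colour_classes V (iterated E t)"
  obtain t0 where t0: "t0 \<le> card V" "?P t0" using stable_time_le[OF assms] by blast
  have "?P (LEAST t. ?P t)" using t0(2) by (rule LeastI)
  moreover have "(LEAST t. ?P t) \<le> card V" using Least_le[of ?P, OF t0(2)] t0(1) by linarith
  ultimately show ?thesis by (intro that[of "LEAST t. ?P t"]) (simp_all only: stable_colouring_def)
qed

text \<open>As the next refinement has the same classes, vertices of equal stable colour also have
  equal refined colours, and these record the degrees into all classes.\<close>

lemma stable_colouring_equitable:
  assumes E: "E \<subseteq> all_edges n"
  shows "equitable n E (stable_colouring {1..n} E trivial_colouring)"
proof -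
  obtain t where t: "stable_colouring {1..n} E trivial_colouring = iterated E t"
    "colour_classes {1..n} (iterated E (Suc t)) = colour_classes {1..n} (iterated E t)"
    using stable_colouring_properties[of "{1..n}"] by blast
  show ?thesis
    unfolding equitable_def t(1)
  proof (intro ballI impI allI)
    fix x y \<omega> assume xy: "x \<in> {1..n}" "y \<in> {1..n}" "iterated E t x = iterated E t y"
    \<comment> \<open>The two partitions are equal only as sets of classes, so the class of
      \<open>x\<close> has to be found again through some \<open>u\<close>.\<close>
    have "{v \<in> {1..n}. iterated E t v = iterated E t x} \<in> colour_classes {1..n} (iterated E (Suc t))"
      unfolding t(2) using xy by (auto simp: colour_classes_def)
    then obtain u where u: "{v \<in> {1..n}. iterated E t v = iterated E t x}
        = {v \<in> {1..n}. iterated E (Suc t) v = iterated E (Suc t) u}"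
      unfolding colour_classes_def by (rule imageE)
    have "x \<in> {v \<in> {1..n}. iterated E t v = iterated E t x}" "y \<in> {v \<in> {1..n}. iterated E t v = iterated E t x}"
      using xy by simp_all
    then have "refine E (iterated E t) x = refine E (iterated E t) y" unfolding u by simp
    then have "card {w \<in> neighbours E x. iterated E t w = \<omega>} = card {w \<in> neighbours E y. iterated E t w = \<omega>}"
      using refine_eq_iff[OF finite_neighbours[OF E] finite_neighbours[OF E]] by blast
    moreover have "{w \<in> neighbours E z. iterated E t w = \<omega>} = {w \<in> {1..n}. {z, w} \<in> E \<and> iterated E t w = \<omega>}" for z
      using neighbours_subset[OF E, of z] by (auto simp: neighbours_def)
    ultimately show "card {w \<in> {1..n}. {x, w} \<in> E \<and> iterated E t w = \<omega>}
      = card {w \<in> {1..n}. {y, w} \<in> E \<and> iterated E t w = \<omega>}" by simp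
  qed
qed

lemma prob_random_graph_mono:
  assumes "\<And>R. R \<subseteq> all_edges n \<Longrightarrow> P R \<Longrightarrow> Q R"
  shows "prob (random_graph n p) {R. P R} \<le> prob (random_graph n p) {R. Q R}"
  unfolding random_graph_def measure_map_pmf
  by (intro measure_pmf.finite_measure_mono) (auto intro: assms)

section \<open>Limits of the probabilities\<close>

lemma whpI:
  assumes "f \<longlonglongrightarrow> 0" "\<forall>\<^sub>F n in sequentially. prob (M n) {x. \<not> P n x} \<le> f n"
  shows "whp M P"
  unfolding whp_def
proof (rule tendsto_sandwich[where h = "\<lambda>_. 1"])
  show "(\<lambda>n. 1 - f n) \<longlonglongrightarrow> 1" using tendsto_diff[OF tendsto_const assms(1), of 1] by simp
  show "\<forall>\<^sub>F n in sequentially. 1 - f n \<le> prob (M n) {x. P n x}"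
    using assms(2)
  proof eventually_elim
    case (elim n)
    have "{x. \<not> P n x} = UNIV - {x. P n x}" by auto
    then show ?case using elim measure_pmf.prob_compl[of "{x. P n x}" "M n"] by simp
  qed
qed (auto intro: always_eventually)

lemma whp_mono:
  assumes "whp (\<lambda>n. random_graph n (p n)) P" "\<And>n R. R \<subseteq> all_edges n \<Longrightarrow> P n R \<Longrightarrow> Q n R"
  shows "whp (\<lambda>n. random_graph n (p n)) Q"
  unfolding whp_def
proof (rule tendsto_sandwich[OF _ _ assms(1)[unfolded whp_def] tendsto_const])
  show "\<forall>\<^sub>F n in sequentially. prob (random_graph n (p n)) {x. P n x}
      \<le> prob (random_graph n (p n)) {x. Q n x}"
    by (intro always_eventually allI prob_random_graph_mono assms(2))
qed (auto intro: always_eventually)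

text \<open>Given \<open>e\<close>, the modulus \<open>M\<close> is fixed first, so that
  \<open>1 / M\<close> contributes less than \<open>e / 2\<close>. The constant \<open>c\<close>
  depends only on \<open>M\<close>, and the exponential term vanishes as \<open>n\<close>
  grows.\<close>

lemma prob_degree_event_tendsto_0:
  fixes p :: "nat \<Rightarrow> real" and G :: "nat \<Rightarrow> nat set set"
  assumes \<eta>: "\<eta> > 0"
    and p: "\<forall>\<^sub>F n in sequentially. 0 \<le> p n \<and> p n \<le> 1 / 2 \<and> 2 * p n * (1 - p n) * real n \<ge> 2 * ln (real n)"
  shows "(\<lambda>n. prob (random_graph n (p n)) {R. degree_event \<eta> n (sym_diff (G n) R)}) \<longlonglongrightarrow> 0"
proof (rule tendstoI)
  fix e :: real assume e: "e > 0"
  obtain M :: nat where M: "4 / (e * \<eta>\<^sup>2) < real M" using reals_Archimedean2 by blast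
  have "4 / (e * \<eta>\<^sup>2) > 0" using e \<eta> by simp
  then have M0: "real M > 0" using M by linarith
  have M2: "2 * (1 / real M) / \<eta>\<^sup>2 < e / 2"
    using M M0 e \<eta> by (simp add: divide_simps mult.commute mult.left_commute split: if_splits)
  obtain c where c: "c > 0" "\<forall>j\<in>{1..<M}. 1 - cos (2 * pi * real j / real M) \<ge> c"
    using one_minus_cos_roots_bounded_below by blast
  have "(\<lambda>n::nat. 2 * exp (- c * (ln (real n) / 2)) / \<eta>\<^sup>2) \<longlonglongrightarrow> 2 * 0 / \<eta>\<^sup>2"
  proof (intro tendsto_intros)
    show "(\<lambda>n::nat. exp (- c * (ln (real n) / 2))) \<longlonglongrightarrow> 0" using c(1) by real_asymp
  qed (use \<eta> in simp)
  then have "\<forall>\<^sub>F n::nat in sequentially. 2 * exp (- c * (ln (real n) / 2)) / \<eta>\<^sup>2 < e / 2"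
    using e by (intro order_tendstoD(2)) auto
  moreover have "\<forall>\<^sub>F n::nat in sequentially. \<eta> * real n \<ge> 2" using \<eta> by real_asymp
  ultimately show "\<forall>\<^sub>F n in sequentially.
      dist (prob (random_graph n (p n)) {R. degree_event \<eta> n (sym_diff (G n) R)}) 0 < e"
    using p eventually_ge_at_top[of 4]
  proof eventually_elim
    case (elim n)
    define \<theta> where "\<theta> = 1 / real M + exp (- c * (ln (real n) / 2))"
    have "prob (random_graph n (p n)) {R. degree_event \<eta> n (sym_diff (G n) R)} \<le> 2 * \<theta> / \<eta>\<^sup>2"
      unfolding degree_event_def
    proof (rule prob_large_degree_class_le)
      fix x y assume xy: "x \<in> {1..n}" "y \<in> {1..n}" "x \<noteq> y"
      have "prob (random_graph n (p n))
         {R. degree_in n (sym_diff (G n) R) x = degree_in n (sym_diff (G n) R) y}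
        \<le> 1 / real M + exp (- (p n * (1 - p n) * c * (n - 2)))"
        using M0 elim by (intro prob_degrees_eq_le c(2) xy) auto
      also have "\<dots> \<le> \<theta>"
      proof -
        \<comment> \<open>The factor 1/2 pays for \<open>n - 2 \<ge> n / 2\<close>, valid for
          \<open>n \<ge> 4\<close>.\<close>
        have "2 * ln (real n) * (1 / 2) \<le> (2 * p n * (1 - p n) * real n) * (1 / 2)"
          using elim by (intro mult_right_mono) auto
        also have "\<dots> = 2 * p n * (1 - p n) * (real n / 2)" by simp
        also have "\<dots> \<le> 2 * p n * (1 - p n) * real (n - 2)"
          using elim by (intro mult_left_mono) (auto simp: of_nat_diff)
        finally have "c * (ln (real n) / 2) \<le> c * (p n * (1 - p n) * real (n - 2))"
          using c(1) by (intro mult_left_mono) auto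
        then show ?thesis by (simp add: \<theta>_def algebra_simps)
      qed
      finally show "prob (random_graph n (p n))
         {R. degree_in n (sym_diff (G n) R) x = degree_in n (sym_diff (G n) R) y} \<le> \<theta>" .
    qed (use \<eta> elim M0 in \<open>auto simp: \<theta>_def\<close>)
    also have "\<dots> = 2 * (1 / real M) / \<eta>\<^sup>2 + 2 * exp (- c * (ln (real n) / 2)) / \<eta>\<^sup>2"
      by (simp add: \<theta>_def add_divide_distrib distrib_left)
    also have "\<dots> < e" using M2 elim by linarith
    finally show ?case by (simp add: measure_nonneg)
  qed
qed

text \<open>Since \<open>x * (1 - x)\<close> increases up to 1/2, \<open>p\<close> may be replaced
  by its lower bound \<open>p0\<close>. This is so small that \<open>1 - p0\<close> only reduces
  \<open>1 + 2 * \<kappa>\<close> to at least \<open>1 + \<kappa>\<close>.\<close>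

lemma edge_density_bound:
  fixes p \<kappa> :: real
  assumes "0 < \<kappa>" "p \<le> 1 / 2" "(1 + 2 * \<kappa>) * ln (real n) / real n \<le> p"
    and "(1 + 2 * \<kappa>) * ln (real n) / real n \<le> \<kappa> / (1 + 2 * \<kappa>)" "n \<ge> 2"
  shows "2 * p * (1 - p) * real n \<ge> 2 * (1 + \<kappa>) * ln (real n)"
proof -
  define p0 where "p0 = (1 + 2 * \<kappa>) * ln (real n) / real n"
  have p0: "0 \<le> p0" "p0 \<le> p" "p0 \<le> \<kappa> / (1 + 2 * \<kappa>)" "p0 * real n = (1 + 2 * \<kappa>) * ln (real n)"
    using assms by (auto simp: p0_def)
  have "0 \<le> (p - p0) * (1 - p - p0)" using p0 assms by (intro mult_nonneg_nonneg) auto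
  then have "p0 * (1 - p0) \<le> p * (1 - p)" by (simp add: algebra_simps)
  then have "2 * (p0 * (1 - p0)) * real n \<le> 2 * (p * (1 - p)) * real n"
    by (intro mult_right_mono mult_left_mono) auto
  moreover have "(1 + \<kappa>) * ln (real n) \<le> (1 - p0) * (1 + 2 * \<kappa>) * ln (real n)"
  proof (rule mult_right_mono)
    have "p0 * (1 + 2 * \<kappa>) \<le> \<kappa>" using p0(3) assms(1) by (simp add: le_divide_eq)
    then show "1 + \<kappa> \<le> (1 - p0) * (1 + 2 * \<kappa>)" by (simp add: algebra_simps)
  qed (use assms in simp)
  moreover have "2 * (p0 * (1 - p0)) * real n = 2 * ((1 - p0) * (1 + 2 * \<kappa>) * ln (real n))"
  proof -
    have "2 * (p0 * (1 - p0)) * real n = 2 * ((1 - p0) * (p0 * real n))" by (simp only: mult_ac)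
    then show ?thesis by (simp only: p0(4) mult.assoc)
  qed
  ultimately show ?thesis by (simp add: algebra_simps)
qed

text \<open>The four events are combined for explicit \<open>b\<close> and \<open>m\<close>; the
  four summands bound them in the order of the case distinction. By the choice of \<open>K1\<close>,
  each number \<open>K\<close> of big classes contributes at most
  \<open>(1 / 2) ^ n\<close>.\<close>

lemma prob_not_distinguished_le:
  fixes p \<kappa> \<tau> :: real and n :: nat
  assumes p: "0 \<le> p" "p \<le> 1 / 2" and n: "n \<ge> 2" and \<kappa>: "0 < \<kappa>" "\<kappa> \<le> 1 / 2"
    and q: "2 * p * (1 - p) * real n \<ge> 2 * (1 + \<kappa>) * ln (real n)"
    and \<tau>: "\<tau> = \<kappa> / 96" "\<tau> * real n / ln (real n) \<ge> 4" "6 * (ln (real n) / real n) \<le> \<kappa> / 48"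
    and G: "G \<subseteq> all_edges n"
    and \<eta>: "\<eta> > 0" "real K1 * \<eta> \<le> \<kappa> / 24"
    and K1: "\<And>K. K \<ge> K1 \<Longrightarrow> (real K + 1) * ((1 + exp (- (2 * \<tau>))) / 2) powr (real K * (\<kappa> / 24) / 8) \<le> 1 / 2"
  shows "prob (random_graph n p) {R. \<not> distinguishes_all_vertices {1..n} (sym_diff G R)}
    \<le> (exp (2 * real n powr (- \<kappa>)) - 1)
      + prob (random_graph n p) {R. degree_event \<eta> n (sym_diff G R)}
      + (real n + 1) * (1 / 2) ^ n
      + (ln (real n) / \<tau> + 1) powr real n * real n powr (- \<kappa> * (\<kappa> * real n / 24 - 1))"
proof -
  let ?P = "\<lambda>Q. prob (random_graph n p) {R. Q (sym_diff G R)}"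
  have lnn: "ln (real n) > 0" using n by simp
  \<comment> \<open>Of order \<open>n / ln n\<close>: large enough for
    \<open>2 * p * (1 - p) * b \<ge> 2 * \<tau>\<close> and for only \<open>O(ln n)\<close> groups,
    small enough for the first-order estimate on groups of size \<open>2 * b\<close>.\<close>
  define b where "b = nat \<lceil>\<tau> * real n / ln (real n)\<rceil>"
  \<comment> \<open>This gives \<open>2 * m \<le> \<kappa> / 12 * n\<close> for the grouping bound
    and \<open>3 * m \<le> \<kappa> / 4 * n\<close> for finding the pairs.\<close>
  define m where "m = nat \<lfloor>\<kappa> * real n / 24\<rfloor>"
  have b: "\<tau> * real n / ln (real n) \<le> real b" "real b \<le> \<tau> * real n / ln (real n) + 1"
    using \<tau> unfolding b_def by linarith+
  have "real b \<ge> 4" using b(1) \<tau>(2) by linarith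
  then have b4: "b \<ge> 4" by linarith
  have m: "real m \<le> \<kappa> * real n / 24" "\<kappa> * real n / 24 - 1 \<le> real m"
  proof -
    have "0 \<le> \<kappa> * real n / 24" using \<kappa> by simp
    then show "real m \<le> \<kappa> * real n / 24" "\<kappa> * real n / 24 - 1 \<le> real m"
      unfolding m_def by linarith+
  qed
  have \<tau>0: "\<tau> > 0" using \<tau>(1) \<kappa> by simp
  have qb: "2 * p * (1 - p) * real b \<ge> 2 * \<tau>"
  proof -
    have "2 * \<tau> \<le> 2 * (1 + \<kappa>) * \<tau>" using \<tau>0 \<kappa> by simp
    also have "\<dots> = (2 * (1 + \<kappa>) * ln (real n)) * (\<tau> / ln (real n))" using lnn by simp
    also have "\<dots> \<le> (2 * p * (1 - p) * real n) * (\<tau> / ln (real n))"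
      using q lnn \<tau>0 by (intro mult_right_mono) auto
    also have "\<dots> = 2 * p * (1 - p) * (\<tau> * real n / ln (real n))" by simp
    also have "\<dots> \<le> 2 * p * (1 - p) * real b" using b(1) p by (intro mult_left_mono) auto
    finally show ?thesis .
  qed
  \<comment> \<open>The value \<open>\<tau> = \<kappa> / 96\<close> is made for this:
    \<open>6 * \<tau> = \<kappa> / 16\<close>, and rounding up \<open>b\<close> adds at most
    \<open>\<kappa> / 48\<close>.\<close>
  have b2: "2 * real b * (2 * (1 + \<kappa>) * ln (real n) / real n) \<le> \<kappa> / 12"
  proof -
    have "2 * real b * (2 * (1 + \<kappa>) * ln (real n) / real n) = (4 * (1 + \<kappa>)) * (real b * (ln (real n) / real n))"
      by simp
    also have "\<dots> \<le> 6 * (real b * (ln (real n) / real n))"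
      using \<kappa> lnn by (intro mult_right_mono) auto
    also have "\<dots> \<le> 6 * ((\<tau> * real n / ln (real n) + 1) * (ln (real n) / real n))"
      using b(2) lnn by (intro mult_left_mono mult_right_mono) auto
    also have "\<dots> = 6 * \<tau> + 6 * (ln (real n) / real n)"
      using lnn n by (simp add: field_simps)
    also have "\<dots> \<le> \<kappa> / 12" using \<tau>(1,3) by simp
    finally show ?thesis .
  qed
  have cases: "?P (\<lambda>E. \<not> distinguishes_all_vertices {1..n} E)
    \<le> ?P (\<lambda>E. small_event (\<kappa> / 4) n E \<or> degree_event \<eta> n E
        \<or> (\<exists>K\<in>{K1..n}. big_classes_event b (\<kappa> / 24) K n E)
        \<or> grouping_event b (n div b + 1) (\<kappa> / 24) m n E)"
  proof (rule prob_random_graph_mono)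
    fix R assume R: "R \<subseteq> all_edges n" and "\<not> distinguishes_all_vertices {1..n} (sym_diff G R)"
    then have ninj: "\<not> inj_on (stable_colouring {1..n} (sym_diff G R) trivial_colouring) {1..n}"
      by (simp add: distinguishes_all_vertices_def)
    have "sym_diff G R \<subseteq> all_edges n" using G R by auto
    then have eq: "equitable n (sym_diff G R) (stable_colouring {1..n} (sym_diff G R) trivial_colouring)"
      by (rule stable_colouring_equitable)
    show "small_event (\<kappa> / 4) n (sym_diff G R) \<or> degree_event \<eta> n (sym_diff G R)
        \<or> (\<exists>K\<in>{K1..n}. big_classes_event b (\<kappa> / 24) K n (sym_diff G R))
        \<or> grouping_event b (n div b + 1) (\<kappa> / 24) m n (sym_diff G R)"
      by (rule equitable_not_inj_cases[OF eq ninj]) (use b4 \<eta> n m \<kappa> in auto)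
  qed
  also have "\<dots> \<le> ?P (small_event (\<kappa> / 4) n) + (?P (degree_event \<eta> n)
      + (?P (\<lambda>E. \<exists>K\<in>{K1..n}. big_classes_event b (\<kappa> / 24) K n E)
      + ?P (grouping_event b (n div b + 1) (\<kappa> / 24) m n)))"
    unfolding Collect_disj_eq
    by (intro order.trans[OF measure_subadditive] add_mono order.refl) (auto simp: emeasure_eq_ennreal_measure)
  also have "?P (small_event (\<kappa> / 4) n) \<le> exp (2 * real n powr (- \<kappa>)) - 1"
    by (rule prob_small_event_le[OF p n \<kappa> q])
  also have "?P (\<lambda>E. \<exists>K\<in>{K1..n}. big_classes_event b (\<kappa> / 24) K n E) \<le> (\<Sum>K\<in>{K1..n}. (1 / 2) ^ n)"
  proof (rule prob_Bex_le_sum)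
    fix K assume K: "K \<in> {K1..n}"
    have "?P (big_classes_event b (\<kappa> / 24) K n)
      \<le> ((real K + 1) * ((1 + exp (- (2 * \<tau>))) / 2) powr (K * (\<kappa> / 24) / 8)) ^ n"
      using \<kappa> by (intro prob_big_classes_event_le[OF p b4 \<tau>0 qb]) auto
    also have "\<dots> \<le> (1 / 2) ^ n"
      using K1[of K] K by (intro power_mono) auto
    finally show "?P (big_classes_event b (\<kappa> / 24) K n) \<le> (1 / 2) ^ n" .
  qed simp
  also have "(\<Sum>K\<in>{K1..n}. (1 / 2 :: real) ^ n) \<le> (real n + 1) * (1 / 2) ^ n"
    by simp
  also have "?P (grouping_event b (n div b + 1) (\<kappa> / 24) m n)
      \<le> (ln (real n) / \<tau> + 1) powr real n * real n powr (- \<kappa> * (\<kappa> * real n / 24 - 1))"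
  proof -
    have "?P (grouping_event b (n div b + 1) (\<kappa> / 24) m n) \<le> real (n div b + 1) ^ n * real n powr (- \<kappa> * m)"
      by (rule prob_grouping_event_le[OF p n \<kappa> q b2]) (use m in simp)
    also have "\<dots> \<le> (ln (real n) / \<tau> + 1) powr real n * real n powr (- \<kappa> * (\<kappa> * real n / 24 - 1))"
    proof (rule mult_mono)
      have "real (n div b) \<le> real n / real b" by (rule of_nat_div_le_of_nat)
      also have "\<dots> \<le> real n / (\<tau> * real n / ln (real n))"
        using b(1) \<tau>0 lnn n b4 by (intro divide_left_mono mult_pos_pos divide_pos_pos) auto
      also have "\<dots> = ln (real n) / \<tau>" using n by simp
      finally have "real (n div b + 1) \<le> ln (real n) / \<tau> + 1" by simp
      then have "real (n div b + 1) ^ n \<le> (ln (real n) / \<tau> + 1) ^ n" by (intro power_mono) auto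
      also have "\<dots> = (ln (real n) / \<tau> + 1) powr real n"
        using lnn \<tau>0 by (intro powr_realpow[symmetric]) (simp add: add_pos_pos)
      finally show "real (n div b + 1) ^ n \<le> (ln (real n) / \<tau> + 1) powr real n" .
      have "- \<kappa> * real m \<le> - \<kappa> * (\<kappa> * real n / 24 - 1)" using m(2) \<kappa> by (intro mult_left_mono_neg) auto
      then show "real n powr (- \<kappa> * real m) \<le> real n powr (- \<kappa> * (\<kappa> * real n / 24 - 1))"
        using n by (intro powr_mono) auto
    qed auto
    finally show ?thesis .
  qed
  finally show ?thesis by simp
qed

text \<open>The constants are chosen in the order \<open>\<kappa>\<close>, \<open>\<tau>\<close>,
  \<open>\<rho>\<close>, \<open>K1\<close>, \<open>\<eta>\<close>. In particular \<open>K1\<close>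
  has to beat the number of maps into \<open>K + 1\<close> values, and only then is
  \<open>\<eta>\<close> small enough to force \<open>K1\<close> classes.\<close>

theorem whp_distinguishes_all_vertices:
  fixes \<epsilon> :: real and p :: "nat \<Rightarrow> real" and G :: "nat \<Rightarrow> nat set set"
  assumes \<epsilon>: "\<epsilon> > 0"
    and p: "\<forall>\<^sub>F n in sequentially. 0 \<le> p n \<and> p n \<le> 1/2 \<and> (1 + \<epsilon>) * ln (real n) / real n \<le> p n"
    and G: "\<And>n. G n \<subseteq> all_edges n"
  shows "whp (\<lambda>n. random_graph n (p n)) (\<lambda>n R. distinguishes_all_vertices {1..n} (sym_diff (G n) R))"
proof -
  define \<kappa> where "\<kappa> = min (\<epsilon> / 2) (1 / 2)"
  define \<tau> where "\<tau> = \<kappa> / 96"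
  have \<kappa>: "0 < \<kappa>" "\<kappa> \<le> 1 / 2" "2 * \<kappa> \<le> \<epsilon>" using \<epsilon> by (auto simp: \<kappa>_def)
  define \<rho> where "\<rho> = (1 + exp (- (2 * \<tau>))) / 2"
  have \<rho>: "0 < \<rho>" "\<rho> < 1" using \<kappa> by (auto simp: \<rho>_def \<tau>_def add_pos_pos)
  define c where "c = - ln \<rho> * (\<kappa> / 24) / 8"
  have "ln \<rho> < 0" using \<rho> by simp
  then have c: "c > 0" using \<kappa> by (simp add: c_def mult_neg_pos)
  have "(\<lambda>K::nat. (real K + 1) * exp (- c * real K)) \<longlonglongrightarrow> 0" using c by real_asymp
  then have "\<forall>\<^sub>F K::nat in sequentially. (real K + 1) * exp (- c * real K) < 1 / 2"
    by (rule order_tendstoD) simp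
  then obtain K1 where K1: "\<And>K. K \<ge> K1 \<Longrightarrow> (real K + 1) * exp (- c * real K) < 1 / 2"
    by (auto simp: eventually_sequentially)
  have K1': "(real K + 1) * \<rho> powr (real K * (\<kappa> / 24) / 8) \<le> 1 / 2" if "K \<ge> K1" for K
  proof -
    have "\<rho> powr (real K * (\<kappa> / 24) / 8) = exp (- c * real K)" using \<rho> by (simp add: powr_def c_def)
    then show ?thesis using K1[OF that] by simp
  qed
  \<comment> \<open>The summand 1 avoids division by zero when \<open>K1 = 0\<close>.\<close>
  define \<eta> where "\<eta> = \<kappa> / 24 / (real K1 + 1)"
  have \<eta>: "\<eta> > 0" "real K1 * \<eta> \<le> \<kappa> / 24" using \<kappa> by (auto simp: \<eta>_def field_simps)
  have small: "\<forall>\<^sub>F n::nat in sequentially. (1 + 2 * \<kappa>) * ln (real n) / real n \<le> \<kappa> / (1 + 2 * \<kappa>)"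
    using \<kappa>(1) by real_asymp
  have good: "\<forall>\<^sub>F n in sequentially. 0 \<le> p n \<and> p n \<le> 1 / 2
      \<and> 2 * p n * (1 - p n) * real n \<ge> 2 * (1 + \<kappa>) * ln (real n)"
    using p small eventually_ge_at_top[of 2]
  proof eventually_elim
    case (elim n)
    have "(1 + 2 * \<kappa>) * ln (real n) / real n \<le> (1 + \<epsilon>) * ln (real n) / real n"
      using \<kappa>(3) elim by (intro divide_right_mono mult_right_mono) auto
    then show ?case using elim \<kappa> by (intro conjI edge_density_bound) auto
  qed
  let ?D = "\<lambda>n. prob (random_graph n (p n)) {R. degree_event \<eta> n (sym_diff (G n) R)}"
  have D: "?D \<longlonglongrightarrow> 0"
  proof (rule prob_degree_event_tendsto_0[OF \<eta>(1)])
    show "\<forall>\<^sub>F n in sequentially. 0 \<le> p n \<and> p n \<le> 1 / 2 \<and> 2 * p n * (1 - p n) * real n \<ge> 2 * ln (real n)"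
      using good eventually_ge_at_top[of 1]
    proof eventually_elim
      case (elim n)
      have "2 * ln (real n) \<le> 2 * (1 + \<kappa>) * ln (real n)" using elim \<kappa> by (intro mult_right_mono) auto
      then show ?case using elim by linarith
    qed
  qed
  show ?thesis
  proof (rule whpI)
    show "(\<lambda>n. (exp (2 * real n powr (- \<kappa>)) - 1) + ?D n + (real n + 1) * (1 / 2) ^ n
        + (ln (real n) / \<tau> + 1) powr real n * real n powr (- \<kappa> * (\<kappa> * real n / 24 - 1))) \<longlonglongrightarrow> 0"
    proof (intro tendsto_add_zero D)
      have "\<tau> > 0" using \<kappa> by (simp add: \<tau>_def)
      \<comment> \<open>The logarithm of the first factor is of order \<open>n * ln (ln n)\<close>,
        that of the second about \<open>- \<kappa>\<^sup>2 / 24 * n * ln n\<close>.\<close>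
      then show "(\<lambda>n. (ln (real n) / \<tau> + 1) powr real n * real n powr (- \<kappa> * (\<kappa> * real n / 24 - 1))) \<longlonglongrightarrow> 0"
        using \<kappa>(1) by real_asymp
      show "(\<lambda>n. exp (2 * real n powr (- \<kappa>)) - 1) \<longlonglongrightarrow> 0" using \<kappa>(1) by real_asymp
      show "(\<lambda>n. (real n + 1) * (1 / 2) ^ n) \<longlonglongrightarrow> 0" by real_asymp
    qed
    have "\<forall>\<^sub>F n::nat in sequentially. \<tau> * real n / ln (real n) \<ge> 4"
    proof -
      have "\<tau> > 0" using \<kappa> by (simp add: \<tau>_def)
      then show ?thesis by real_asymp
    qed
    moreover have "\<forall>\<^sub>F n::nat in sequentially. 6 * (ln (real n) / real n) \<le> \<kappa> / 48" using \<kappa>(1) by real_asymp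
    ultimately show "\<forall>\<^sub>F n in sequentially. prob (random_graph n (p n))
        {R. \<not> distinguishes_all_vertices {1..n} (sym_diff (G n) R)}
      \<le> (exp (2 * real n powr (- \<kappa>)) - 1) + ?D n + (real n + 1) * (1 / 2) ^ n
        + (ln (real n) / \<tau> + 1) powr real n * real n powr (- \<kappa> * (\<kappa> * real n / 24 - 1))"
      using good eventually_ge_at_top[of 2]
    proof eventually_elim
      case (elim n)
      then show ?case
        using \<kappa> by (intro prob_not_distinguished_le[OF _ _ _ _ _ _ \<tau>_def _ _ G \<eta> K1'[unfolded \<rho>_def]]) auto
    qed
  qed
qed

section \<open>Timed execution and the isomorphism test\<close>

text \<open>Upper bounds on the time compose without exact step counts; in particular both branches
  of a conditional can share one bound.\<close>

definition run :: "com \<Rightarrow> memory \<Rightarrow> nat \<Rightarrow> memory \<Rightarrow> bool" where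
  "run P s T s' \<longleftrightarrow> (\<exists>t\<le>T. exec P s t s')"

lemma runI: "exec P s t s' \<Longrightarrow> t \<le> T \<Longrightarrow> run P s T s'"
  by (auto simp: run_def)

lemma runE:
  assumes "run P s T s'"
  obtains t where "exec P s t s'" "t \<le> T"
  using assms by (auto simp: run_def)

lemma run_mono: "run P s T s' \<Longrightarrow> T \<le> U \<Longrightarrow> run P s U s'"
  by (auto elim!: runE intro: runI)

lemma run_Skip: "run Skip s 1 s"
  by (rule runI[OF exec.Skip]) simp

lemma run_Assign: "run (Assign x a b) s 1 (s(x := (s x)(aval a s := aval b s)))"
  by (rule runI[OF exec.Assign]) simp

lemma run_Seq: "run P s T s' \<Longrightarrow> run Q s' U s'' \<Longrightarrow> run (Seq P Q) s (T + U) s''"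
  by (elim runE, rule runI[OF exec.Seq]) auto

lemma run_If:
  assumes "bval b s \<Longrightarrow> run P s T s'" "\<not> bval b s \<Longrightarrow> run Q s T s'"
  shows "run (If b P Q) s (1 + T) s'"
proof (cases "bval b s")
  case True
  show ?thesis using assms(1)[OF True] by (elim runE, intro runI[OF exec.IfTrue] True) auto
next
  case False
  show ?thesis using assms(2)[OF False] by (elim runE, intro runI[OF exec.IfFalse] False) auto
qed

lemma run_While_False: "\<not> bval b s \<Longrightarrow> run (While b P) s 1 s"
  by (rule runI[OF exec.WhileFalse]) auto

lemma run_While_True:
  assumes "bval b s" "run P s T s'" "run (While b P) s' U s''"
  shows "run (While b P) s (1 + T + U) s''"
  using assms(2,3) by (elim runE, intro runI[OF exec.WhileTrue] assms(1)) auto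

abbreviation Reg :: "nat \<Rightarrow> aexp" where
  "Reg x \<equiv> Cell x (N 0)"

definition For :: "nat \<Rightarrow> aexp \<Rightarrow> com \<Rightarrow> com" where
  "For x k P = Seq (Assign x (N 0) (N 0))
     (While (Less (Reg x) k) (Seq P (Assign x (N 0) (Plus (Reg x) (N 1)))))"

definition Eq :: "aexp \<Rightarrow> aexp \<Rightarrow> bexp" where
  "Eq a b = And (Not (Less a b)) (Not (Less b a))"

lemma bval_Eq [simp]: "bval (Eq a b) s \<longleftrightarrow> aval a s = aval b s"
  by (auto simp: Eq_def)

definition set_reg :: "memory \<Rightarrow> nat \<Rightarrow> nat \<Rightarrow> memory" where
  "set_reg s x v = s(x := (s x)(0 := v))"

lemma set_reg_simps [simp]: "set_reg s x v x 0 = v" "y \<noteq> x \<Longrightarrow> set_reg s x v y = s y"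
  by (simp_all add: set_reg_def)

text \<open>By \<open>reg\<close> the invariant does not notice the counter, so it survives the
  reset and each increment; by \<open>bound\<close> it fixes the value of the limit, which is
  evaluated anew at every test. Per round the test and the increment add 2 to \<open>T\<close>; the
  initial assignment and the last test give the other 2.\<close>

lemma run_For:
  assumes bound: "\<And>i s. Inv i s \<Longrightarrow> aval k s = K"
    and reg: "\<And>i s v. Inv i s \<Longrightarrow> Inv i (set_reg s x v)"
    and body: "\<And>i s. i < K \<Longrightarrow> Inv i s \<Longrightarrow> s x 0 = i \<Longrightarrow> \<exists>s'. run P s T s' \<and> Inv (Suc i) s' \<and> s' x 0 = i"
    and init: "Inv 0 s"
  shows "\<exists>s'. run (For x k P) s (2 + K * (T + 2)) s' \<and> Inv K s'"
proof -
  let ?W = "While (Less (Reg x) k) (Seq P (Assign x (N 0) (Plus (Reg x) (N 1))))"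
  have loop: "\<exists>s'. run ?W s (1 + d * (T + 2)) s' \<and> Inv K s'"
    if "Inv i s" "s x 0 = i" "i + d = K" for i d s
    using that
  proof (induction d arbitrary: i s)
    case 0
    then show ?case using bound[of i s] by (intro exI[of _ s] conjI run_mono[OF run_While_False]) auto
  next
    case (Suc d)
    then obtain s' where s': "run P s T s'" "Inv (Suc i) s'" "s' x 0 = i" using body[of i s] by auto
    let ?s = "set_reg s' x (Suc i)"
    have "run (Assign x (N 0) (Plus (Reg x) (N 1))) s' 1 ?s"
      using run_Assign[of x "N 0" "Plus (Reg x) (N 1)" s'] s'(3) by (simp add: set_reg_def)
    then have step: "run (Seq P (Assign x (N 0) (Plus (Reg x) (N 1)))) s (T + 1) ?s" using s'(1) run_Seq by blast
    obtain s'' where s'': "run ?W ?s (1 + d * (T + 2)) s''" "Inv K s''"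
      using Suc.IH[of "Suc i" ?s] reg[OF s'(2)] Suc.prems(3) by auto
    have "bval (Less (Reg x) k) s" using bound[OF Suc.prems(1)] Suc.prems by simp
    from run_While_True[OF this step s''(1)] have "run ?W s (1 + Suc d * (T + 2)) s''"
      by (rule run_mono) simp
    then show ?case using s''(2) by blast
  qed
  have "run (Assign x (N 0) (N 0)) s 1 (set_reg s x 0)"
    using run_Assign[of x "N 0" "N 0" s] by (simp add: set_reg_def)
  moreover obtain s' where "run ?W (set_reg s x 0) (1 + K * (T + 2)) s'" "Inv K s'"
    using loop[of 0 "set_reg s x 0" K] reg[OF init] by auto
  ultimately show ?thesis
    unfolding For_def by (intro exI[of _ s'] conjI run_mono[OF run_Seq]) auto
qed

definition same_except :: "nat set \<Rightarrow> memory \<Rightarrow> memory \<Rightarrow> bool" where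
  "same_except M s s' \<longleftrightarrow> (\<forall>x. x \<notin> M \<longrightarrow> s x = s' x)"

lemma same_except_refl [simp]: "same_except M s s"
  by (simp add: same_except_def)

lemma same_exceptD: "same_except M s s' \<Longrightarrow> x \<notin> M \<Longrightarrow> s x = s' x"
  by (simp add: same_except_def)

lemma same_except_trans:
  assumes "same_except M s s'" "same_except M' s' s''" "M \<union> M' \<subseteq> M''"
  shows "same_except M'' s s''"
  unfolding same_except_def
proof (intro allI impI)
  fix x assume "x \<notin> M''"
  then have "x \<notin> M" "x \<notin> M'" using assms(3) by auto
  then show "s x = s'' x" using assms(1,2) by (simp add: same_except_def)
qed

lemma same_except_upd [simp]: "x \<in> M \<Longrightarrow> same_except M (s(x := a)) s' \<longleftrightarrow> same_except M s s'"
  by (auto simp: same_except_def)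

lemma same_except_set_reg [simp]: "x \<in> M \<Longrightarrow> same_except M (set_reg s x v) s' \<longleftrightarrow> same_except M s s'"
  by (simp add: set_reg_def)

section \<open>One round of colour refinement as a program\<close>

text \<open>The program uses the arrays 0 (input), 15 and 2 (current and next colours of the vertices of the
  disjoint union of the two graphs; a colour is the number of a vertex of that colour), 3 (position
  of the adjacency row of a vertex in the input) and 4 (number of the first vertex in the component
  of a vertex), and the registers 5 (round), 6 and 7 (vertices), 8 (colour), 9 (neighbour),
  10 and 11 (counters), 12 (flag), 13 (number of vertices) and 14 (address, result).\<close>

definition Count :: "nat \<Rightarrow> nat \<Rightarrow> com" where
  "Count x y = Seq (Assign y (N 0) (N 0))
     (For 9 (Reg 0) (If (And (Less (N 0) (Cell 0 (Plus (Cell 3 (Reg x)) (Reg 9))))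
                             (Eq (Cell 15 (Plus (Cell 4 (Reg x)) (Reg 9))) (Reg 8)))
        (Assign y (N 0) (Plus (Reg y) (N 1))) Skip))"

definition cnt :: "memory \<Rightarrow> nat \<Rightarrow> nat \<Rightarrow> nat" where
  "cnt s u w = card {j. j < s 0 0 \<and> 0 < s 0 (s 3 u + j) \<and> s 15 (s 4 u + j) = w}"

lemma run_Count:
  assumes "x \<in> {6, 7}" "y \<in> {10, 11}"
  shows "\<exists>s'. run (Count x y) s (3 + s 0 0 * 4) s' \<and> same_except {9, y} s' s \<and> s' y 0 = cnt s (s x 0) (s 8 0)"
proof -
  let ?b = "And (Less (N 0) (Cell 0 (Plus (Cell 3 (Reg x)) (Reg 9))))
                             (Eq (Cell 15 (Plus (Cell 4 (Reg x)) (Reg 9))) (Reg 8))"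
  let ?B = "If ?b (Assign y (N 0) (Plus (Reg y) (N 1))) Skip"
  define Q where "Q = (\<lambda>j. 0 < s 0 (s 3 (s x 0) + j) \<and> s 15 (s 4 (s x 0) + j) = s 8 0)"
  define Inv where "Inv = (\<lambda>i s'. same_except {9, y} s' s \<and> s' y 0 = card {j. j < i \<and> Q j})"
  have "\<exists>s'. run (For 9 (Reg 0) ?B) (set_reg s y 0) (2 + s 0 0 * ((1 + 1) + 2)) s' \<and> Inv (s 0 0) s'"
  proof (rule run_For)
    show "aval (Reg 0) s' = s 0 0" if "Inv i s'" for i s'
      using that assms by (auto simp: Inv_def same_except_def)
    show "Inv i (set_reg s' 9 v)" if "Inv i s'" for i s' v
      using that assms by (auto simp: Inv_def)
    show "Inv 0 (set_reg s y 0)" by (simp add: Inv_def)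
    fix i s' assume i: "i < s 0 0" "Inv i s'" "s' 9 0 = i"
    have eqs: "s' 0 = s 0" "s' 15 = s 15" "s' 3 = s 3" "s' 4 = s 4" "s' 8 = s 8" "s' x = s x"
      using i(2) assms by (auto simp: Inv_def same_except_def)
    have set: "{j. j < Suc i \<and> Q j} = (if Q i then insert i {j. j < i \<and> Q j} else {j. j < i \<and> Q j})"
      by (auto simp: less_Suc_eq)
    let ?s = "if Q i then set_reg s' y (s' y 0 + 1) else s'"
    have "run ?B s' (1 + 1) ?s"
    proof (rule run_If)
      assume "bval ?b s'"
      then have "Q i" by (simp add: Q_def eqs i(3))
      then show "run (Assign y (N 0) (Plus (Reg y) (N 1))) s' 1 ?s"
        using run_Assign[of y "N 0" "Plus (Reg y) (N 1)" s'] by (simp add: set_reg_def)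
    next
      assume "\<not> bval ?b s'"
      then have "\<not> Q i" by (simp add: Q_def eqs i(3))
      then show "run Skip s' 1 ?s" using run_Skip by simp
    qed
    moreover have "Inv (Suc i) ?s"
      using i(2) unfolding Inv_def set by auto
    moreover have "?s 9 0 = i" using i(3) assms by auto
    ultimately show "\<exists>s''. run ?B s' (1 + 1) s'' \<and> Inv (Suc i) s'' \<and> s'' 9 0 = i" by blast
  qed
  then obtain s' where s': "run (For 9 (Reg 0) ?B) (set_reg s y 0) (2 + s 0 0 * ((1 + 1) + 2)) s'" "Inv (s 0 0) s'"
    by blast
  have "run (Assign y (N 0) (N 0)) s 1 (set_reg s y 0)"
    using run_Assign[of y "N 0" "N 0" s] by (simp add: set_reg_def)
  from run_Seq[OF this s'(1)] have "run (Count x y) s (3 + s 0 0 * 4) s'"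
    unfolding Count_def by (rule run_mono) simp
  then show ?thesis using s'(2) unfolding Inv_def cnt_def Q_def by blast
qed

lemma cnt_cong:
  assumes "same_except M s' s" "M \<inter> {0, 15, 3, 4} = {}"
  shows "cnt s' = cnt s"
proof -
  have "s' 0 = s 0" "s' 15 = s 15" "s' 3 = s 3" "s' 4 = s 4"
    using assms by (simp_all add: same_except_def)
  then show ?thesis unfolding cnt_def by simp
qed

text \<open>Decides whether the vertices in registers 6 and 7 receive equal refined colours. The
  flag starts as equality of the current colours, and the loop can only lower it.\<close>

definition Match :: com where
  "Match = Seq (If (Eq (Cell 15 (Reg 6)) (Cell 15 (Reg 7))) (Assign 12 (N 0) (N 1)) (Assign 12 (N 0) (N 0)))
     (For 8 (Reg 13) (Seq (Seq (Count 6 10) (Count 7 11)) (If (Eq (Reg 10) (Reg 11)) Skip (Assign 12 (N 0) (N 0)))))"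

definition matching :: "memory \<Rightarrow> nat \<Rightarrow> nat \<Rightarrow> bool" where
  "matching s u v \<longleftrightarrow> s 15 u = s 15 v \<and> (\<forall>w<s 13 0. cnt s u w = cnt s v w)"

lemma matching_cong:
  assumes "same_except M s' s" "M \<inter> {0, 15, 3, 4, 13} = {}"
  shows "matching s' = matching s"
proof -
  have "s' 15 = s 15" "s' 13 = s 13" using assms by (simp_all add: same_except_def)
  moreover have "cnt s' = cnt s" using assms(2) by (intro cnt_cong[OF assms(1)]) auto
  ultimately show ?thesis unfolding matching_def by simp
qed

lemma run_Match:
  "\<exists>s'. run Match s (4 + s 13 0 * (10 + s 0 0 * 8)) s' \<and> same_except {8, 9, 10, 11, 12} s' s
     \<and> s' 12 0 = (if matching s (s 6 0) (s 7 0) then 1 else 0)"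
proof -
  let ?B = "Seq (Seq (Count 6 10) (Count 7 11)) (If (Eq (Reg 10) (Reg 11)) Skip (Assign 12 (N 0) (N 0)))"
  let ?T = "(3 + s 0 0 * 4) + (3 + s 0 0 * 4) + (1 + 1)"
  let ?M = "{8, 9, 10, 11, 12}"
  define Inv where "Inv = (\<lambda>i s'. same_except ?M s' s
    \<and> s' 12 0 = (if s 15 (s 6 0) = s 15 (s 7 0) \<and> (\<forall>w<i. cnt s (s 6 0) w = cnt s (s 7 0) w) then 1 else 0))"
  let ?s0 = "set_reg s 12 (if s 15 (s 6 0) = s 15 (s 7 0) then 1 else 0)"
  have "\<exists>s'. run (For 8 (Reg 13) ?B) ?s0 (2 + s 13 0 * (?T + 2)) s' \<and> Inv (s 13 0) s'"
  proof (rule run_For)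
    show "aval (Reg 13) s' = s 13 0" if "Inv i s'" for i s'
      using that same_exceptD[of ?M s' s 13] by (simp add: Inv_def)
    show "Inv i (set_reg s' 8 v)" if "Inv i s'" for i s' v
      using that by (simp add: Inv_def)
    show "Inv 0 ?s0" by (simp add: Inv_def)
    fix i s' assume i: "i < s 13 0" "Inv i s'" "s' 8 0 = i"
    have same: "same_except ?M s' s" using i(2) by (simp add: Inv_def)
    have eqs: "s' 0 = s 0" "s' 6 = s 6" "s' 7 = s 7" using same by (simp_all add: same_except_def)
    obtain s1 where s1: "run (Count 6 10) s' (3 + s 0 0 * 4) s1" "same_except {9, 10} s1 s'"
      "s1 10 0 = cnt s' (s 6 0) i" using run_Count[of 6 10 s'] eqs i(3) by auto
    have eqs1: "s1 0 = s 0" "s1 7 = s 7" "s1 8 = s' 8" "s1 12 = s' 12"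
      using s1(2) eqs by (simp_all add: same_except_def)
    obtain s2 where s2: "run (Count 7 11) s1 (3 + s 0 0 * 4) s2" "same_except {9, 11} s2 s1"
      "s2 11 0 = cnt s1 (s 7 0) i" using run_Count[of 7 11 s1] eqs1 i(3) by auto
    have eqs2: "s2 8 = s' 8" "s2 12 = s' 12" "s2 10 = s1 10"
      using s2(2) eqs1 by (simp_all add: same_except_def)
    have same1: "same_except ?M s1 s" by (rule same_except_trans[OF s1(2) same]) simp
    have same2: "same_except ?M s2 s" by (rule same_except_trans[OF s2(2) same1]) simp
    have c: "s2 10 0 = cnt s (s 6 0) i" "s2 11 0 = cnt s (s 7 0) i"
      using s1(3) s2(3) eqs2 cnt_cong[OF same] cnt_cong[OF same1] by simp_all
    let ?s = "if cnt s (s 6 0) i = cnt s (s 7 0) i then s2 else set_reg s2 12 0"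
    have "run (If (Eq (Reg 10) (Reg 11)) Skip (Assign 12 (N 0) (N 0))) s2 (1 + 1) ?s"
    proof (rule run_If)
      assume "bval (Eq (Reg 10) (Reg 11)) s2"
      then show "run Skip s2 1 ?s" using run_Skip c by simp
    next
      assume "\<not> bval (Eq (Reg 10) (Reg 11)) s2"
      then show "run (Assign 12 (N 0) (N 0)) s2 1 ?s"
        using run_Assign[of 12 "N 0" "N 0" s2] c by (simp add: set_reg_def)
    qed
    then have "run ?B s' ?T ?s" using run_Seq[OF run_Seq[OF s1(1) s2(1)]] by blast
    moreover have "Inv (Suc i) ?s"
      using i(2) same2 eqs2 unfolding Inv_def by (auto simp: less_Suc_eq)
    moreover have "?s 8 0 = i" using eqs2 i(3) by simp
    ultimately show "\<exists>s''. run ?B s' ?T s'' \<and> Inv (Suc i) s'' \<and> s'' 8 0 = i" by blast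
  qed
  then obtain s' where s': "run (For 8 (Reg 13) ?B) ?s0 (2 + s 13 0 * (?T + 2)) s'" "Inv (s 13 0) s'" by blast
  have "run (If (Eq (Cell 15 (Reg 6)) (Cell 15 (Reg 7))) (Assign 12 (N 0) (N 1)) (Assign 12 (N 0) (N 0))) s (1 + 1) ?s0"
    by (rule run_If) (use run_Assign[of 12 "N 0" "N 1" s] run_Assign[of 12 "N 0" "N 0" s] in \<open>simp_all add: set_reg_def\<close>)
  from run_Seq[OF this s'(1)] have "run Match s (4 + s 13 0 * (10 + s 0 0 * 8)) s'"
    unfolding Match_def by (rule run_mono) (simp add: algebra_simps)
  then show ?thesis using s'(2) unfolding Inv_def matching_def by blast
qed

text \<open>The content of a cell with old content \<open>d\<close> after a loop that overwrites it
  with the index whenever \<open>P\<close> holds.\<close>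

fun last_below :: "(nat \<Rightarrow> bool) \<Rightarrow> nat \<Rightarrow> nat \<Rightarrow> nat" where
  "last_below P d 0 = d"
| "last_below P d (Suc k) = (if P k then k else last_below P d k)"

lemma last_below_eq_Max:
  assumes "v < k" "P v"
  shows "last_below P d k = Max {v. v < k \<and> P v}"
  using assms(1)
proof (induction k)
  case (Suc k)
  show ?case
  proof (cases "P k")
    case True
    have "Max {v. v < Suc k \<and> P v} = k"
      by (rule Max_eqI) (use True in \<open>auto simp: less_Suc_eq_le\<close>)
    then show ?thesis using True by simp
  next
    case False
    then have "{v. v < Suc k \<and> P v} = {v. v < k \<and> P v}"
      using less_Suc_eq by metis
    moreover have "v < k" using Suc.prems assms(2) False by (metis less_SucE)
    ultimately show ?thesis using Suc.IH False by simp
  qed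
qed simp

text \<open>The new colour of a vertex is the largest vertex matching it, a canonical representative
  of its new class.\<close>

definition Next_colour :: com where
  "Next_colour = For 7 (Reg 13) (Seq Match (If (Less (N 0) (Reg 12)) (Assign 2 (Reg 6) (Reg 7)) Skip))"

lemma run_Next_colour:
  "\<exists>s'. run Next_colour s (2 + s 13 0 * (8 + s 13 0 * (10 + s 0 0 * 8))) s'
     \<and> same_except {2, 7, 8, 9, 10, 11, 12} s' s
     \<and> (\<forall>a. s' 2 a = (if a = s 6 0 then last_below (matching s (s 6 0)) (s 2 a) (s 13 0) else s 2 a))"
proof -
  let ?B = "Seq Match (If (Less (N 0) (Reg 12)) (Assign 2 (Reg 6) (Reg 7)) Skip)"
  let ?T = "(4 + s 13 0 * (10 + s 0 0 * 8)) + (1 + 1)"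
  let ?M = "{2, 7, 8, 9, 10, 11, 12}"
  define Inv where "Inv = (\<lambda>i s'. same_except ?M s' s
    \<and> (\<forall>a. s' 2 a = (if a = s 6 0 then last_below (matching s (s 6 0)) (s 2 a) i else s 2 a)))"
  have "\<exists>s'. run (For 7 (Reg 13) ?B) s (2 + s 13 0 * (?T + 2)) s' \<and> Inv (s 13 0) s'"
  proof (rule run_For)
    show "aval (Reg 13) s' = s 13 0" if "Inv i s'" for i s'
      using that same_exceptD[of ?M s' s 13] by (simp add: Inv_def)
    show "Inv i (set_reg s' 7 v)" if "Inv i s'" for i s' v
      using that by (simp add: Inv_def)
    show "Inv 0 s" by (simp add: Inv_def)
    fix i s' assume i: "i < s 13 0" "Inv i s'" "s' 7 0 = i"
    have same: "same_except ?M s' s" using i(2) by (simp add: Inv_def)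
    have eqs: "s' 0 = s 0" "s' 6 = s 6" "s' 13 = s 13" "s' 15 = s 15" "s' 3 = s 3" "s' 4 = s 4"
      using same by (simp_all add: same_except_def)
    have mat: "matching s' = matching s"
      by (rule matching_cong[OF same]) simp
    obtain s1 where s1: "run Match s' (4 + s 13 0 * (10 + s 0 0 * 8)) s1" "same_except {8, 9, 10, 11, 12} s1 s'"
      "s1 12 0 = (if matching s (s 6 0) i then 1 else 0)"
      using run_Match[of s'] eqs i(3) mat by auto
    have eqs1: "s1 2 = s' 2" "s1 6 = s 6" "s1 7 = s' 7" using s1(2) eqs by (simp_all add: same_except_def)
    have same1: "same_except ?M s1 s" by (rule same_except_trans[OF s1(2) same]) simp
    let ?s = "if matching s (s 6 0) i then s1(2 := (s1 2)(s 6 0 := i)) else s1"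
    have "run (If (Less (N 0) (Reg 12)) (Assign 2 (Reg 6) (Reg 7)) Skip) s1 (1 + 1) ?s"
    proof (rule run_If)
      assume "bval (Less (N 0) (Reg 12)) s1"
      then show "run (Assign 2 (Reg 6) (Reg 7)) s1 1 ?s"
        using run_Assign[of 2 "Reg 6" "Reg 7" s1] s1(3) eqs1 i(3) by (simp split: if_splits)
    next
      assume "\<not> bval (Less (N 0) (Reg 12)) s1"
      then show "run Skip s1 1 ?s" using run_Skip s1(3) by (simp split: if_splits)
    qed
    then have "run ?B s' ?T ?s" using run_Seq[OF s1(1)] by blast
    moreover have "Inv (Suc i) ?s"
      using i(2) same1 eqs1 unfolding Inv_def by simp
    moreover have "?s 7 0 = i" using eqs1 i(3) by simp
    ultimately show "\<exists>s''. run ?B s' ?T s'' \<and> Inv (Suc i) s'' \<and> s'' 7 0 = i" by blast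
  qed
  then obtain s' where "run (For 7 (Reg 13) ?B) s (2 + s 13 0 * (?T + 2)) s'" "Inv (s 13 0) s'" by blast
  then show ?thesis unfolding Next_colour_def Inv_def
    by (intro exI[of _ s'] conjI) (auto elim: run_mono)
qed

text \<open>New colours are collected in array 2 and copied only afterwards, because the comparisons
  still read the old colours in array 15.\<close>

definition Round :: com where
  "Round = Seq (For 6 (Reg 13) Next_colour) (For 6 (Reg 13) (Assign 15 (Reg 6) (Cell 2 (Reg 6))))"

lemma run_Round:
  "\<exists>s'. run Round s (4 + s 13 0 * (7 + s 13 0 * (8 + s 13 0 * (10 + s 0 0 * 8)))) s'
     \<and> same_except {15, 2, 6, 7, 8, 9, 10, 11, 12} s' s
     \<and> (\<forall>u<s 13 0. s' 15 u = last_below (matching s u) (s 2 u) (s 13 0))"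
proof -
  let ?T = "2 + s 13 0 * (8 + s 13 0 * (10 + s 0 0 * 8))"
  let ?M = "{2, 6, 7, 8, 9, 10, 11, 12}"
  define new where "new = (\<lambda>u. last_below (matching s u) (s 2 u) (s 13 0))"
  define Inv where "Inv = (\<lambda>i s'. same_except ?M s' s \<and> (\<forall>u. s' 2 u = (if u < i then new u else s 2 u)))"
  have "\<exists>s'. run (For 6 (Reg 13) Next_colour) s (2 + s 13 0 * (?T + 2)) s' \<and> Inv (s 13 0) s'"
  proof (rule run_For)
    show "aval (Reg 13) s' = s 13 0" if "Inv i s'" for i s'
      using that same_exceptD[of ?M s' s 13] by (simp add: Inv_def)
    show "Inv i (set_reg s' 6 v)" if "Inv i s'" for i s' v
      using that by (simp add: Inv_def)
    show "Inv 0 s" by (simp add: Inv_def)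
    fix i s' assume i: "i < s 13 0" "Inv i s'" "s' 6 0 = i"
    have same: "same_except ?M s' s" using i(2) by (simp add: Inv_def)
    have eqs: "s' 0 = s 0" "s' 13 = s 13" using same by (simp_all add: same_except_def)
    have mat: "matching s' = matching s" by (rule matching_cong[OF same]) simp
    obtain s1 where s1: "run Next_colour s' ?T s1" "same_except {2, 7, 8, 9, 10, 11, 12} s1 s'"
      "\<forall>a. s1 2 a = (if a = i then last_below (matching s i) (s' 2 a) (s 13 0) else s' 2 a)"
      using run_Next_colour[of s'] eqs i(3) mat by auto
    have "same_except ?M s1 s" by (rule same_except_trans[OF s1(2) same]) simp
    moreover have "\<forall>u. s1 2 u = (if u < Suc i then new u else s 2 u)"
      using i(2) s1(3) by (auto simp: Inv_def new_def)
    moreover have "s1 6 0 = i" using s1(2) i(3) by (simp add: same_except_def)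
    ultimately show "\<exists>s''. run Next_colour s' ?T s'' \<and> Inv (Suc i) s'' \<and> s'' 6 0 = i"
      using s1(1) unfolding Inv_def by blast
  qed
  then obtain s1 where s1: "run (For 6 (Reg 13) Next_colour) s (2 + s 13 0 * (?T + 2)) s1" "Inv (s 13 0) s1" by blast
  let ?M' = "{15, 2, 6, 7, 8, 9, 10, 11, 12}"
  define Inv' where "Inv' = (\<lambda>i s'. same_except ?M' s' s \<and> (\<forall>u. s' 2 u = s1 2 u) \<and> (\<forall>u<i. s' 15 u = s1 2 u))"
  have "\<exists>s'. run (For 6 (Reg 13) (Assign 15 (Reg 6) (Cell 2 (Reg 6)))) s1 (2 + s 13 0 * (1 + 2)) s' \<and> Inv' (s 13 0) s'"
  proof (rule run_For)
    show "aval (Reg 13) s' = s 13 0" if "Inv' i s'" for i s'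
      using that same_exceptD[of ?M' s' s 13] by (simp add: Inv'_def)
    show "Inv' i (set_reg s' 6 v)" if "Inv' i s'" for i s' v
      using that by (simp add: Inv'_def)
    show "Inv' 0 s1" using s1(2) by (auto simp: Inv'_def Inv_def same_except_def)
    fix i s' assume i: "i < s 13 0" "Inv' i s'" "s' 6 0 = i"
    have "run (Assign 15 (Reg 6) (Cell 2 (Reg 6))) s' 1 (s'(15 := (s' 15)(i := s1 2 i)))"
      using run_Assign[of 15 "Reg 6" "Cell 2 (Reg 6)" s'] i(2,3) by (simp add: Inv'_def)
    moreover have "Inv' (Suc i) (s'(15 := (s' 15)(i := s1 2 i)))"
      using i(2) by (auto simp: Inv'_def less_Suc_eq)
    ultimately show "\<exists>s''. run (Assign 15 (Reg 6) (Cell 2 (Reg 6))) s' 1 s'' \<and> Inv' (Suc i) s'' \<and> s'' 6 0 = i"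
      using i(3) by (intro exI[of _ "s'(15 := (s' 15)(i := s1 2 i))"]) simp
  qed
  then obtain s2 where s2: "run (For 6 (Reg 13) (Assign 15 (Reg 6) (Cell 2 (Reg 6)))) s1 (2 + s 13 0 * (1 + 2)) s2"
    "Inv' (s 13 0) s2" by blast
  have "run Round s (4 + s 13 0 * (7 + s 13 0 * (8 + s 13 0 * (10 + s 0 0 * 8)))) s2"
    unfolding Round_def by (rule run_mono[OF run_Seq[OF s1(1) s2(1)]]) (simp add: algebra_simps)
  then show ?thesis
    using s2(2) s1(2) by (intro exI[of _ s2]) (auto simp: Inv'_def Inv_def new_def)
qed

section \<open>Correctness of the isomorphism test\<close>

text \<open>The row starts are accumulated in register 14, beginning at 2 because the input starts
  with the two numbers of vertices. A single step length suffices, since the test runs this only for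
  equal numbers of vertices.\<close>

definition Init :: com where
  "Init = Seq (Assign 13 (N 0) (Plus (Reg 0) (Reg 0))) (Seq (Assign 14 (N 0) (N 2))
     (For 6 (Reg 13) (Seq (Seq (Assign 3 (Reg 6) (Reg 14)) (Assign 14 (N 0) (Plus (Reg 14) (Reg 0))))
        (If (Less (Reg 6) (Reg 0)) (Assign 4 (Reg 6) (N 0)) (Assign 4 (Reg 6) (Reg 0))))))"

lemma run_Init:
  assumes "s 0 0 = n"
  shows "\<exists>s'. run Init s (4 + 2 * n * 6) s' \<and> same_except {3, 4, 6, 13, 14} s' s \<and> s' 13 0 = 2 * n
    \<and> (\<forall>u<2 * n. s' 3 u = 2 + u * n \<and> s' 4 u = (if u < n then 0 else n))"
proof -
  let ?B = "Seq (Seq (Assign 3 (Reg 6) (Reg 14)) (Assign 14 (N 0) (Plus (Reg 14) (Reg 0))))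
        (If (Less (Reg 6) (Reg 0)) (Assign 4 (Reg 6) (N 0)) (Assign 4 (Reg 6) (Reg 0)))"
  let ?M = "{3, 4, 6, 13, 14}"
  let ?s1 = "set_reg s 13 (2 * n)"
  let ?s2 = "set_reg ?s1 14 2"
  define Inv where "Inv = (\<lambda>i s'. same_except ?M s' s \<and> s' 13 0 = 2 * n \<and> s' 14 0 = 2 + i * n
    \<and> (\<forall>u<i. s' 3 u = 2 + u * n \<and> s' 4 u = (if u < n then 0 else n)))"
  have 1: "run (Assign 13 (N 0) (Plus (Reg 0) (Reg 0))) s 1 ?s1"
    using run_Assign[of 13 "N 0" "Plus (Reg 0) (Reg 0)" s] assms by (simp add: set_reg_def mult_2)
  have 2: "run (Assign 14 (N 0) (N 2)) ?s1 1 ?s2"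
    using run_Assign[of 14 "N 0" "N 2" ?s1] by (simp add: set_reg_def)
  have "\<exists>s'. run (For 6 (Reg 13) ?B) ?s2 (2 + 2 * n * (((1 + 1) + (1 + 1)) + 2)) s' \<and> Inv (2 * n) s'"
  proof (rule run_For)
    show "aval (Reg 13) s' = 2 * n" if "Inv i s'" for i s' using that by (simp add: Inv_def)
    show "Inv i (set_reg s' 6 v)" if "Inv i s'" for i s' v using that by (simp add: Inv_def)
    show "Inv 0 ?s2" by (simp add: Inv_def)
    fix i s' assume i: "i < 2 * n" "Inv i s'" "s' 6 0 = i"
    have n: "s' 0 0 = n" using i(2) assms by (simp add: Inv_def same_except_def)
    let ?t1 = "s'(3 := (s' 3)(i := 2 + i * n))"
    let ?t2 = "set_reg ?t1 14 (2 + Suc i * n)"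
    let ?t3 = "?t2(4 := (?t2 4)(i := if i < n then 0 else n))"
    have "run (Assign 3 (Reg 6) (Reg 14)) s' 1 ?t1"
      using run_Assign[of 3 "Reg 6" "Reg 14" s'] i(2,3) by (simp add: Inv_def)
    moreover have "run (Assign 14 (N 0) (Plus (Reg 14) (Reg 0))) ?t1 1 ?t2"
      using run_Assign[of 14 "N 0" "Plus (Reg 14) (Reg 0)" ?t1] i(2) n
      by (simp add: Inv_def set_reg_def add.commute add.left_commute)
    moreover have "run (If (Less (Reg 6) (Reg 0)) (Assign 4 (Reg 6) (N 0)) (Assign 4 (Reg 6) (Reg 0))) ?t2 (1 + 1) ?t3"
      by (rule run_If)
        (use run_Assign[of 4 "Reg 6" "N 0" ?t2] run_Assign[of 4 "Reg 6" "Reg 0" ?t2] i(3) n in simp_all)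
    ultimately have "run ?B s' ((1 + 1) + (1 + 1)) ?t3" by (intro run_Seq)
    moreover have "Inv (Suc i) ?t3"
      using i(2) by (auto simp: Inv_def less_Suc_eq)
    moreover have "?t3 6 0 = i" using i(3) by simp
    ultimately show "\<exists>s''. run ?B s' ((1 + 1) + (1 + 1)) s'' \<and> Inv (Suc i) s'' \<and> s'' 6 0 = i" by blast
  qed
  then obtain s' where s': "run (For 6 (Reg 13) ?B) ?s2 (2 + 2 * n * (((1 + 1) + (1 + 1)) + 2)) s'" "Inv (2 * n) s'"
    by blast
  have "run Init s (4 + 2 * n * 6) s'"
    unfolding Init_def by (rule run_mono[OF run_Seq[OF 1 run_Seq[OF 2 s'(1)]]]) simp
  then show ?thesis using s'(2) unfolding Inv_def by blast
qed

text \<open>Register 14 becomes 0 as soon as some vertex of the first graph has no partner of its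
  colour in the second. Cell 0 of array 0 is the loop limit, so the answer is written there only at
  the end.\<close>

definition Final :: com where
  "Final = Seq (Seq (Assign 14 (N 0) (N 1)) (For 6 (Reg 0)
     (Seq (Seq (Assign 12 (N 0) (N 0))
            (For 7 (Reg 0) (If (Eq (Cell 15 (Reg 6)) (Cell 15 (Plus (Reg 7) (Reg 0)))) (Assign 12 (N 0) (N 1)) Skip)))
          (If (Less (N 0) (Reg 12)) Skip (Assign 14 (N 0) (N 0))))))
     (Assign 0 (N 0) (Reg 14))"

lemma run_Final:
  assumes "s 0 0 = n"
  shows "\<exists>s'. run Final s (4 + n * (7 + n * 4)) s'
    \<and> s' 0 0 = (if \<forall>u<n. \<exists>v<n. s 15 u = s 15 (v + n) then 1 else 0)"
proof -
  let ?B = "If (Eq (Cell 15 (Reg 6)) (Cell 15 (Plus (Reg 7) (Reg 0)))) (Assign 12 (N 0) (N 1)) Skip"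
  let ?C = "Seq (Seq (Assign 12 (N 0) (N 0)) (For 7 (Reg 0) ?B)) (If (Less (N 0) (Reg 12)) Skip (Assign 14 (N 0) (N 0)))"
  let ?T = "(1 + (2 + n * ((1 + 1) + 2))) + (1 + 1)"
  have inner: "\<exists>s'. run (For 7 (Reg 0) ?B) (set_reg t 12 0) (2 + n * ((1 + 1) + 2)) s'
      \<and> same_except {7, 12} s' t \<and> s' 12 0 = (if \<exists>v<n. t 15 (t 6 0) = t 15 (v + n) then 1 else 0)"
    if n: "t 0 0 = n" for t
  proof -
    define Inv where "Inv = (\<lambda>i s'. same_except {7, 12} s' t
      \<and> s' 12 0 = (if \<exists>v<i. t 15 (t 6 0) = t 15 (v + n) then 1 else 0))"
    have "\<exists>s'. run (For 7 (Reg 0) ?B) (set_reg t 12 0) (2 + n * ((1 + 1) + 2)) s' \<and> Inv n s'"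
    proof (rule run_For)
      show "aval (Reg 0) s' = n" if "Inv i s'" for i s' using that n by (simp add: Inv_def same_except_def)
      show "Inv i (set_reg s' 7 v)" if "Inv i s'" for i s' v using that by (simp add: Inv_def)
      show "Inv 0 (set_reg t 12 0)" by (simp add: Inv_def)
      fix i s' assume i: "i < n" "Inv i s'" "s' 7 0 = i"
      have eqs: "s' 0 = t 0" "s' 6 = t 6" "s' 15 = t 15" using i(2) by (simp_all add: Inv_def same_except_def)
      let ?s = "if t 15 (t 6 0) = t 15 (i + n) then set_reg s' 12 1 else s'"
      have "run ?B s' (1 + 1) ?s"
        by (rule run_If)
          (use run_Assign[of 12 "N 0" "N 1" s'] run_Skip[of s'] eqs i(3) n in \<open>simp_all add: set_reg_def\<close>)
      moreover have "Inv (Suc i) ?s" using i(2) by (auto simp: Inv_def less_Suc_eq)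
      moreover have "?s 7 0 = i" using i(3) by simp
      ultimately show "\<exists>s''. run ?B s' (1 + 1) s'' \<and> Inv (Suc i) s'' \<and> s'' 7 0 = i" by blast
    qed
    then show ?thesis unfolding Inv_def by blast
  qed
  define Inv where "Inv = (\<lambda>i s'. same_except {6, 7, 12, 14} s' s
      \<and> s' 14 0 = (if \<forall>u<i. \<exists>v<n. s 15 u = s 15 (v + n) then 1 else 0))"
  have "\<exists>s'. run (For 6 (Reg 0) ?C) (set_reg s 14 1) (2 + n * (?T + 2)) s' \<and> Inv n s'"
  proof (rule run_For)
    show "aval (Reg 0) s' = n" if "Inv i s'" for i s' using that assms by (simp add: Inv_def same_except_def)
    show "Inv i (set_reg s' 6 v)" if "Inv i s'" for i s' v using that by (simp add: Inv_def)
    show "Inv 0 (set_reg s 14 1)" by (simp add: Inv_def)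
    fix i s' assume i: "i < n" "Inv i s'" "s' 6 0 = i"
    have same: "same_except {6, 7, 12, 14} s' s" using i(2) by (simp add: Inv_def)
    have eqs: "s' 0 0 = n" "s' 15 = s 15" using same assms by (simp_all add: same_except_def)
    obtain s1 where s1: "run (For 7 (Reg 0) ?B) (set_reg s' 12 0) (2 + n * ((1 + 1) + 2)) s1"
      "same_except {7, 12} s1 s'" "s1 12 0 = (if \<exists>v<n. s 15 i = s 15 (v + n) then 1 else 0)"
      using inner[of s', OF eqs(1), unfolded eqs(2) i(3)] by blast
    have same1: "same_except {6, 7, 12, 14} s1 s" by (rule same_except_trans[OF s1(2) same]) simp
    have s1_eqs: "s1 14 = s' 14" "s1 6 = s' 6" using s1(2) by (simp_all add: same_except_def)
    have 1: "run (Assign 12 (N 0) (N 0)) s' 1 (set_reg s' 12 0)"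
      using run_Assign[of 12 "N 0" "N 0" s'] by (simp add: set_reg_def)
    define A where "A u \<longleftrightarrow> (\<exists>v<n. s 15 u = s 15 (v + n))" for u
    let ?s = "if A i then s1 else set_reg s1 14 0"
    have flag: "s1 12 0 = (if A i then 1 else 0)" unfolding A_def by (rule s1(3))
    have 2: "run (If (Less (N 0) (Reg 12)) Skip (Assign 14 (N 0) (N 0))) s1 (1 + 1) ?s"
    proof (rule run_If)
      assume "bval (Less (N 0) (Reg 12)) s1"
      then have "A i" using flag by (simp split: if_splits)
      then show "run Skip s1 1 ?s" using run_Skip[of s1] by simp
    next
      assume "\<not> bval (Less (N 0) (Reg 12)) s1"
      then have "\<not> A i" using flag by (simp split: if_splits)
      then show "run (Assign 14 (N 0) (N 0)) s1 1 ?s"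
        using run_Assign[of 14 "N 0" "N 0" s1] by (simp add: set_reg_def)
    qed
    have "run ?C s' ?T ?s" by (rule run_Seq[OF run_Seq[OF 1 s1(1)] 2])
    moreover have "Inv (Suc i) ?s"
    proof -
      have "same_except {6, 7, 12, 14} ?s s" using same1 by simp
      moreover have "?s 14 0 = (if \<forall>u<Suc i. A u then 1 else 0)"
      proof -
        have "s' 14 0 = (if \<forall>u<i. A u then 1 else 0)" using i(2) by (simp only: Inv_def A_def)
        then show ?thesis using s1_eqs(1) by (auto simp: less_Suc_eq)
      qed
      ultimately show ?thesis unfolding Inv_def A_def by blast
    qed
    moreover have "?s 6 0 = i" using i(3) s1_eqs(2) by simp
    ultimately show "\<exists>s''. run ?C s' ?T s'' \<and> Inv (Suc i) s'' \<and> s'' 6 0 = i" by blast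
  qed
  then obtain s' where s': "run (For 6 (Reg 0) ?C) (set_reg s 14 1) (2 + n * (?T + 2)) s'" "Inv n s'" by blast
  have 1: "run (Assign 14 (N 0) (N 1)) s 1 (set_reg s 14 1)"
    using run_Assign[of 14 "N 0" "N 1" s] by (simp add: set_reg_def)
  have 2: "run (Assign 0 (N 0) (Reg 14)) s' 1 (set_reg s' 0 (s' 14 0))"
    using run_Assign[of 0 "N 0" "Reg 14" s'] by (simp add: set_reg_def)
  have "run Final s (4 + n * (7 + n * 4)) (set_reg s' 0 (s' 14 0))"
    unfolding Final_def by (rule run_mono[OF run_Seq[OF run_Seq[OF 1 s'(1)] 2]]) (simp add: algebra_simps)
  then show ?thesis using s'(2) unfolding Inv_def by (intro exI[of _ "set_reg s' 0 (s' 14 0)"]) simp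
qed

section \<open>Colour refinement of two graphs in parallel\<close>

lemma iterated_Suc:
  "iterated E (Suc t) v = Refined (iterated E t v) (image_mset (iterated E t) (mset_set (neighbours E v)))"
  by (subst funpow.simps, subst comp_apply, rule refine_def)

lemma refine_eq_refine_iff:
  assumes "finite (neighbours E u)" "finite (neighbours F v)"
  shows "refine E c u = refine F d v \<longleftrightarrow>
    c u = d v \<and> (\<forall>\<omega>. card {w \<in> neighbours E u. c w = \<omega>} = card {w \<in> neighbours F v. d w = \<omega>})"
proof -
  have "count (image_mset c (mset_set (neighbours E u))) \<omega> = card {w \<in> neighbours E u. c w = \<omega>}"
    "count (image_mset d (mset_set (neighbours F v))) \<omega> = card {w \<in> neighbours F v. d w = \<omega>}" for \<omega>
    using assms by (simp_all add: count_image_mset vimage_def Int_def conj_commute)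
  then show ?thesis by (simp add: refine_def multiset_eq_iff)
qed

context
  fixes n :: nat and E F :: "nat set set"
  assumes E: "E \<subseteq> all_edges n" and F: "F \<subseteq> all_edges n"
begin

text \<open>The disjoint union of \<open>E\<close> and \<open>F\<close> has the vertices \<open>{..<2 * n}\<close>: vertex \<open>x\<close> of \<open>E\<close> becomes
  \<open>x - 1\<close> and vertex \<open>x\<close> of \<open>F\<close> becomes \<open>n + (x - 1)\<close>.\<close>

definition col :: "nat \<Rightarrow> nat \<Rightarrow> unit colour" where
  "col t u = (if u < n then iterated E t (u + 1) else iterated F t (u - n + 1))"

definition adj :: "nat \<Rightarrow> nat \<Rightarrow> bool" where
  "adj u j = (if u < n then {u + 1, j + 1} \<in> E else {u - n + 1, j + 1} \<in> F)"

definition offset :: "nat \<Rightarrow> nat" where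
  "offset u = (if u < n then 0 else n)"

text \<open>The numbers in array 15 need not be the colours; they only have to be equal exactly when
  the colours are. The bound \<open>2 * n\<close> ensures that the loop of \<open>Match\<close> over
  all numbers below it meets every colour in use.\<close>

definition represents :: "memory \<Rightarrow> nat \<Rightarrow> bool" where
  "represents s t \<longleftrightarrow> s 0 0 = n \<and> s 13 0 = 2 * n
     \<and> (\<forall>u<2 * n. s 4 u = offset u \<and> (\<forall>j<n. 0 < s 0 (s 3 u + j) \<longleftrightarrow> adj u j))
     \<and> (\<forall>u<2 * n. s 15 u < 2 * n) \<and> (\<forall>u<2 * n. \<forall>v<2 * n. s 15 u = s 15 v \<longleftrightarrow> col t u = col t v)"

definition col_cnt :: "nat \<Rightarrow> nat \<Rightarrow> unit colour \<Rightarrow> nat" where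
  "col_cnt t u \<omega> = card {j. j < n \<and> adj u j \<and> col t (offset u + j) = \<omega>}"

lemma card_neighbours_of_colour:
  assumes "H \<subseteq> all_edges n"
  shows "card {w \<in> neighbours H x. c w = \<omega>} = card {j. j < n \<and> {x, j + 1} \<in> H \<and> c (j + 1) = \<omega>}"
proof -
  have "{w \<in> neighbours H x. c w = \<omega>} = Suc ` {j. j < n \<and> {x, j + 1} \<in> H \<and> c (j + 1) = \<omega>}"
  proof (intro equalityI subsetI)
    fix w assume w: "w \<in> {w \<in> neighbours H x. c w = \<omega>}"
    then have "w \<in> {1..n}" using neighbours_subset[OF assms, of x] by blast
    then have "w = Suc (w - 1)" "w - 1 < n" by auto
    moreover have "{x, w - 1 + 1} \<in> H" "c (w - 1 + 1) = \<omega>"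
      using w \<open>w = Suc (w - 1)\<close> by (auto simp: neighbours_def)
    ultimately show "w \<in> Suc ` {j. j < n \<and> {x, j + 1} \<in> H \<and> c (j + 1) = \<omega>}" by blast
  qed (auto simp: neighbours_def)
  then show ?thesis by (simp add: card_image)
qed

lemma col_Suc_eq_iff:
  assumes "u < 2 * n" "v < 2 * n"
  shows "col (Suc t) u = col (Suc t) v \<longleftrightarrow> col t u = col t v \<and> (\<forall>\<omega>. col_cnt t u \<omega> = col_cnt t v \<omega>)"
proof -
  define H where "H = (\<lambda>z. if z < n then E else F)"
  define nd where "nd = (\<lambda>z. if z < n then z + 1 else z - n + 1)"
  have H: "H z \<subseteq> all_edges n" for z using E F by (simp add: H_def)
  have col: "col t z = iterated (H z) t (nd z)" for t z by (simp add: col_def H_def nd_def)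
  have cnt: "card {w \<in> neighbours (H z) (nd z). iterated (H z) t w = \<omega>} = col_cnt t z \<omega>" for z \<omega>
    unfolding card_neighbours_of_colour[OF H] col_cnt_def
    by (intro arg_cong[where f = card]) (auto simp: H_def nd_def adj_def offset_def col_def)
  have "col (Suc t) u = col (Suc t) v \<longleftrightarrow>
      refine (H u) (iterated (H u) t) (nd u) = refine (H v) (iterated (H v) t) (nd v)"
    by (simp add: col)
  then show ?thesis
    unfolding refine_eq_refine_iff[OF finite_neighbours[OF H] finite_neighbours[OF H]] cnt col .
qed

lemma cnt_eq_col_cnt:
  assumes "represents s t" "z < 2 * n" "u < 2 * n"
  shows "cnt s u (s 15 z) = col_cnt t u (col t z)"
proof -
  have "s 15 (offset u + j) = s 15 z \<longleftrightarrow> col t (offset u + j) = col t z" if "j < n" for j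
  proof -
    have "offset u + j < 2 * n" using that by (simp add: offset_def)
    then show ?thesis using assms(1,2) by (simp add: represents_def)
  qed
  then show ?thesis
    using assms unfolding cnt_def col_cnt_def represents_def
    by (intro arg_cong[where f = card] Collect_cong) auto
qed

text \<open>Numbers and colours in use correspond to each other. A colour that does not occur, or a
  number not in use, is counted 0 times on both sides.\<close>

lemma matching_iff:
  assumes s: "represents s t" and uv: "u < 2 * n" "v < 2 * n"
  shows "matching s u v \<longleftrightarrow> col (Suc t) u = col (Suc t) v"
proof -
  have "(\<forall>w<2 * n. cnt s u w = cnt s v w) \<longleftrightarrow> (\<forall>\<omega>. col_cnt t u \<omega> = col_cnt t v \<omega>)"
  proof (intro iffI allI impI)
    fix \<omega> assume *: "\<forall>w<2 * n. cnt s u w = cnt s v w"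
    show "col_cnt t u \<omega> = col_cnt t v \<omega>"
    proof (cases "\<exists>z<2 * n. col t z = \<omega>")
      case True
      then obtain z where z: "z < 2 * n" "col t z = \<omega>" by blast
      then have "s 15 z < 2 * n" using s by (simp add: represents_def)
      then show ?thesis using * cnt_eq_col_cnt[OF s z(1)] uv z(2) by metis
    next
      case False
      have "col_cnt t x \<omega> = 0" for x
      proof -
        have "offset x + j < 2 * n" if "j < n" for j using that by (simp add: offset_def)
        then have "{j. j < n \<and> adj x j \<and> col t (offset x + j) = \<omega>} = {}" using False by auto
        then show ?thesis unfolding col_cnt_def by (simp only: card.empty)
      qed
      then show ?thesis by simp
    qed
  next
    fix w assume *: "\<forall>\<omega>. col_cnt t u \<omega> = col_cnt t v \<omega>" and "w < 2 * n"
    show "cnt s u w = cnt s v w"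
    proof (cases "\<exists>z<2 * n. s 15 z = w")
      case True
      then obtain z where z: "z < 2 * n" "s 15 z = w" by blast
      then show ?thesis using * cnt_eq_col_cnt[OF s z(1)] uv by metis
    next
      case False
      have "cnt s x w = 0" if x: "x < 2 * n" for x
      proof -
        have "s 4 x + j < 2 * n" if "j < n" for j using that s x by (simp add: represents_def offset_def)
        then have "{j. j < s 0 0 \<and> 0 < s 0 (s 3 x + j) \<and> s 15 (s 4 x + j) = w} = {}"
          using False s by (auto simp: represents_def)
        then show ?thesis unfolding cnt_def by (simp only: card.empty)
      qed
      then show ?thesis using uv by simp
    qed
  qed
  moreover have "s 15 u = s 15 v \<longleftrightarrow> col t u = col t v" "s 13 0 = 2 * n"
    using s uv by (simp_all add: represents_def)
  ultimately show ?thesis unfolding matching_def col_Suc_eq_iff[OF uv] by simp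
qed

abbreviation round_time :: nat where
  "round_time \<equiv> 4 + 2 * n * (7 + 2 * n * (8 + 2 * n * (10 + n * 8)))"

text \<open>The maximum of a new class lies in this class. So it determines the class, and it
  depends on nothing else.\<close>

lemma run_Round_represents:
  assumes s: "represents s t"
  shows "\<exists>s'. run Round s round_time s' \<and> represents s' (Suc t) \<and> s' 5 = s 5"
proof -
  have n: "s 0 0 = n" "s 13 0 = 2 * n" using s by (simp_all add: represents_def)
  obtain s' where s': "run Round s round_time s'" "same_except {15, 2, 6, 7, 8, 9, 10, 11, 12} s' s"
    "\<forall>u<2 * n. s' 15 u = last_below (matching s u) (s 2 u) (2 * n)"
    using run_Round[of s] n by auto
  have new: "s' 15 u = Max {v. v < 2 * n \<and> col (Suc t) u = col (Suc t) v}" if u: "u < 2 * n" for u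
  proof -
    have "matching s u u" by (simp add: matching_def)
    then have "s' 15 u = Max {v. v < 2 * n \<and> matching s u v}"
      using s'(3) u last_below_eq_Max[of u "2 * n" "matching s u"] by simp
    also have "{v. v < 2 * n \<and> matching s u v} = {v. v < 2 * n \<and> col (Suc t) u = col (Suc t) v}"
      using matching_iff[OF s u] by blast
    finally show ?thesis .
  qed
  have new_in: "s' 15 u < 2 * n \<and> col (Suc t) u = col (Suc t) (s' 15 u)" if u: "u < 2 * n" for u
  proof -
    have "Max {v. v < 2 * n \<and> col (Suc t) u = col (Suc t) v} \<in> {v. v < 2 * n \<and> col (Suc t) u = col (Suc t) v}"
      by (rule Max_in) (use u in auto)
    then show ?thesis unfolding new[OF u, symmetric] by blast
  qed
  have eqs: "s' 0 = s 0" "s' 13 = s 13" "s' 3 = s 3" "s' 4 = s 4" "s' 5 = s 5"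
    using s'(2) by (simp_all add: same_except_def)
  have "s' 15 u = s' 15 v \<longleftrightarrow> col (Suc t) u = col (Suc t) v" if "u < 2 * n" "v < 2 * n" for u v
  proof
    assume "s' 15 u = s' 15 v"
    then show "col (Suc t) u = col (Suc t) v" using new_in[OF that(1)] new_in[OF that(2)] by simp
  next
    assume "col (Suc t) u = col (Suc t) v"
    then show "s' 15 u = s' 15 v" using new[OF that(1)] new[OF that(2)] by simp
  qed
  moreover have "\<forall>u<2 * n. s' 15 u < 2 * n" using new_in by blast
  ultimately have "represents s' (Suc t)"
    using s unfolding represents_def eqs by blast
  then show ?thesis using s'(1) eqs(5) by blast
qed

lemma run_Rounds:
  assumes "represents s 0"
  shows "\<exists>s'. run (For 5 (Reg 13) Round) s (2 + 2 * n * (round_time + 2)) s' \<and> represents s' (2 * n)"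
proof (rule run_For)
  show "aval (Reg 13) s' = 2 * n" if "represents s' i" for i s' using that by (simp add: represents_def)
  show "represents (set_reg s' 5 v) i" if "represents s' i" for i s' v
    using that by (simp add: represents_def)
  show "represents s 0" by fact
  fix i s' assume i: "i < 2 * n" "represents s' i" "s' 5 0 = i"
  show "\<exists>s''. run Round s' round_time s'' \<and> represents s'' (Suc i) \<and> s'' 5 0 = i"
    using run_Round_represents[OF i(2)] i(3) by auto
qed

text \<open>An isomorphism maps neighbourhoods onto neighbourhoods and so transports the colours
  round by round.\<close>

lemma iterated_iso:
  assumes f: "bij_betw f {1..n} {1..n}" "\<forall>u\<in>{1..n}. \<forall>v\<in>{1..n}. {u, v} \<in> E \<longleftrightarrow> {f u, f v} \<in> F"
    and "x \<in> {1..n}"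
  shows "iterated E t x = iterated F t (f x)"
  using assms(3)
proof (induction t arbitrary: x)
  case 0
  show ?case by (simp add: trivial_colouring_def)
next
  case (Suc t)
  have inj: "inj_on f {1..n}" using f(1) by (simp add: bij_betw_def)
  have fx: "f x \<in> {1..n}" using bij_betw_apply[OF f(1) Suc.prems] .
  have sub: "neighbours E x \<subseteq> {1..n}" by (rule neighbours_subset[OF E])
  have "neighbours F (f x) = f ` neighbours E x"
  proof (intro equalityI subsetI)
    fix w assume w: "w \<in> neighbours F (f x)"
    then have "w \<in> {1..n}" using neighbours_subset[OF F] by blast
    then have "w \<in> f ` {1..n}" using f(1) by (simp add: bij_betw_def)
    then obtain y where y: "w = f y" "y \<in> {1..n}" by (rule imageE)
    then have "{x, y} \<in> E" using w f(2) Suc.prems by (auto simp: neighbours_def)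
    then show "w \<in> f ` neighbours E x" using y by (auto simp: neighbours_def)
  next
    fix w assume "w \<in> f ` neighbours E x"
    then obtain y where y: "y \<in> neighbours E x" "w = f y" by blast
    then have "y \<in> {1..n}" using sub by blast
    then show "w \<in> neighbours F (f x)" using y f(2) Suc.prems by (auto simp: neighbours_def)
  qed
  then have "mset_set (neighbours F (f x)) = image_mset f (mset_set (neighbours E x))"
    using image_mset_mset_set[OF inj_on_subset[OF inj sub]] by simp
  then have "image_mset (iterated F t) (mset_set (neighbours F (f x)))
      = image_mset (\<lambda>y. iterated F t (f y)) (mset_set (neighbours E x))"
    by (simp add: image_mset.compositionality comp_def)
  also have "\<dots> = image_mset (iterated E t) (mset_set (neighbours E x))"
    by (rule image_mset_cong) (use Suc.IH sub finite_neighbours[OF E] in auto)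
  finally have eq: "image_mset (iterated F t) (mset_set (neighbours F (f x)))
      = image_mset (iterated E t) (mset_set (neighbours E x))" .
  show ?case unfolding iterated_Suc eq Suc.IH[OF Suc.prems] by (rule refl)
qed

text \<open>The stable colouring is reached after at most \<open>n\<close> rounds, and vertices
  separated once stay separated.\<close>

lemma iterated_inj_on:
  assumes "distinguishes_all_vertices {1..n} E" "t \<ge> n"
  shows "inj_on (iterated E t) {1..n}"
proof -
  obtain t0 where t0: "t0 \<le> card {1..n}" "stable_colouring {1..n} E trivial_colouring = iterated E t0"
    using stable_colouring_properties[of "{1..n}" E] by blast
  have inj: "inj_on (iterated E t0) {1..n}"
    using assms(1) unfolding distinguishes_all_vertices_def t0(2) .
  have le: "t0 \<le> t" using t0(1) assms(2) by simp
  show ?thesis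
  proof (rule inj_onI)
    fix x y assume "x \<in> {1..n}" "y \<in> {1..n}" "iterated E t x = iterated E t y"
    then show "x = y" using iterated_eq_mono[OF le] inj_onD[OF inj] by blast
  qed
qed

text \<open>Sending each vertex of \<open>E\<close> to one of the same colour in \<open>F\<close> is
  injective because the colours of \<open>E\<close> are distinct, hence bijective. Equal colours at
  the last round mean equal multisets of neighbour colours at the round before, and these already
  identify the neighbours.\<close>

lemma colour_matching_iff_iso:
  assumes dist: "distinguishes_all_vertices {1..n} E"
  shows "(\<forall>u<n. \<exists>v<n. col (2 * n) u = col (2 * n) (v + n)) \<longleftrightarrow> graph_iso {1..n} E {1..n} F"
proof
  assume *: "\<forall>u<n. \<exists>v<n. col (2 * n) u = col (2 * n) (v + n)"
  have "\<forall>x\<in>{1..n}. \<exists>y. y \<in> {1..n} \<and> iterated E (2 * n) x = iterated F (2 * n) y"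
  proof
    fix x assume x: "x \<in> {1..n}"
    then obtain z where z: "x = z + 1" "z < n"
      by (intro that[of "x - 1"]) auto
    then obtain v where v: "v < n" "col (2 * n) z = col (2 * n) (v + n)" using * by blast
    then have "iterated E (2 * n) x = iterated F (2 * n) (v + 1)" using z by (simp add: col_def)
    then show "\<exists>y. y \<in> {1..n} \<and> iterated E (2 * n) x = iterated F (2 * n) y"
      using v(1) by (intro exI[of _ "v + 1"]) auto
  qed
  from bchoice[OF this] obtain f where
    "\<forall>x\<in>{1..n}. f x \<in> {1..n} \<and> iterated E (2 * n) x = iterated F (2 * n) (f x)" by (elim exE)
  then have f_in: "f x \<in> {1..n}" and f_col: "iterated E (2 * n) x = iterated F (2 * n) (f x)"
    if "x \<in> {1..n}" for x
    using that by blast+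
  have inj: "inj_on f {1..n}"
  proof (rule inj_onI)
    fix x y assume xy: "x \<in> {1..n}" "y \<in> {1..n}" "f x = f y"
    have "iterated E (2 * n) x = iterated E (2 * n) y"
      by (simp only: f_col[OF xy(1)] f_col[OF xy(2)] xy(3))
    moreover have "inj_on (iterated E (2 * n)) {1..n}" by (rule iterated_inj_on[OF dist]) simp
    ultimately show "x = y" using inj_onD xy(1,2) by metis
  qed
  have "f ` {1..n} \<subseteq> {1..n}" using f_in by blast
  then have "f ` {1..n} = {1..n}" using inj by (intro endo_inj_surj) auto
  then have bij: "bij_betw f {1..n} {1..n}" using inj by (simp add: bij_betw_def)
  show "graph_iso {1..n} E {1..n} F"
    unfolding graph_iso_def
  proof (intro exI[of _ f] conjI ballI bij)
    fix x y assume x: "x \<in> {1..n}" and y: "y \<in> {1..n}"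
    \<comment> \<open>The round before the last. As \<open>x\<close> exists,
      \<open>n \<ge> 1\<close>, so \<open>Suc k = 2 * n\<close> and \<open>k\<close> is still at
      least \<open>n\<close>: the colours of \<open>E\<close> are distinct there too.\<close>
    define k where "k = 2 * n - 1"
    have k: "2 * n = Suc k" "n \<le> k" using x by (auto simp: k_def)
    have injk: "inj_on (iterated E k) {1..n}" using iterated_inj_on[OF dist k(2)] .
    have fk: "iterated E k z = iterated F k (f z)" if "z \<in> {1..n}" for z
      by (rule iterated_eq_Suc[OF f_col[OF that, unfolded k(1)]])
    have "iterated E (Suc k) x = iterated F (Suc k) (f x)" by (rule f_col[OF x, unfolded k(1)])
    then have "image_mset (iterated E k) (mset_set (neighbours E x))
        = image_mset (iterated F k) (mset_set (neighbours F (f x)))"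
      unfolding iterated_Suc by simp
    then have "set_mset (image_mset (iterated E k) (mset_set (neighbours E x)))
        = set_mset (image_mset (iterated F k) (mset_set (neighbours F (f x))))" by (rule arg_cong)
    then have img: "iterated E k ` neighbours E x = iterated F k ` neighbours F (f x)"
      using finite_neighbours[OF E] finite_neighbours[OF F] by simp
    show "{x, y} \<in> E \<longleftrightarrow> {f x, f y} \<in> F"
    proof
      assume "{x, y} \<in> E"
      then have "iterated E k y \<in> iterated F k ` neighbours F (f x)"
        unfolding img[symmetric] by (simp add: neighbours_def)
      then obtain z where z: "z \<in> neighbours F (f x)" "iterated E k y = iterated F k z" by blast
      then have "z \<in> {1..n}" using neighbours_subset[OF F] by blast
      then have "z \<in> f ` {1..n}" using bij by (simp add: bij_betw_def)
      then obtain y' where y': "z = f y'" "y' \<in> {1..n}" by (rule imageE)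
      then have "iterated E k y = iterated E k y'" using z(2) fk by simp
      then have "y = y'" using inj_onD[OF injk] y y' by blast
      then show "{f x, f y} \<in> F" using z(1) y' by (simp add: neighbours_def)
    next
      assume "{f x, f y} \<in> F"
      then have "iterated F k (f y) \<in> iterated E k ` neighbours E x"
        unfolding img by (simp add: neighbours_def)
      then obtain z where z: "z \<in> neighbours E x" "iterated F k (f y) = iterated E k z" by blast
      then have "z \<in> {1..n}" using neighbours_subset[OF E] by blast
      then have "z = y" using inj_onD[OF injk] fk[OF y] z(2) y by simp
      then show "{x, y} \<in> E" using z(1) by (simp add: neighbours_def)
    qed
  qed
next
  assume "graph_iso {1..n} E {1..n} F"
  then obtain f where f: "bij_betw f {1..n} {1..n}" "\<forall>u\<in>{1..n}. \<forall>v\<in>{1..n}. {u, v} \<in> E \<longleftrightarrow> {f u, f v} \<in> F"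
    unfolding graph_iso_def by blast
  show "\<forall>u<n. \<exists>v<n. col (2 * n) u = col (2 * n) (v + n)"
  proof (intro allI impI)
    fix u assume u: "u < n"
    then have u1: "u + 1 \<in> {1..n}" by simp
    have "f (u + 1) \<in> {1..n}" using bij_betw_apply[OF f(1) u1] .
    then obtain v where v: "f (u + 1) = v + 1" "v < n" by (intro that[of "f (u + 1) - 1"]) auto
    then have "col (2 * n) u = col (2 * n) (v + n)"
      using iterated_iso[OF f u1, of "2 * n"] u by (simp add: col_def)
    then show "\<exists>v<n. col (2 * n) u = col (2 * n) (v + n)" using v(2) by blast
  qed
qed

end

section \<open>The complete test and its running time\<close>

definition iso_test :: com where
  "iso_test = If (Eq (Cell 0 (N 0)) (Cell 0 (N 1)))
     (Seq Init (Seq (For 5 (Reg 13) Round) Final)) (Assign 0 (N 0) (N 0))"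

text \<open>One formula over any commutative semiring, so that it can be read both as a number of
  steps and, at \<open>[:0, 1:]\<close>, as the polynomial with these values.\<close>

definition iso_test_time :: "'a :: comm_semiring_1 \<Rightarrow> 'a" where
  "iso_test_time x = 1 + ((4 + 2 * x * 6)
     + ((2 + 2 * x * ((4 + 2 * x * (7 + 2 * x * (8 + 2 * x * (10 + x * 8)))) + 2)) + (4 + x * (7 + x * 4))))"

lemma poly_iso_test_time: "poly (iso_test_time [:0, 1:]) x = iso_test_time (x :: nat)"
  by (simp add: iso_test_time_def)

lemma iso_test_time_mono: "x \<le> y \<Longrightarrow> iso_test_time x \<le> iso_test_time (y :: nat)"
  unfolding iso_test_time_def by (intro add_mono mult_mono le_refl) auto

lemma nth_concat_map_equal_length:
  assumes "\<And>x. x \<in> set xs \<Longrightarrow> length (g x) = k" "i < length xs" "j < k"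
  shows "concat (map g xs) ! (i * k + j) = g (xs ! i) ! j"
  using assms(1,2)
proof (induction xs arbitrary: i)
  case (Cons x xs)
  have x: "length (g x) = k" using Cons.prems(1) by simp
  show ?case
  proof (cases i)
    case 0
    then show ?thesis using x assms(3) by (simp add: nth_append)
  next
    case (Suc i')
    then have "concat (map g xs) ! (i' * k + j) = g (xs ! i') ! j" using Cons by auto
    then show ?thesis using Suc x by (simp add: nth_append)
  qed
qed simp

lemma length_adjacency_word [simp]: "length (adjacency_word n E) = n * n"
  by (simp add: adjacency_word_def length_concat comp_def sum_list_triv)

lemma nth_adjacency_word:
  assumes "i < n" "j < n"
  shows "adjacency_word n E ! (i * n + j) = (if {i + 1, j + 1} \<in> E then 1 else 0)"
proof -
  let ?g = "\<lambda>i. map (\<lambda>j. if {i, j} \<in> E then 1 else 0 :: nat) [1..<Suc n]"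
  have "adjacency_word n E ! (i * n + j) = ?g ([1..<Suc n] ! i) ! j"
    unfolding adjacency_word_def
    by (rule nth_concat_map_equal_length) (use assms in simp_all)
  then show ?thesis using assms by (simp del: upt_Suc)
qed

lemma initial_memory_encode_pair:
  "initial_memory (encode_pair n E m F) 0 0 = n" "initial_memory (encode_pair n E m F) 0 1 = m"
  by (simp_all add: initial_memory_def encode_pair_def)

text \<open>Both matrices have \<open>n\<close> rows of length \<open>n\<close>, so the rows of the
  second continue the spacing of the first and row \<open>u\<close> starts at
  \<open>2 + u * n\<close> throughout.\<close>

lemma initial_memory_adjacency:
  assumes E: "E \<subseteq> all_edges n" and F: "F \<subseteq> all_edges n" and "u < 2 * n" "j < n"
  shows "0 < initial_memory (encode_pair n E n F) 0 (2 + u * n + j) \<longleftrightarrow> adj n E F u j"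
proof -
  let ?w = "encode_pair n E n F"
  have "u * n + j < (u + 1) * n" using assms by simp
  also have "\<dots> \<le> 2 * n * n" using assms by (intro mult_right_mono) auto
  finally have lt: "u * n + j < n * n + n * n" by (simp add: algebra_simps)
  then have "2 + u * n + j < length ?w" by (simp add: encode_pair_def)
  then have "initial_memory ?w 0 (2 + u * n + j) = (adjacency_word n E @ adjacency_word n F) ! (u * n + j)"
    by (simp add: initial_memory_def encode_pair_def)
  also have "\<dots> = (if adj n E F u j then 1 else 0)"
  proof (cases "u < n")
    case True
    have "u * n + j < (u + 1) * n" using assms by simp
    also have "\<dots> \<le> n * n" using True by (intro mult_right_mono) auto
    finally show ?thesis using True assms by (simp add: nth_append nth_adjacency_word adj_def[OF E F])
  next
    case False
    then obtain i where i: "u = n + i" by (metis le_add_diff_inverse not_less)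
    then have "i < n" "u * n + j = n * n + (i * n + j)" using assms by (simp_all add: algebra_simps)
    then show ?thesis using False assms i by (simp add: nth_append nth_adjacency_word adj_def[OF E F])
  qed
  finally show ?thesis by simp
qed

lemma run_iso_test:
  assumes E: "E \<subseteq> all_edges n" and F: "F \<subseteq> all_edges n" and dist: "distinguishes_all_vertices {1..n} E"
  shows "\<exists>s. run iso_test (initial_memory (encode_pair n E n F)) (iso_test_time n) s
    \<and> s 0 0 = (if graph_iso {1..n} E {1..n} F then 1 else 0)"
proof -
  let ?s0 = "initial_memory (encode_pair n E n F)"
  have n: "?s0 0 0 = n" by (rule initial_memory_encode_pair)
  obtain s1 where s1: "run Init ?s0 (4 + 2 * n * 6) s1" "same_except {3, 4, 6, 13, 14} s1 ?s0" "s1 13 0 = 2 * n"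
    "\<forall>u<2 * n. s1 3 u = 2 + u * n \<and> s1 4 u = (if u < n then 0 else n)"
    using run_Init[of ?s0 n] n by blast
  have eqs: "s1 0 = ?s0 0" "s1 15 = (\<lambda>_. 0)"
    using s1(2) by (auto simp: same_except_def initial_memory_def)
  \<comment> \<open>Array 15 is still all 0, which represents the trivial colouring.\<close>
  have "represents n E F s1 0"
    unfolding represents_def[OF E F]
    using s1(3,4) n initial_memory_adjacency[OF E F] unfolding eqs
    by (auto simp: offset_def[OF E F] col_def[OF E F] trivial_colouring_def)
  from run_Rounds[OF E F this] obtain s2 where
    s2: "run (For 5 (Reg 13) Round) s1 (2 + 2 * n * ((4 + 2 * n * (7 + 2 * n * (8 + 2 * n * (10 + n * 8)))) + 2)) s2"
    "represents n E F s2 (2 * n)" by blast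
  have n2: "s2 0 0 = n" using s2(2) by (simp add: represents_def[OF E F])
  obtain s3 where s3: "run Final s2 (4 + n * (7 + n * 4)) s3"
    "s3 0 0 = (if \<forall>u<n. \<exists>v<n. s2 15 u = s2 15 (v + n) then 1 else 0)"
    using run_Final[of s2 n, OF n2] by blast
  have "s2 15 u = s2 15 (v + n) \<longleftrightarrow> col n E F (2 * n) u = col n E F (2 * n) (v + n)" if "u < n" "v < n" for u v
    using s2(2) that by (simp add: represents_def[OF E F])
  then have "(\<forall>u<n. \<exists>v<n. s2 15 u = s2 15 (v + n)) \<longleftrightarrow> graph_iso {1..n} E {1..n} F"
    unfolding colour_matching_iff_iso[OF E F dist, symmetric] by blast
  then have "s3 0 0 = (if graph_iso {1..n} E {1..n} F then 1 else 0)" using s3(2) by simp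
  moreover have "run iso_test ?s0 (iso_test_time n) s3"
    unfolding iso_test_def iso_test_time_def
  proof (rule run_If)
    show "run (Seq Init (Seq (For 5 (Reg 13) Round) Final)) ?s0 (4 + 2 * n * 6
      + (2 + 2 * n * (4 + 2 * n * (7 + 2 * n * (8 + 2 * n * (10 + n * 8))) + 2) + (4 + n * (7 + n * 4)))) s3"
      by (rule run_Seq[OF s1(1) run_Seq[OF s2(1) s3(1)]])
  qed (use initial_memory_encode_pair[of n E n F] in simp)
  ultimately show ?thesis by blast
qed

text \<open>For \<open>m = n\<close> the colour test decides; otherwise there is no bijection and
  the program answers 0 at once. The time bound in \<open>n\<close> is monotone, and
  \<open>n\<close> is at most the length of the input.\<close>

lemma iso_test_correct:
  assumes E: "E \<subseteq> all_edges n" and dist: "distinguishes_all_vertices {1..n} E"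
  shows "tests_isomorphism iso_test (iso_test_time [:0, 1:]) n E"
  unfolding tests_isomorphism_def
proof (intro allI impI)
  fix m F assume F: "F \<subseteq> all_edges m"
  let ?w = "encode_pair n E m F"
  have "n \<le> length ?w"
  proof -
    have "n \<le> n * n" by (rule le_square)
    moreover have "length ?w = 2 + n * n + m * m" by (simp add: encode_pair_def)
    ultimately show ?thesis by linarith
  qed
  then have le: "iso_test_time n \<le> poly (iso_test_time [:0, 1:]) (length ?w)"
    unfolding poly_iso_test_time by (rule iso_test_time_mono)
  have "\<exists>s. run iso_test (initial_memory ?w) (iso_test_time n) s
      \<and> s 0 0 = (if graph_iso {1..n} E {1..m} F then 1 else 0)"
  proof (cases "n = m")
    case True
    then show ?thesis using run_iso_test[OF E _ dist, of F] F by simp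
  next
    case False
    have "\<not> graph_iso {1..n} E {1..m} F"
      using False bij_betw_same_card[of _ "{1..n}" "{1..m}"] by (auto simp: graph_iso_def)
    moreover have "run iso_test (initial_memory ?w) (iso_test_time n) (set_reg (initial_memory ?w) 0 0)"
    proof -
      have "run iso_test (initial_memory ?w) (1 + 1) (set_reg (initial_memory ?w) 0 0)"
        unfolding iso_test_def
        by (rule run_If)
          (use False initial_memory_encode_pair[of n E m F] run_Assign[of 0 "N 0" "N 0" "initial_memory ?w"]
            in \<open>simp_all add: set_reg_def\<close>)
      then show ?thesis by (rule run_mono) (simp add: iso_test_time_def)
    qed
    ultimately show ?thesis by (intro exI[of _ "set_reg (initial_memory ?w) 0 0"]) simp
  qed
  then obtain s t where "exec iso_test (initial_memory ?w) t s" "t \<le> iso_test_time n"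
    "s 0 0 = (if graph_iso {1..n} E {1..m} F then 1 else 0)" by (auto elim: runE)
  then show "\<exists>t s. exec iso_test (initial_memory ?w) t s \<and> t \<le> poly (iso_test_time [:0, 1:]) (length ?w)
      \<and> s 0 0 = (if graph_iso {1..n} E {1..m} F then 1 else 0)" using le by (meson le_trans)
qed

text \<open>The program and the polynomial are fixed once and for all and work for every graph with
  discrete stable colouring, so the second claim follows from the first by monotonicity.\<close>

theorem theorem1p2:
  shows "(\<forall>(\<epsilon>::real) (p :: nat \<Rightarrow> real) (G0 :: nat \<Rightarrow> nat set set).
            \<epsilon> > 0
            \<and> (\<forall>\<^sub>F n in sequentially. 0 \<le> p n \<and> p n \<le> 1/2 \<and> (1 + \<epsilon>) * ln (real n) / real n \<le> p n)
            \<and> (\<forall>n. G0 n \<subseteq> all_edges n)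
          \<longrightarrow> whp (\<lambda>n. random_graph n (p n))
                (\<lambda>n R. distinguishes_all_vertices {1..n} (sym_diff (G0 n) R)))
       \<and> (\<exists>P q. \<forall>(\<epsilon>::real) (p :: nat \<Rightarrow> real) (G0 :: nat \<Rightarrow> nat set set).
            \<epsilon> > 0
            \<and> (\<forall>\<^sub>F n in sequentially. 0 \<le> p n \<and> p n \<le> 1/2 \<and> (1 + \<epsilon>) * ln (real n) / real n \<le> p n)
            \<and> (\<forall>n. G0 n \<subseteq> all_edges n)
          \<longrightarrow> whp (\<lambda>n. random_graph n (p n))
                (\<lambda>n R. tests_isomorphism P q n (sym_diff (G0 n) R)))"
proof (intro conjI exI[of _ iso_test] exI[of _ "iso_test_time [:0, 1:]"] allI impI; elim conjE)
  fix \<epsilon> :: real and p :: "nat \<Rightarrow> real" and G0 :: "nat \<Rightarrow> nat set set"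
  assume asm: "\<epsilon> > 0"
    "\<forall>\<^sub>F n in sequentially. 0 \<le> p n \<and> p n \<le> 1/2 \<and> (1 + \<epsilon>) * ln (real n) / real n \<le> p n"
    "\<forall>n. G0 n \<subseteq> all_edges n"
  show whp: "whp (\<lambda>n. random_graph n (p n)) (\<lambda>n R. distinguishes_all_vertices {1..n} (sym_diff (G0 n) R))"
    using whp_distinguishes_all_vertices[OF asm(1,2)] asm(3) by blast
  show "whp (\<lambda>n. random_graph n (p n)) (\<lambda>n R. tests_isomorphism iso_test (iso_test_time [:0, 1:]) n (sym_diff (G0 n) R))"
  proof (rule whp_mono[OF whp])
    fix n R assume "R \<subseteq> all_edges n" "distinguishes_all_vertices {1..n} (sym_diff (G0 n) R)"
    then show "tests_isomorphism iso_test (iso_test_time [:0, 1:]) n (sym_diff (G0 n) R)"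
      using asm(3) by (intro iso_test_correct) auto
  qed
qed

end
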